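(* Let $N_5(B)$ be the number of subrings of $\mathbb{Z}^5$ (componentwise operations) containing $(1,1,1,1,1)$, of finite index at most $B$. There is a polynomial $P_5$ of degree $9$ such that for every $\epsilon>0$, $$N_5(B)=B\,P_5(\log B)+O_\epsilon(B^{\frac{33}{34}+\epsilon})$$ as $B\to\infty$. *)

theory Defs
  imports
    "HOL-Analysis.Analysis"
    "HOL-Library.Landau_Symbols"
    "HOL-Computational_Algebra.Polynomial"
    "HOL-Algebra.AbelCoset"
    "HOL-Algebra.Subrings"
begin

definition Z5 :: "(int ^ 5) ring"
  where "Z5 = \<lparr>carrier = UNIV, mult = (*), one = 1, zero = 0, add = (+)\<rparr>"

lemma cring_Z5: "cring Z5"
proof (rule cringI)
  show "abelian_group Z5"
    by (rule abelian_groupI)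
      (auto simp: Z5_def algebra_simps intro: exI[of _ "- x" for x])
  show "Group.comm_monoid Z5"
    by (rule comm_monoidI) (auto simp: Z5_def algebra_simps)
qed (auto simp: Z5_def algebra_simps)

text \<open>
  The locale \<open>subring\<close> already requires the identity of the ambient ring, here \<open>(1,1,1,1,1)\<close>,
  to be an element.  The index is the additive one; its finiteness has to be demanded separately
  because \<open>card\<close> of an infinite set is \<open>0\<close>.
\<close>

definition N5 :: "real \<Rightarrow> nat"
  where "N5 B = card {S. subring S Z5 \<and> finite (a_rcosets\<^bsub>Z5\<^esub> S)
                         \<and> real (card (a_rcosets\<^bsub>Z5\<^esub> S)) \<le> B}"

end

theory Submission
  imports Defs "HOL-Number_Theory.Cong"
begin

text \<open>
  Let \<open>f n\<close> be the number of unital subrings of index \<open>n\<close>.  It is multiplicative, \<open>f p = 10\<close> for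
  every prime \<open>p\<close> (the subrings \<open>{x. x\<^sub>i \<equiv> x\<^sub>j (mod p)}\<close>), and \<open>f (p ^ k)\<close> is at most a polynomial
  in \<open>k\<close> times \<open>p ^ e\<close> with \<open>e = 19 * (k - 1) div 20\<close>.  Hence \<open>f\<close> is the Dirichlet convolution of
  the tenfold divisor function with a function \<open>h\<close> vanishing at primes for which
  \<open>\<Sum>n. \<bar>h n\<bar> * n powr (-97/100)\<close> converges, and the asymptotic expansion of the divisor problem,
  obtained by the hyperbola method, carries over with error term \<open>O(B powr (97/100))\<close>; note
  \<open>97/100 < 33/34\<close>.

  For the bound on \<open>f (p ^ k)\<close>, a subring has a basis in Hermite normal form
  \<open>(1,1,1,1,1)\<close>, \<open>(0,p^a,y,z,u)\<close>, \<open>(0,0,p^b,w,v)\<close>, \<open>(0,0,0,p^c,t)\<close>, \<open>(0,0,0,0,p^d)\<close>, and closure under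
  multiplication makes \<open>y\<close>, \<open>t\<close> and the pairs \<open>(w,v)\<close>, \<open>(z,u)\<close> solutions of quadratic congruences.
  Counting the solutions gives the exponent \<open>19/20 * (b + c + d)\<close>.  A proper subring of \<open>p\<close>-power index
  satisfies some congruence \<open>x\<^sub>i \<equiv> x\<^sub>j (mod p)\<close>, so after reordering the coordinates
  \<open>a \<ge> 1\<close>, whence \<open>b + c + d \<le> k - 1\<close>.
\<close>

text \<open>The saving of one in \<open>19 * (k - 1) div 20\<close> is decisive: for the series of
  \<open>h\<close> to converge at 97/100, the bound has to keep the exponent of \<open>p\<close>
  below -1 for every \<open>k \<ge> 2\<close>, and with \<open>19 * k div 20\<close> it would be 19
  - 19.4 at \<open>k = 20\<close>. So the congruence between two coordinates matters as much as the
  count of solutions. The fraction 19/20 comes from balancing two bounds for the pairs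
  \<open>(w,v)\<close>, one good for small \<open>b\<close>, the other for small \<open>c\<close>,
  against those for the remaining entries.

  The divisor problem is treated with the weights \<open>1 / n\<close>. Then all sums are
  polynomials in the logarithm up to a power saving, and functions with this property, for every
  extra power of the logarithm, are stable under convolution at the price of halving the saving.
  Four halvings take 9/10 to 9/160, which still exceeds 3/100 = 1 - 97/100. Summation by parts
  removes the weights at the very end. The degree is not visible in this construction; it is found
  by comparing growth from above and below.\<close>

no_notation fps_nth (infixl "$" 75)
hide_const (open) up_ring.coeff up_ring.monom module.smult

section \<open>Polynomials in the logarithm\<close>

definition summatory :: "(nat \<Rightarrow> real) \<Rightarrow> real \<Rightarrow> real" where
  "summatory a x = (\<Sum>n\<in>{1..nat \<lfloor>x\<rfloor>}. a n)"

lemma in_floor_range_iff: "n \<in> {1..nat \<lfloor>x\<rfloor>} \<longleftrightarrow> 1 \<le> n \<and> real n \<le> x"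
  by (auto simp: nat_le_iff le_floor_iff nat_less_iff) (linarith | simp add: le_nat_iff le_floor_iff)+

text \<open>Each further factor \<open>L\<close> costs half of the exponent, by
  \<open>L \<le> 2 / \<epsilon> * exp (\<epsilon> / 2 * L)\<close> for positive \<open>L\<close>.
  The absolute value in the exponent keeps the bound usable at \<open>L = ln z\<close> with
  \<open>z < 1\<close>.\<close>

lemma poly_abs_le_exp:
  fixes Q :: "real poly"
  assumes "\<epsilon> > 0"
  shows "\<exists>C\<ge>0. \<forall>L. \<bar>poly Q L\<bar> \<le> C * exp (\<epsilon> * \<bar>L\<bar>)"
  using assms
proof (induction Q arbitrary: \<epsilon>)
  case 0
  show ?case by (auto intro!: exI[of _ 0])
next
  case (pCons a Q)
  obtain C where C: "C \<ge> 0" "\<And>L. \<bar>poly Q L\<bar> \<le> C * exp (\<epsilon> / 2 * \<bar>L\<bar>)"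
    using pCons(2)[of "\<epsilon> / 2"] pCons.prems by auto
  show ?case
  proof (intro exI[of _ "\<bar>a\<bar> + 2 / \<epsilon> * C"] conjI allI)
    show "0 \<le> \<bar>a\<bar> + 2 / \<epsilon> * C" using C pCons.prems by simp
    fix L
    have "\<epsilon> / 2 * \<bar>L\<bar> \<le> exp (\<epsilon> / 2 * \<bar>L\<bar>)" using exp_ge_add_one_self[of "\<epsilon> / 2 * \<bar>L\<bar>"] by linarith
    hence L: "\<bar>L\<bar> \<le> 2 / \<epsilon> * exp (\<epsilon> / 2 * \<bar>L\<bar>)" using pCons.prems by (simp add: field_simps)
    have "\<bar>L * poly Q L\<bar> \<le> (2 / \<epsilon> * exp (\<epsilon> / 2 * \<bar>L\<bar>)) * (C * exp (\<epsilon> / 2 * \<bar>L\<bar>))"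
      unfolding abs_mult using L C pCons.prems by (intro mult_mono) auto
    also have "\<dots> = 2 / \<epsilon> * C * (exp (\<epsilon> / 2 * \<bar>L\<bar>) * exp (\<epsilon> / 2 * \<bar>L\<bar>))" by simp
    also have "exp (\<epsilon> / 2 * \<bar>L\<bar>) * exp (\<epsilon> / 2 * \<bar>L\<bar>) = exp (\<epsilon> * \<bar>L\<bar>)" by (simp flip: exp_add)
    finally have 1: "\<bar>L * poly Q L\<bar> \<le> 2 / \<epsilon> * C * exp (\<epsilon> * \<bar>L\<bar>)" .
    have 2: "\<bar>a\<bar> \<le> \<bar>a\<bar> * exp (\<epsilon> * \<bar>L\<bar>)" using pCons.prems by (simp add: mult_le_cancel_left1)
    show "\<bar>poly (pCons a Q) L\<bar> \<le> (\<bar>a\<bar> + 2 / \<epsilon> * C) * exp (\<epsilon> * \<bar>L\<bar>)"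
      using 1 2 by (simp add: algebra_simps)
  qed
qed

lemma poly_ln_le_powr:
  fixes Q :: "real poly"
  assumes "\<epsilon> > 0"
  shows "\<exists>C\<ge>0. \<forall>x\<ge>1. \<bar>poly Q (ln x)\<bar> \<le> C * x powr \<epsilon>"
proof -
  obtain C where C: "C \<ge> 0" "\<And>L. \<bar>poly Q L\<bar> \<le> C * exp (\<epsilon> * \<bar>L\<bar>)"
    using poly_abs_le_exp[OF assms] by blast
  show ?thesis
  proof (intro exI[of _ C] conjI allI impI C)
    fix x :: real assume x: "x \<ge> 1"
    have "\<bar>poly Q (ln x)\<bar> \<le> C * exp (\<epsilon> * \<bar>ln x\<bar>)" by (rule C)
    thus "\<bar>poly Q (ln x)\<bar> \<le> C * x powr \<epsilon>" using x by (simp add: powr_def)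
  qed
qed

text \<open>Separation of variables: with \<open>L = ln x\<close> and \<open>M = ln m\<close>, a sum
  over \<open>m\<close> of values at \<open>ln (x / m)\<close> becomes a polynomial in
  \<open>ln x\<close> whose coefficients are sums of powers of \<open>ln m\<close>.\<close>

lemma poly_diff_expand:
  fixes Q :: "real poly"
  shows "\<exists>n R. \<forall>L M. poly Q (L - M) = (\<Sum>s<(n::nat). poly (R s) L * M ^ s)"
proof (induction Q)
  case 0
  show ?case by (intro exI[of _ 0]) auto
next
  case (pCons a Q)
  then obtain n R where R: "\<And>L M. poly Q (L - M) = (\<Sum>s<(n::nat). poly (R s) L * M ^ s)" by blast
  define R' where "R' = (\<lambda>s. (if s = 0 then [:a:] else 0) + (if s < n then [:0, 1:] * R s else 0) - (if s
      = 0 then 0 else R (s - 1)))"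
  show ?case
  proof (intro exI[of _ "Suc n"] exI[of _ R'] allI)
    fix L M :: real
    have "(\<Sum>s<Suc n. poly (R' s) L * M ^ s) = (\<Sum>s<Suc n. (if s = 0 then a else 0)) +
        (\<Sum>s<Suc n. if s < n then L * (poly (R s) L * M ^ s) else 0) -
        (\<Sum>s<Suc n. (if s = 0 then 0 else poly (R (s - 1)) L * M ^ s))"
      unfolding sum.distrib[symmetric] sum_subtractf[symmetric]
      by (intro sum.cong) (auto simp: R'_def algebra_simps)
    also have "(\<Sum>s<Suc n. (if s = 0 then a else 0)) = a" by (simp add: sum.delta)
    also have "(\<Sum>s<Suc n. if s < n then L * (poly (R s) L * M ^ s) else 0) = L * poly Q (L - M)"
      unfolding R sum_distrib_left by simp
    also have "(\<Sum>s<Suc n. (if s = 0 then 0 else poly (R (s - 1)) L * M ^ s)) = M * poly Q (L - M)"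
      unfolding R sum_distrib_left sum.lessThan_Suc_shift by (simp add: algebra_simps)
    finally show "poly (pCons a Q) (L - M) = (\<Sum>s<Suc n. poly (R' s) L * M ^ s)"
      by (simp add: algebra_simps)
  qed
qed

text \<open>Asking for every \<open>\<delta>' < \<delta>\<close> instead of one fixed exponent makes
  the class stable under multiplication by polynomials in \<open>ln x\<close>. The point
  \<open>x = 1\<close> forces the constants to be nonnegative.\<close>

definition small_error :: "real \<Rightarrow> (real \<Rightarrow> real) \<Rightarrow> bool" where
  "small_error \<delta> E \<longleftrightarrow> (\<forall>\<delta>'<\<delta>. \<exists>C. \<forall>x\<ge>1. \<bar>E x\<bar> \<le> C * x powr (- \<delta>'))"

lemma small_errorE:
  assumes "small_error \<delta> E" "\<delta>' < \<delta>"
  obtains C where "C \<ge> 0" "\<And>x. x \<ge> 1 \<Longrightarrow> \<bar>E x\<bar> \<le> C * x powr (- \<delta>')"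
proof -
  obtain C where C: "\<And>x. x \<ge> 1 \<Longrightarrow> \<bar>E x\<bar> \<le> C * x powr (- \<delta>')"
    using assms unfolding small_error_def by blast
  have "C \<ge> 0" using C[of 1] by simp
  thus ?thesis using that C by blast
qed

lemma small_error_cong: "small_error \<delta> E \<Longrightarrow> (\<And>x. x \<ge> 1 \<Longrightarrow> E x = F x) \<Longrightarrow> small_error \<delta> F"
  unfolding small_error_def by (metis (no_types, lifting))

lemma small_error_zero [simp]: "small_error \<delta> (\<lambda>x. 0)"
  unfolding small_error_def by (auto intro!: exI[of _ 0])

lemma small_error_add:
  assumes "small_error \<delta> E" "small_error \<delta> F"
  shows "small_error \<delta> (\<lambda>x. E x + F x)"
  unfolding small_error_def
proof safe
  fix \<delta>' assume d: "\<delta>' < \<delta>"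
  obtain C1 where C1: "\<And>x. x \<ge> 1 \<Longrightarrow> \<bar>E x\<bar> \<le> C1 * x powr (- \<delta>')" using small_errorE[OF assms(1) d] by blast
  obtain C2 where C2: "\<And>x. x \<ge> 1 \<Longrightarrow> \<bar>F x\<bar> \<le> C2 * x powr (- \<delta>')" using small_errorE[OF assms(2) d] by blast
  show "\<exists>C. \<forall>x\<ge>1. \<bar>E x + F x\<bar> \<le> C * x powr (- \<delta>')"
    using C1 C2 by (intro exI[of _ "C1 + C2"]) (fastforce simp: algebra_simps)
qed

lemma small_error_poly_mult:
  assumes "small_error \<delta> E"
  shows "small_error \<delta> (\<lambda>x. poly Q (ln x) * E x)"
  unfolding small_error_def
proof safe
  fix \<delta>' assume d: "\<delta>' < \<delta>"
  define m where "m = (\<delta> + \<delta>') / 2"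
  have m: "m < \<delta>" "m - \<delta>' > 0" using d by (auto simp: m_def field_simps)
  obtain C1 where C1: "C1 \<ge> 0" "\<And>x. x \<ge> 1 \<Longrightarrow> \<bar>E x\<bar> \<le> C1 * x powr (- m)" using small_errorE[OF assms(1)
      m(1)] by blast
  obtain C2 where C2: "C2 \<ge> 0" "\<And>x. x \<ge> 1 \<Longrightarrow> \<bar>poly Q (ln x)\<bar> \<le> C2 * x powr (m - \<delta>')"
    using poly_ln_le_powr[OF m(2)] by blast
  show "\<exists>C. \<forall>x\<ge>1. \<bar>poly Q (ln x) * E x\<bar> \<le> C * x powr (- \<delta>')"
  proof (intro exI[of _ "C2 * C1"] allI impI)
    fix x :: real assume x: "x \<ge> 1"
    have "\<bar>poly Q (ln x) * E x\<bar> \<le> (C2 * x powr (m - \<delta>')) * (C1 * x powr (- m))"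
      unfolding abs_mult using C1 C2 x by (intro mult_mono) auto
    also have "\<dots> = C2 * C1 * x powr (m - \<delta>' + - m)" unfolding powr_add by simp
    finally show "\<bar>poly Q (ln x) * E x\<bar> \<le> C2 * C1 * x powr (- \<delta>')" by simp
  qed
qed

lemma small_error_mult:
  assumes "small_error \<delta> E" "small_error \<delta> F" "\<delta> > 0"
  shows "small_error \<delta> (\<lambda>x. E x * F x)"
  unfolding small_error_def
proof safe
  fix \<delta>' assume d: "\<delta>' < \<delta>"
  obtain C1 where C1: "C1 \<ge> 0" "\<And>x. x \<ge> 1 \<Longrightarrow> \<bar>E x\<bar> \<le> C1 * x powr (- \<delta>')" using small_errorE[OF assms(1) d]
      by blast
  obtain C2 where C2: "C2 \<ge> 0" "\<And>x. x \<ge> 1 \<Longrightarrow> \<bar>F x\<bar> \<le> C2 * x powr (- 0)"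
    using small_errorE[OF assms(2,3)] by blast
  show "\<exists>C. \<forall>x\<ge>1. \<bar>E x * F x\<bar> \<le> C * x powr (- \<delta>')"
  proof (intro exI[of _ "C1 * C2"] allI impI)
    fix x :: real assume x: "x \<ge> 1"
    have "\<bar>E x * F x\<bar> \<le> (C1 * x powr (- \<delta>')) * C2"
      unfolding abs_mult using C1 C2(1) C2(2)[OF x] x by (intro mult_mono) auto
    thus "\<bar>E x * F x\<bar> \<le> C1 * C2 * x powr (- \<delta>')" by (simp add: algebra_simps)
  qed
qed

lemma small_error_sqrt:
  assumes "small_error \<delta> E"
  shows "small_error (\<delta> / 2) (\<lambda>x. E (sqrt x))"
  unfolding small_error_def
proof safe
  fix \<delta>' assume d: "\<delta>' < \<delta> / 2"
  hence "2 * \<delta>' < \<delta>" by simp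
  then obtain C where C: "\<And>x. x \<ge> 1 \<Longrightarrow> \<bar>E x\<bar> \<le> C * x powr (- (2 * \<delta>'))"
    using small_errorE[OF assms] by blast
  show "\<exists>C. \<forall>x\<ge>1. \<bar>E (sqrt x)\<bar> \<le> C * x powr (- \<delta>')"
  proof (intro exI[of _ C] allI impI)
    fix x :: real assume x: "x \<ge> 1"
    have "\<bar>E (sqrt x)\<bar> \<le> C * sqrt x powr (- (2 * \<delta>'))" using C[of "sqrt x"] x by simp
    also have "sqrt x powr (- (2 * \<delta>')) = x powr (- \<delta>')"
      using x by (simp add: powr_half_sqrt[symmetric] powr_powr)
    finally show "\<bar>E (sqrt x)\<bar> \<le> C * x powr (- \<delta>')" .
  qed
qed

lemma small_error_mono: "small_error \<delta> E \<Longrightarrow> \<delta>2 \<le> \<delta> \<Longrightarrow> small_error \<delta>2 E"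
  unfolding small_error_def by fastforce

definition poly_log :: "real \<Rightarrow> (real \<Rightarrow> real) \<Rightarrow> bool" where
  "poly_log \<delta> F \<longleftrightarrow> (\<exists>Q. small_error \<delta> (\<lambda>x. F x - poly Q (ln x)))"

lemma poly_log_cong: "poly_log \<delta> F \<Longrightarrow> (\<And>x. x \<ge> 1 \<Longrightarrow> F x = G x) \<Longrightarrow> poly_log \<delta> G"
  unfolding poly_log_def by (metis (no_types, lifting) small_error_cong)

lemma poly_log_mono: "poly_log \<delta> F \<Longrightarrow> \<delta>2 \<le> \<delta> \<Longrightarrow> poly_log \<delta>2 F"
  unfolding poly_log_def using small_error_mono by blast

lemma poly_log_small_error: "small_error \<delta> F \<Longrightarrow> poly_log \<delta> F"
  unfolding poly_log_def by (intro exI[of _ 0]) simp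

lemma poly_log_add:
  assumes "poly_log \<delta> F" "poly_log \<delta> G"
  shows "poly_log \<delta> (\<lambda>x. F x + G x)"
proof -
  obtain P Q where "small_error \<delta> (\<lambda>x. F x - poly P (ln x))" "small_error \<delta> (\<lambda>x. G x - poly Q (ln x))"
    using assms unfolding poly_log_def by blast
  from small_error_add[OF this] have "small_error \<delta> (\<lambda>x. (F x + G x) - poly (P + Q) (ln x))"
    by (simp add: algebra_simps)
  thus ?thesis unfolding poly_log_def by blast
qed

lemma poly_log_poly_mult:
  assumes "poly_log \<delta> F"
  shows "poly_log \<delta> (\<lambda>x. poly Q (ln x) * F x)"
proof -
  obtain P where "small_error \<delta> (\<lambda>x. F x - poly P (ln x))"
    using assms unfolding poly_log_def by blast
  from small_error_poly_mult[OF this, of Q]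
  have "small_error \<delta> (\<lambda>x. poly Q (ln x) * F x - poly (Q * P) (ln x))" by (simp add: algebra_simps)
  thus ?thesis unfolding poly_log_def by blast
qed

lemma poly_log_cmult: "poly_log \<delta> F \<Longrightarrow> poly_log \<delta> (\<lambda>x. c * F x)"
  using poly_log_poly_mult[of \<delta> F "[:c:]"] by simp

lemma poly_log_sum:
  assumes "\<And>i. i \<in> I \<Longrightarrow> poly_log \<delta> (F i)"
  shows "poly_log \<delta> (\<lambda>x. \<Sum>i\<in>I. F i x)"
  using assms
proof (induction I rule: infinite_finite_induct)
  case (insert i I)
  thus ?case using poly_log_add[of \<delta> "F i" "\<lambda>x. \<Sum>i\<in>I. F i x"] by simp
qed (auto intro: poly_log_small_error)

lemma poly_log_mult:
  assumes "poly_log \<delta> F" "poly_log \<delta> G" "\<delta> > 0"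
  shows "poly_log \<delta> (\<lambda>x. F x * G x)"
proof -
  obtain P Q where PQ: "small_error \<delta> (\<lambda>x. F x - poly P (ln x))" "small_error \<delta> (\<lambda>x. G x - poly Q (ln x))"
    using assms unfolding poly_log_def by blast
  have "small_error \<delta> (\<lambda>x. (F x - poly P (ln x)) * (G x - poly Q (ln x)) +
      (poly P (ln x) * (G x - poly Q (ln x)) + poly Q (ln x) * (F x - poly P (ln x))))"
    by (intro small_error_add small_error_mult small_error_poly_mult PQ assms)
  hence "small_error \<delta> (\<lambda>x. F x * G x - poly (P * Q) (ln x))" by (simp add: algebra_simps)
  thus ?thesis unfolding poly_log_def by blast
qed

lemma poly_log_sqrt:
  assumes "poly_log \<delta> F"
  shows "poly_log (\<delta> / 2) (\<lambda>x. F (sqrt x))"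
proof -
  obtain P where "small_error \<delta> (\<lambda>x. F x - poly P (ln x))"
    using assms unfolding poly_log_def by blast
  from small_error_sqrt[OF this] have "small_error (\<delta> / 2) (\<lambda>x. F (sqrt x) - poly (pcompose P [:0, 1/2:])
      (ln x))"
    by (rule small_error_cong) (simp add: poly_pcompose ln_sqrt)
  thus ?thesis unfolding poly_log_def by blast
qed

lemma poly_log_growth:
  assumes "poly_log \<delta> F" "\<delta> > 0" "\<epsilon> > 0"
  obtains C where "C \<ge> 0" "\<And>x. x \<ge> 1 \<Longrightarrow> \<bar>F x\<bar> \<le> C * x powr \<epsilon>"
proof -
  obtain P where P: "small_error \<delta> (\<lambda>x. F x - poly P (ln x))"
    using assms unfolding poly_log_def by blast
  obtain C1 where C1: "C1 \<ge> 0" "\<And>x. x \<ge> 1 \<Longrightarrow> \<bar>F x - poly P (ln x)\<bar> \<le> C1 * x powr (- 0)"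
    using small_errorE[OF P assms(2)] by blast
  obtain C2 where C2: "C2 \<ge> 0" "\<And>x. x \<ge> 1 \<Longrightarrow> \<bar>poly P (ln x)\<bar> \<le> C2 * x powr \<epsilon>"
    using poly_ln_le_powr[OF assms(3)] by blast
  show ?thesis
  proof (rule that[of "C1 + C2"])
    fix x :: real assume x: "x \<ge> 1"
    have "C1 * 1 \<le> C1 * x powr \<epsilon>" using C1 x assms by (intro mult_left_mono ge_one_powr_ge_zero) auto
    thus "\<bar>F x\<bar> \<le> (C1 + C2) * x powr \<epsilon>"
      using C1(2)[OF x] C2(2)[OF x] x by (simp add: algebra_simps)
  qed (use C1 C2 in simp)
qed

section \<open>Convolutions and the hyperbola method\<close>

definition dirichlet_conv :: "(nat \<Rightarrow> real) \<Rightarrow> (nat \<Rightarrow> real) \<Rightarrow> nat \<Rightarrow> real" where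
  "dirichlet_conv a b n = (\<Sum>d | d dvd n. a d * b (n div d))"

definition hyperbola_region :: "real \<Rightarrow> (nat \<times> nat) set" where
  "hyperbola_region x = {(m, n). 1 \<le> m \<and> 1 \<le> n \<and> real (m * n) \<le> x}"

lemma hyperbola_region_Sigma:
  "hyperbola_region x = (SIGMA m:{1..nat \<lfloor>x\<rfloor>}. {1..nat \<lfloor>x / real m\<rfloor>})"
proof -
  have "real m \<le> x" if "1 \<le> m" "1 \<le> n" "real m * real n \<le> x" for m n :: nat
  proof -
    have "real m * 1 \<le> real m * real n" using that by (intro mult_left_mono) auto
    thus ?thesis using that(3) by linarith
  qed
  thus ?thesis unfolding hyperbola_region_def
    by (auto simp only: in_floor_range_iff mem_Sigma_iff set_eq_iff mem_Collect_eq split: prod.splits)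
       (auto simp: field_simps)
qed

lemma finite_hyperbola_region [simp]: "finite (hyperbola_region x)"
  unfolding hyperbola_region_Sigma by (intro finite_SigmaI) auto

lemma summatory_conv:
  "summatory (\<lambda>n. dirichlet_conv a b n * g n) x = (\<Sum>(m, n)\<in>hyperbola_region x. a m * b n * g (m * n))"
proof -
  have "summatory (\<lambda>n. dirichlet_conv a b n * g n) x =
      (\<Sum>k\<in>{1..nat \<lfloor>x\<rfloor>}. \<Sum>d | d dvd k. a d * b (k div d) * g k)"
    unfolding summatory_def dirichlet_conv_def by (simp add: sum_distrib_right)
  also have "\<dots> = (\<Sum>(k, d)\<in>(SIGMA k:{1..nat \<lfloor>x\<rfloor>}. {d. d dvd k}). a d * b (k div d) * g k)"
    by (subst sum.Sigma) auto
  also have "\<dots> = (\<Sum>(m, n)\<in>hyperbola_region x. a m * b n * g (m * n))"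
    by (rule sum.reindex_bij_witness[of _ "\<lambda>(m, n). (m * n, m)" "\<lambda>(k, d). (d, k div d)"])
       (auto simp: hyperbola_region_def in_floor_range_iff[unfolded One_nat_def] Suc_le_eq simp del:
           atLeastAtMost_iff
         elim!: dvdE)
  finally show ?thesis .
qed

lemma sum_hyperbola_region:
  "(\<Sum>(m, n)\<in>hyperbola_region x. a m * b n) = (\<Sum>m\<in>{1..nat \<lfloor>x\<rfloor>}. a m * summatory b (x / real m))"
  unfolding hyperbola_region_Sigma summatory_def sum_distrib_left by (subst sum.Sigma) auto

text \<open>In a pair with product at most \<open>x\<close> one entry is at most
  \<open>sqrt x\<close>; the pairs in which both are form a full square, which inclusion-exclusion
  subtracts.\<close>

lemma hyperbola_method:
  assumes x: "x \<ge> 1"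
  shows "(\<Sum>(m, n)\<in>hyperbola_region x. a m * b n) =
     (\<Sum>m\<in>{1..nat \<lfloor>sqrt x\<rfloor>}. a m * summatory b (x / real m)) +
     (\<Sum>n\<in>{1..nat \<lfloor>sqrt x\<rfloor>}. b n * summatory a (x / real n)) -
     summatory a (sqrt x) * summatory b (sqrt x)"
proof -
  define A where "A = {(m, n) \<in> hyperbola_region x. real m \<le> sqrt x}"
  define B where "B = {(m, n) \<in> hyperbola_region x. real n \<le> sqrt x}"
  have fin: "finite A" "finite B"
    unfolding A_def B_def by (rule finite_subset[of _ "hyperbola_region x"]; auto)+
  have ss: "sqrt x * sqrt x = x" using x by simp
  have small: "real m * real n \<le> x" if "real m \<le> sqrt x" "real n \<le> sqrt x" for m n :: nat
    using mult_mono[OF that] x ss by simp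
  have "hyperbola_region x = A \<union> B"
  proof -
    have "real m \<le> sqrt x \<or> real n \<le> sqrt x" if "real m * real n \<le> x" for m n :: nat
    proof (rule ccontr)
      assume "\<not> (real m \<le> sqrt x \<or> real n \<le> sqrt x)"
      hence "sqrt x * sqrt x < real m * real n" using x by (intro mult_strict_mono') auto
      thus False using that ss by simp
    qed
    thus ?thesis unfolding A_def B_def hyperbola_region_def by auto
  qed
  hence eq: "(\<Sum>(m, n)\<in>hyperbola_region x. a m * b n) = (\<Sum>(m, n)\<in>A. a m * b n) +
      (\<Sum>(m, n)\<in>B. a m * b n) - (\<Sum>(m, n)\<in>A \<inter> B. a m * b n)"
    using sum.union_inter[OF fin, of "\<lambda>(m, n). a m * b n"] by simp
  have A: "A = (SIGMA m:{1..nat \<lfloor>sqrt x\<rfloor>}. {1..nat \<lfloor>x / real m\<rfloor>})"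
    unfolding A_def hyperbola_region_def
    by (auto simp only: in_floor_range_iff mem_Sigma_iff set_eq_iff mem_Collect_eq split: prod.splits)
       (auto simp: field_simps)
  have sA: "(\<Sum>(m, n)\<in>A. a m * b n) = (\<Sum>m\<in>{1..nat \<lfloor>sqrt x\<rfloor>}. a m * summatory b (x / real m))"
    unfolding A summatory_def sum_distrib_left by (subst sum.Sigma) auto
  have "(\<Sum>(m, n)\<in>B. a m * b n) = (\<Sum>(n, m)\<in>(SIGMA n:{1..nat \<lfloor>sqrt x\<rfloor>}. {1..nat \<lfloor>x / real n\<rfloor>}). b n * a m)"
  proof (rule sum.reindex_bij_witness[of _ "\<lambda>(n, m). (m, n)" "\<lambda>(m, n). (n, m)"])
    fix q assume q: "q \<in> B"
    obtain m n where mn: "q = (m, n)" by (cases q)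
    show "(case q of (m, n) \<Rightarrow> (n, m)) \<in> (SIGMA n:{1..nat \<lfloor>sqrt x\<rfloor>}. {1..nat \<lfloor>x / real n\<rfloor>})"
      using q unfolding mn B_def hyperbola_region_def
      by (auto simp only: in_floor_range_iff mem_Sigma_iff set_eq_iff mem_Collect_eq split: prod.splits)
         (auto simp: field_simps)
  next
    fix q assume q: "q \<in> (SIGMA n:{1..nat \<lfloor>sqrt x\<rfloor>}. {1..nat \<lfloor>x / real n\<rfloor>})"
    obtain m n where mn: "q = (n, m)" by (cases q)
    show "(case q of (n, m) \<Rightarrow> (m, n)) \<in> B"
      using q unfolding mn B_def hyperbola_region_def
      by (auto simp only: in_floor_range_iff mem_Sigma_iff set_eq_iff mem_Collect_eq split: prod.splits)
         (auto simp: field_simps)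
  qed auto
  also have "\<dots> = (\<Sum>n\<in>{1..nat \<lfloor>sqrt x\<rfloor>}. b n * summatory a (x / real n))"
    unfolding summatory_def sum_distrib_left by (subst sum.Sigma) auto
  finally have sB: "(\<Sum>(m, n)\<in>B. a m * b n) = (\<Sum>n\<in>{1..nat \<lfloor>sqrt x\<rfloor>}. b n * summatory a (x / real n))" .
  have AB: "A \<inter> B = {1..nat \<lfloor>sqrt x\<rfloor>} \<times> {1..nat \<lfloor>sqrt x\<rfloor>}"
    unfolding A_def B_def hyperbola_region_def
    by (auto simp only: in_floor_range_iff mem_Sigma_iff set_eq_iff mem_Collect_eq split: prod.splits)
       (auto intro: small)
  have "(\<Sum>(m, n)\<in>A \<inter> B. a m * b n) = summatory a (sqrt x) * summatory b (sqrt x)"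
    unfolding AB summatory_def sum_product by (simp add: sum.cartesian_product)
  thus ?thesis unfolding eq sA sB by simp
qed

text \<open>The powers of the logarithm belong to the class because convolution creates them:
  expanding a polynomial at \<open>ln x - ln m\<close> yields powers of \<open>ln m\<close>, and
  \<open>ln (m * n) ^ j\<close> splits binomially. Nonnegativity allows error terms to be summed
  against \<open>\<alpha>\<close> itself.\<close>

definition log_class :: "real \<Rightarrow> (nat \<Rightarrow> real) \<Rightarrow> bool" where
  "log_class \<delta> \<alpha> \<longleftrightarrow> (\<forall>n. \<alpha> n \<ge> 0) \<and> (\<forall>j::nat. poly_log \<delta> (summatory (\<lambda>n. \<alpha> n * ln (real n) ^ j)))"

lemma log_class_mono: "log_class \<delta> \<alpha> \<Longrightarrow> \<delta>2 \<le> \<delta> \<Longrightarrow> log_class \<delta>2 \<alpha>"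
  unfolding log_class_def using poly_log_mono by blast

text \<open>For \<open>m \<le> sqrt x\<close> the argument \<open>x / m\<close> is at least
  \<open>sqrt x\<close>, so the error of \<open>B\<close> is there at most of order
  \<open>x powr (- d1 / 2)\<close> for \<open>d1\<close> close to \<open>\<delta>\<close>, while the
  weights sum to less than any power of \<open>x\<close>. The polynomial part of \<open>B\<close>
  separates into sums over \<open>m\<close> taken at \<open>sqrt x\<close>.\<close>

lemma poly_log_half_sum:
  assumes \<alpha>: "log_class \<delta> \<alpha>" and B: "poly_log \<delta> B" and \<delta>: "\<delta> > 0"
  shows "poly_log (\<delta> / 2) (\<lambda>x. \<Sum>m\<in>{1..nat \<lfloor>sqrt x\<rfloor>}. \<alpha> m * ln (real m) ^ i * B (x / real m))"
proof -
  obtain Q where Q: "small_error \<delta> (\<lambda>x. B x - poly Q (ln x))" using B unfolding poly_log_def by blast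
  define E where "E = (\<lambda>x. B x - poly Q (ln x))"
  obtain N R where R: "\<And>L M. poly Q (L - M) = (\<Sum>s<(N::nat). poly (R s) L * M ^ s)"
    using poly_diff_expand by blast
  have A: "poly_log \<delta> (summatory (\<lambda>n. \<alpha> n * ln (real n) ^ j))" for j using \<alpha> unfolding log_class_def by blast
  have pos: "\<alpha> n \<ge> 0" for n using \<alpha> unfolding log_class_def by blast
  have main: "poly_log (\<delta> / 2) (\<lambda>x. \<Sum>s<N. poly (R s) (ln x) * summatory (\<lambda>n. \<alpha> n * ln (real n) ^ (i + s))
      (sqrt x))"
    by (intro poly_log_sum poly_log_poly_mult poly_log_sqrt A)
  define F where "F = (\<lambda>x. \<Sum>m\<in>{1..nat \<lfloor>sqrt x\<rfloor>}. \<alpha> m * ln (real m) ^ i * E (x / real m))"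
  have "small_error (\<delta> / 2) F"
    unfolding small_error_def
  proof safe
    fix \<delta>' assume d: "\<delta>' < \<delta> / 2"
    \<comment> \<open>\<open>d1\<close> lies strictly between \<open>max (2 * \<delta>') 0\<close>
      and \<open>\<delta>\<close>; being positive, it makes the power decreasing, and what remains,
      \<open>\<epsilon> = d1 / 2 - \<delta>'\<close>, is spent on the sum of the weights.\<close>
    define d1 where "d1 = (\<delta> + max (2 * \<delta>') 0) / 2"
    define \<epsilon> where "\<epsilon> = d1 / 2 - \<delta>'"
    have d1: "d1 < \<delta>" "d1 > 0" "\<epsilon> > 0" using d \<delta> unfolding d1_def \<epsilon>_def by (auto simp: max_def field_simps)
    obtain C1 where C1: "C1 \<ge> 0" "\<And>x. x \<ge> 1 \<Longrightarrow> \<bar>E x\<bar> \<le> C1 * x powr (- d1)"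
      using small_errorE[OF Q d1(1)] unfolding E_def by blast
    obtain C2 where C2: "C2 \<ge> 0" "\<And>x. x \<ge> 1 \<Longrightarrow> \<bar>summatory (\<lambda>n. \<alpha> n * ln (real n) ^ i) (sqrt x)\<bar> \<le> C2 * x
        powr \<epsilon>"
      using poly_log_growth[OF poly_log_sqrt[OF A[of i]] _ d1(3)] \<delta> by auto
    show "\<exists>C. \<forall>x\<ge>1. \<bar>F x\<bar> \<le> C * x powr (- \<delta>')"
    proof (intro exI[of _ "C1 * C2"] allI impI)
      fix x :: real assume x: "x \<ge> 1"
      have s1: "sqrt x \<ge> 1" and ss: "sqrt x * sqrt x = x" using x by auto
      have "\<bar>F x\<bar> \<le> (\<Sum>m\<in>{1..nat \<lfloor>sqrt x\<rfloor>}. \<bar>\<alpha> m * ln (real m) ^ i * E (x / real m)\<bar>)"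
        unfolding F_def by (rule sum_abs)
      also have "\<dots> \<le> (\<Sum>m\<in>{1..nat \<lfloor>sqrt x\<rfloor>}. \<alpha> m * ln (real m) ^ i * (C1 * x powr (- d1 / 2)))"
      proof (rule sum_mono)
        fix m assume m: "m \<in> {1..nat \<lfloor>sqrt x\<rfloor>}"
        hence m: "1 \<le> m" "real m \<le> sqrt x" using in_floor_range_iff by auto
        have "real m * sqrt x \<le> sqrt x * sqrt x" using m s1 by (intro mult_right_mono) auto
        hence xm: "sqrt x \<le> x / real m" using m ss by (simp add: field_simps)
        have "\<bar>E (x / real m)\<bar> \<le> C1 * (x / real m) powr (- d1)"
          by (rule C1(2)) (use xm s1 in linarith)
        also have "\<dots> \<le> C1 * sqrt x powr (- d1)"
          using xm s1 d1 C1 by (intro mult_left_mono powr_mono2') auto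
        also have "sqrt x powr (- d1) = x powr (- d1 / 2)"
          using x by (simp add: powr_half_sqrt[symmetric] powr_powr)
        finally have "\<bar>E (x / real m)\<bar> \<le> C1 * x powr (- d1 / 2)" .
        moreover have "\<alpha> m * ln (real m) ^ i \<ge> 0" using pos m by simp
        ultimately show "\<bar>\<alpha> m * ln (real m) ^ i * E (x / real m)\<bar> \<le> \<alpha> m * ln (real m) ^ i * (C1 * x powr
            (- d1 / 2))"
          by (simp add: abs_mult[of _ "E (x / real m)"] mult_left_mono)
      qed
      also have "\<dots> = summatory (\<lambda>n. \<alpha> n * ln (real n) ^ i) (sqrt x) * (C1 * x powr (- d1 / 2))"
        unfolding summatory_def by (simp add: sum_distrib_right)
      also have "\<dots> \<le> C2 * x powr \<epsilon> * (C1 * x powr (- d1 / 2))"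
        using C2(2)[OF x] C1 by (intro mult_right_mono) auto
      also have "\<dots> = C1 * C2 * x powr (\<epsilon> + - d1 / 2)" unfolding powr_add by simp
      also have "\<epsilon> + - d1 / 2 = - \<delta>'" by (simp add: \<epsilon>_def)
      finally show "\<bar>F x\<bar> \<le> C1 * C2 * x powr (- \<delta>')" .
    qed
  qed
  from poly_log_add[OF main poly_log_small_error[OF this]]
  show ?thesis
  proof (rule poly_log_cong)
    fix x :: real assume x: "x \<ge> 1"
    have "(\<Sum>m\<in>{1..nat \<lfloor>sqrt x\<rfloor>}. \<alpha> m * ln (real m) ^ i * B (x / real m)) =
       (\<Sum>m\<in>{1..nat \<lfloor>sqrt x\<rfloor>}. (\<Sum>s<N. poly (R s) (ln x) * (\<alpha> m * ln (real m) ^ (i + s)))) + F x"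
      unfolding F_def sum.distrib[symmetric]
    proof (rule sum.cong[OF refl])
      fix m assume m: "m \<in> {1..nat \<lfloor>sqrt x\<rfloor>}"
      have "B (x / real m) = poly Q (ln x - ln (real m)) + E (x / real m)"
        using x m by (simp add: E_def ln_div)
      thus "\<alpha> m * ln (real m) ^ i * B (x / real m) =
        (\<Sum>s<N. poly (R s) (ln x) * (\<alpha> m * ln (real m) ^ (i + s))) + \<alpha> m * ln (real m) ^ i * E (x / real m)"
        unfolding R by (simp add: algebra_simps sum_distrib_left power_add)
    qed
    also have "(\<Sum>m\<in>{1..nat \<lfloor>sqrt x\<rfloor>}. (\<Sum>s<N. poly (R s) (ln x) * (\<alpha> m * ln (real m) ^ (i + s)))) =
       (\<Sum>s<N. poly (R s) (ln x) * summatory (\<lambda>n. \<alpha> n * ln (real n) ^ (i + s)) (sqrt x))"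
      unfolding summatory_def sum_distrib_left by (rule sum.swap)
    finally show "(\<Sum>s<N. poly (R s) (ln x) * summatory (\<lambda>n. \<alpha> n * ln (real n) ^ (i + s)) (sqrt x)) + F x =
      (\<Sum>m\<in>{1..nat \<lfloor>sqrt x\<rfloor>}. \<alpha> m * ln (real m) ^ i * B (x / real m))" ..
  qed
qed

text \<open>The binomial theorem for \<open>(ln m + ln n) ^ j\<close> reduces the claim to products
  of logarithmically weighted \<open>\<alpha>\<close> and \<open>\<beta>\<close>. The hyperbola
  method cuts at \<open>sqrt x\<close> in all three of its terms, which is where half of the saving
  is lost.\<close>

lemma log_class_conv:
  assumes \<alpha>: "log_class \<delta> \<alpha>" and \<beta>: "log_class \<delta> \<beta>" and \<delta>: "\<delta> > 0"
  shows "log_class (\<delta> / 2) (dirichlet_conv \<alpha> \<beta>)"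
  unfolding log_class_def
proof (intro conjI allI)
  show "dirichlet_conv \<alpha> \<beta> n \<ge> 0" for n
    using \<alpha> \<beta> unfolding dirichlet_conv_def log_class_def by (intro sum_nonneg) auto
next
  fix j :: nat
  define a where "a = (\<lambda>i n. \<alpha> n * ln (real n) ^ (i::nat))"
  define b where "b = (\<lambda>i n. \<beta> n * ln (real n) ^ (i::nat))"
  define H where "H = (\<lambda>i x. (\<Sum>m\<in>{1..nat \<lfloor>sqrt x\<rfloor>}. a i m * summatory (b (j - i)) (x / real m)) +
     (\<Sum>n\<in>{1..nat \<lfloor>sqrt x\<rfloor>}. b (j - i) n * summatory (a i) (x / real n)) +
     (- 1) * (summatory (a i) (sqrt x) * summatory (b (j - i)) (sqrt x)))"
  have ab: "poly_log \<delta> (summatory (a i))" "poly_log \<delta> (summatory (b i))" for i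
    using \<alpha> \<beta> unfolding log_class_def a_def b_def by blast+
  have h1: "poly_log (\<delta> / 2) (\<lambda>x. \<Sum>m\<in>{1..nat \<lfloor>sqrt x\<rfloor>}. a i m * summatory (b l) (x / real m))" for i l
    using poly_log_half_sum[OF \<alpha> ab(2)[of l] \<delta>, of i] by (simp only: a_def)
  have h2: "poly_log (\<delta> / 2) (\<lambda>x. \<Sum>m\<in>{1..nat \<lfloor>sqrt x\<rfloor>}. b i m * summatory (a l) (x / real m))" for i l
    using poly_log_half_sum[OF \<beta> ab(1)[of l] \<delta>, of i] by (simp only: b_def)
  have d2: "\<delta> / 2 > 0" using \<delta> by simp
  have "poly_log (\<delta> / 2) (H i)" for i
    unfolding H_def by (intro poly_log_add poly_log_cmult poly_log_mult poly_log_sqrt ab h1 h2 d2)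
  hence "poly_log (\<delta> / 2) (\<lambda>x. \<Sum>i\<le>j. real (j choose i) * H i x)"
    by (intro poly_log_sum poly_log_cmult)
  thus "poly_log (\<delta> / 2) (summatory (\<lambda>n. dirichlet_conv \<alpha> \<beta> n * ln (real n) ^ j))"
  proof (rule poly_log_cong)
    fix x :: real assume x: "x \<ge> 1"
    have "summatory (\<lambda>n. dirichlet_conv \<alpha> \<beta> n * ln (real n) ^ j) x =
      (\<Sum>(m, n)\<in>hyperbola_region x. \<alpha> m * \<beta> n * ln (real (m * n)) ^ j)"
      by (rule summatory_conv)
    also have "\<dots> = (\<Sum>(m, n)\<in>hyperbola_region x. \<Sum>i\<le>j. real (j choose i) * (a i m * b (j - i) n))"
    proof (intro sum.cong refl, safe)
      fix m n assume "(m, n) \<in> hyperbola_region x"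
      hence "ln (real (m * n)) = ln (real m) + ln (real n)"
        by (auto simp: hyperbola_region_def ln_mult)
      thus "\<alpha> m * \<beta> n * ln (real (m * n)) ^ j = (\<Sum>i\<le>j. real (j choose i) * (a i m * b (j - i) n))"
        by (simp add: binomial_ring sum_distrib_left a_def b_def mult_ac)
    qed
    also have "\<dots> = (\<Sum>i\<le>j. real (j choose i) * (\<Sum>(m, n)\<in>hyperbola_region x. a i m * b (j - i) n))"
      unfolding sum_distrib_left case_prod_unfold by (rule sum.swap)
    also have "\<dots> = (\<Sum>i\<le>j. real (j choose i) * H i x)"
      unfolding H_def hyperbola_method[OF x] by simp
    finally show "(\<Sum>i\<le>j. real (j choose i) * H i x) = summatory (\<lambda>n. dirichlet_conv \<alpha> \<beta> n * ln (real n) ^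
        j) x" ..
  qed
qed

section \<open>Asymptotics of the sums of \<open>ln n ^ j / n\<close>\<close>

lemma powr_minus_diff_ge:
  fixes m \<delta> :: real
  assumes m: "m \<ge> 1" and \<delta>: "\<delta> > 0"
  shows "m powr (- 1 - \<delta>) \<le> 2 powr (1 + \<delta>) / \<delta> * (m powr (- \<delta>) - (m + 1) powr (- \<delta>))"
proof -
  have "\<exists>z>m. z < m + 1 \<and> (m + 1) powr (- \<delta>) - m powr (- \<delta>) = (m + 1 - m) * (- \<delta> * z powr (- \<delta> - 1))"
    using m by (intro MVT2) (auto intro!: derivative_eq_intros)
  then obtain z where z: "z > m" "z < m + 1" "m powr (- \<delta>) - (m + 1) powr (- \<delta>) = \<delta> * z powr (- \<delta> - 1)"
    by auto
  have "(2 * m) powr (- \<delta> - 1) \<le> z powr (- \<delta> - 1)" using z m \<delta> by (intro powr_mono2') auto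
  hence "\<delta> * (2 * m) powr (- \<delta> - 1) \<le> m powr (- \<delta>) - (m + 1) powr (- \<delta>)" using z(3) \<delta> by simp
  hence le: "2 powr (1 + \<delta>) / \<delta> * (\<delta> * (2 * m) powr (- \<delta> - 1)) \<le> 2 powr (1 + \<delta>) / \<delta> * (m powr (- \<delta>) - (m
      + 1) powr (- \<delta>))"
    using \<delta> by (intro mult_left_mono) auto
  have eq: "(2 * m) powr (- \<delta> - 1) = m powr (- 1 - \<delta>) / 2 powr (1 + \<delta>)"
  proof -
    have e: "- \<delta> - 1 = - (1 + \<delta>)" "- 1 - \<delta> = - (1 + \<delta>)" by simp_all
    have "(2 * m) powr (- \<delta> - 1) = 2 powr (- (1 + \<delta>)) * m powr (- 1 - \<delta>)"
      unfolding e by (rule powr_mult)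
    thus ?thesis by (simp only: powr_minus[of 2] divide_inverse mult.commute)
  qed
  show ?thesis using le \<delta> unfolding eq by simp
qed

text \<open>The increments of \<open>s\<close> are dominated by those of \<open>g\<close>, so
  \<open>s\<close> is Cauchy. As \<open>g\<close> decreases to 0 it is nonnegative and bounds the
  distance from \<open>s\<close> to its limit.\<close>

lemma telescoping_limit:
  fixes s g :: "nat \<Rightarrow> real"
  assumes d: "\<And>n. n \<ge> 1 \<Longrightarrow> \<bar>s (Suc n) - s n\<bar> \<le> g n - g (Suc n)" and g: "g \<longlonglongrightarrow> 0"
  shows "\<exists>c. \<forall>n\<ge>1. \<bar>s n - c\<bar> \<le> g n"
proof -
  have k: "\<bar>s (n + k) - s n\<bar> \<le> g n - g (n + k)" if "n \<ge> 1" for n k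
  proof (induction k)
    case (Suc k)
    thus ?case using d[of "n + k"] that by simp
  qed simp
  have gpos: "g n \<ge> 0" if "n \<ge> 1" for n
  proof (rule ccontr)
    assume "\<not> g n \<ge> 0"
    have "g (k + n) \<le> g n" for k using k[OF that, of k] by (simp add: add.commute)
    hence "0 \<le> g n" using LIMSEQ_le_const2[OF LIMSEQ_ignore_initial_segment[OF g, of n], of "g n"] by auto
    thus False using \<open>\<not> g n \<ge> 0\<close> by simp
  qed
  have k': "\<bar>s m - s n\<bar> \<le> g n" if "n \<ge> 1" "m \<ge> n" for n m
    using k[OF that(1), of "m - n"] gpos[of m] that by simp
  have "Cauchy s"
  proof (rule CauchyI')
    fix e :: real assume "e > 0"
    then obtain N where N: "\<And>n. n \<ge> N \<Longrightarrow> \<bar>g n\<bar> < e" using g unfolding LIMSEQ_iff by fastforce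
    show "\<exists>M. \<forall>m\<ge>M. \<forall>n>m. dist (s m) (s n) < e"
    proof (intro exI[of _ "max 1 N"] allI impI)
      fix m n assume "max 1 N \<le> m" "m < n"
      thus "dist (s m) (s n) < e" using k'[of m n] N[of m] by (simp add: dist_real_def abs_minus_commute)
    qed
  qed
  then obtain c where c: "s \<longlonglongrightarrow> c" using Cauchy_convergent convergent_def by blast
  have "\<bar>s n - c\<bar> \<le> g n" if n: "n \<ge> 1" for n
  proof -
    have "(\<lambda>m. \<bar>s m - s n\<bar>) \<longlonglongrightarrow> \<bar>c - s n\<bar>" by (intro tendsto_intros c)
    hence "\<bar>c - s n\<bar> \<le> g n" by (rule LIMSEQ_le_const2) (use k'[OF n] in auto)
    thus ?thesis by (simp add: abs_minus_commute)
  qed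
  thus ?thesis by blast
qed

lemma summatory_floor: "x \<ge> 0 \<Longrightarrow> summatory a (real (nat \<lfloor>x\<rfloor>)) = summatory a x"
  by (simp add: summatory_def)

lemma summatory_Suc: "summatory a (real (Suc n)) = summatory a (real n) + a (Suc n)"
  by (simp add: summatory_def flip: of_nat_Suc)

lemma floor_half_le:
  fixes x :: real
  assumes "x \<ge> 1"
  shows "real (nat \<lfloor>x\<rfloor>) \<ge> 1" "real (nat \<lfloor>x\<rfloor>) \<le> x" "x \<le> 2 * real (nat \<lfloor>x\<rfloor>)" "x \<le> real (nat \<lfloor>x\<rfloor>) + 1"
proof -
  have "real (nat \<lfloor>x\<rfloor>) = of_int \<lfloor>x\<rfloor>" "\<lfloor>x\<rfloor> \<ge> 1" using assms by auto
  thus "real (nat \<lfloor>x\<rfloor>) \<ge> 1" "real (nat \<lfloor>x\<rfloor>) \<le> x" "x \<le> 2 * real (nat \<lfloor>x\<rfloor>)" "x \<le> real (nat \<lfloor>x\<rfloor>) + 1"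
    by linarith+
qed

text \<open>Two applications of the mean value theorem: \<open>\<Phi> (n + 1) - \<Phi> n\<close> is
  a value of \<open>\<phi>\<close> inside the interval, and it differs from
  \<open>\<phi> (n + 1)\<close> by at most a value of \<open>\<phi>'\<close>, of size
  \<open>n powr (- 1 - \<delta>)\<close>. By \<open>powr_minus_diff_ge\<close> these errors
  telescope; \<open>c\<close> is the limit.\<close>

lemma summatory_eq_antiderivative:
  fixes \<phi> \<phi>' \<Phi> :: "real \<Rightarrow> real"
  assumes \<delta>: "\<delta> > 0" and K: "K \<ge> 0"
    and D1: "\<And>t. t \<ge> 1 \<Longrightarrow> (\<Phi> has_real_derivative \<phi> t) (at t)"
    and D2: "\<And>t. t \<ge> 1 \<Longrightarrow> (\<phi> has_real_derivative \<phi>' t) (at t)"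
    and b1: "\<And>t. t \<ge> 1 \<Longrightarrow> \<bar>\<phi> t\<bar> \<le> K * t powr (- \<delta>)"
    and b2: "\<And>t. t \<ge> 1 \<Longrightarrow> \<bar>\<phi>' t\<bar> \<le> K * t powr (- 1 - \<delta>)"
  shows "\<exists>c C. \<forall>x\<ge>1. \<bar>summatory (\<lambda>n. \<phi> (real n)) x - \<Phi> x - c\<bar> \<le> C * x powr (- \<delta>)"
proof -
  define s where "s = (\<lambda>n. summatory (\<lambda>n. \<phi> (real n)) (real n) - \<Phi> (real n))"
  define C where "C = K * (2 powr (1 + \<delta>) / \<delta>)"
  have C0: "C \<ge> 0" using K \<delta> by (simp add: C_def)
  define g where "g = (\<lambda>n::nat. C * real n powr (- \<delta>))"
  have "\<bar>s (Suc n) - s n\<bar> \<le> g n - g (Suc n)" if n: "n \<ge> 1" for n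
  proof -
    have n1: "real n \<ge> 1" using n by simp
    obtain z where z: "z > real n" "z < real n + 1" "\<Phi> (real n + 1) - \<Phi> (real n) = (real n + 1 - real n)
        * \<phi> z"
      using MVT2[of "real n" "real n + 1" \<Phi> \<phi>] D1 n1 by auto
    obtain y where y: "y > z" "y < real n + 1" "\<phi> (real n + 1) - \<phi> z = (real n + 1 - z) * \<phi>' y"
      using MVT2[of z "real n + 1" \<phi> \<phi>'] D2 n1 z by auto
    have "s (Suc n) - s n = (real n + 1 - z) * \<phi>' y"
      unfolding s_def summatory_Suc using z(3) y(3) by (simp add: add.commute)
    hence "\<bar>s (Suc n) - s n\<bar> = (real n + 1 - z) * \<bar>\<phi>' y\<bar>" using z by (simp add: abs_mult)
    also have "\<dots> \<le> 1 * (K * y powr (- 1 - \<delta>))" using z y n1 b2[of y] by (intro mult_mono) auto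
    also have "\<dots> \<le> K * real n powr (- 1 - \<delta>)"
      using z y n1 K \<delta> by (simp, intro mult_left_mono powr_mono2') auto
    also have "\<dots> \<le> K * (2 powr (1 + \<delta>) / \<delta> * (real n powr (- \<delta>) - (real n + 1) powr (- \<delta>)))"
      using K by (intro mult_left_mono powr_minus_diff_ge n1 \<delta>)
    also have "\<dots> = g n - g (Suc n)" unfolding g_def C_def by (simp add: algebra_simps)
    finally show ?thesis .
  qed
  moreover have "g \<longlonglongrightarrow> C * 0" unfolding g_def
    by (intro tendsto_mult tendsto_const tendsto_neg_powr filterlim_real_sequentially) (use \<delta> in simp)
  ultimately obtain c where c: "\<And>n. n \<ge> 1 \<Longrightarrow> \<bar>s n - c\<bar> \<le> g n"
    using telescoping_limit[of s g] by auto
  show ?thesis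
  proof (rule exI[of _ c], rule exI[of _ "(C + K) * 2 powr \<delta>"], intro allI impI)
    fix x :: real assume x: "x \<ge> 1"
    define N where "N = nat \<lfloor>x\<rfloor>"
    note N = floor_half_le[OF x, folded N_def]
    have N1: "N \<ge> 1" using N(1) by simp
    have "\<bar>\<Phi> x - \<Phi> (real N)\<bar> \<le> K * real N powr (- \<delta>)"
    proof (cases "x = real N")
      case False
      hence lt: "real N < x" using N by simp
      obtain z where z: "z > real N" "z < x" "\<Phi> x - \<Phi> (real N) = (x - real N) * \<phi> z"
        using MVT2[OF lt, of \<Phi> \<phi>] D1 N(1) by auto
      have "\<bar>\<Phi> x - \<Phi> (real N)\<bar> = (x - real N) * \<bar>\<phi> z\<bar>" using z lt by (simp add: abs_mult)
      also have "\<dots> \<le> 1 * (K * z powr (- \<delta>))"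
      proof (intro mult_mono)
        show "\<bar>\<phi> z\<bar> \<le> K * z powr (- \<delta>)" using z(1) N(1) by (intro b1) linarith
      qed (use z N in auto)
      also have "\<dots> \<le> K * real N powr (- \<delta>)"
        using z N K \<delta> by (simp, intro mult_left_mono powr_mono2') auto
      finally show ?thesis .
    qed (use K in simp)
    moreover have "\<bar>s N - c\<bar> \<le> C * real N powr (- \<delta>)" using c[OF N1] by (simp add: g_def)
    moreover have "summatory (\<lambda>n. \<phi> (real n)) x = summatory (\<lambda>n. \<phi> (real n)) (real N)"
      unfolding N_def by (rule summatory_floor[symmetric]) (use x in simp)
    ultimately have "\<bar>summatory (\<lambda>n. \<phi> (real n)) x - \<Phi> x - c\<bar> \<le> (C + K) * real N powr (- \<delta>)"
      unfolding s_def by (simp add: algebra_simps)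
    also have "real N powr (- \<delta>) \<le> (x / 2) powr (- \<delta>)" using N \<delta> x by (intro powr_mono2') auto
    also have "(x / 2) powr (- \<delta>) = 2 powr \<delta> * x powr (- \<delta>)"
      using x by (simp add: powr_divide powr_minus field_simps)
    finally show "\<bar>summatory (\<lambda>n. \<phi> (real n)) x - \<Phi> x - c\<bar> \<le> (C + K) * 2 powr \<delta> * x powr (- \<delta>)"
      using C0 K by (simp add: mult_left_mono mult.assoc)
  qed
qed

text \<open>The antiderivative of \<open>ln t ^ j / t\<close> is
  \<open>ln t ^ (j + 1) / (j + 1)\<close>. The missing tenth in 9/10 pays for the powers of the
  logarithm in the function and its derivative; the constants \<open>c\<close> are the Stieltjes
  constants.\<close>

lemma log_class_inverse: "log_class (9 / 10) (\<lambda>n. 1 / real n)"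
  unfolding log_class_def
proof (intro conjI allI)
  fix j :: nat
  define \<phi> where "\<phi> = (\<lambda>t::real. ln t ^ j / t)"
  define \<phi>' where "\<phi>' = (\<lambda>t::real. poly (pderiv (monom 1 j) - monom 1 j) (ln t) / t\<^sup>2)"
  define \<Phi> where "\<Phi> = (\<lambda>t::real. ln t ^ Suc j / real (Suc j))"
  obtain C1 where C1: "C1 \<ge> 0" "\<And>x::real. x \<ge> 1 \<Longrightarrow> \<bar>poly (monom 1 j) (ln x)\<bar> \<le> C1 * x powr (1 / 10)"
    using poly_ln_le_powr[of "1 / 10" "monom 1 j"] by auto
  obtain C2 where C2: "C2 \<ge> 0" "\<And>x::real. x \<ge> 1 \<Longrightarrow> \<bar>poly (pderiv (monom 1 j) - monom 1 j) (ln x)\<bar> \<le> C2 * x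
      powr (1 / 10)"
    using poly_ln_le_powr[of "1 / 10" "pderiv (monom 1 j) - monom 1 j"] by auto
  define K where "K = C1 + C2"
  have "\<exists>c C. \<forall>x\<ge>1. \<bar>summatory (\<lambda>n. \<phi> (real n)) x - \<Phi> x - c\<bar> \<le> C * x powr (- (9 / 10))"
  proof (rule summatory_eq_antiderivative[of _ K \<Phi> \<phi> \<phi>'])
    show "K \<ge> 0" using C1 C2 by (simp add: K_def)
    fix t :: real assume t: "t \<ge> 1"
    show "(\<Phi> has_real_derivative \<phi> t) (at t)"
      unfolding \<Phi>_def \<phi>_def
      using DERIV_cdivide[OF DERIV_power[OF DERIV_ln_divide[of t], of "Suc j"], of "real (Suc j)"] t
      by (simp del: of_nat_Suc power_Suc)
    have p: "((\<lambda>t. poly (monom 1 j) (ln t)) has_real_derivative poly (pderiv (monom 1 j)) (ln t) * (1 /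
        t)) (at t)"
      using t by (intro DERIV_chain2[OF poly_DERIV] derivative_eq_intros) auto
    have "((\<lambda>t. poly (monom 1 j) (ln t) / t) has_real_derivative \<phi>' t) (at t)"
      unfolding \<phi>'_def using t
      by (auto intro!: derivative_eq_intros p simp: field_simps power2_eq_square)
    thus "(\<phi> has_real_derivative \<phi>' t) (at t)" by (simp add: \<phi>_def poly_monom)
    have "\<bar>\<phi> t\<bar> = \<bar>poly (monom 1 j) (ln t)\<bar> / t" using t by (simp add: \<phi>_def poly_monom)
    also have "\<dots> \<le> C1 * t powr (1 / 10) / t" using C1(2)[OF t] t by (intro divide_right_mono) auto
    also have "\<dots> = C1 * t powr (1 / 10 - 1)" unfolding powr_diff using t by simp
    also have "\<dots> \<le> K * t powr (- (9 / 10))" using C2(1) by (simp add: K_def algebra_simps)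
    finally show "\<bar>\<phi> t\<bar> \<le> K * t powr (- (9 / 10))" .
    have "\<bar>\<phi>' t\<bar> = \<bar>poly (pderiv (monom 1 j) - monom 1 j) (ln t)\<bar> / t powr 2" using t by (simp add:
        \<phi>'_def abs_divide)
    also have "\<dots> \<le> C2 * t powr (1 / 10) / t powr 2" using C2(2)[OF t] t by (intro divide_right_mono) auto
    also have "\<dots> = C2 * t powr (1 / 10 - 2)" unfolding powr_diff by simp
    also have "\<dots> \<le> K * t powr (- 1 - 9 / 10)" using C1(1) by (simp add: K_def algebra_simps)
    finally show "\<bar>\<phi>' t\<bar> \<le> K * t powr (- 1 - 9 / 10)" .
  qed simp
  then obtain c C where cC: "\<And>x. x \<ge> 1 \<Longrightarrow> \<bar>summatory (\<lambda>n. \<phi> (real n)) x - \<Phi> x - c\<bar> \<le> C * x powr (- (9 / 10))"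
    by blast
  have C0: "C \<ge> 0" using cC[of 1] by simp
  show "poly_log (9 / 10) (summatory (\<lambda>n. 1 / real n * ln (real n) ^ j))"
    unfolding poly_log_def
  proof (rule exI[of _ "monom (1 / real (Suc j)) (Suc j) + [:c:]"], unfold small_error_def, intro allI impI)
    fix \<delta>' :: real assume d: "\<delta>' < 9 / 10"
    show "\<exists>C. \<forall>x\<ge>1. \<bar>summatory (\<lambda>n. 1 / real n * ln (real n) ^ j) x - poly (monom (1 / real (Suc j)) (Suc
        j) + [:c:]) (ln x)\<bar> \<le> C * x powr (- \<delta>')"
    proof (intro exI[of _ C] allI impI)
      fix x :: real assume x: "x \<ge> 1"
      have "\<bar>summatory (\<lambda>n. 1 / real n * ln (real n) ^ j) x - poly (monom (1 / real (Suc j)) (Suc j) +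
          [:c:]) (ln x)\<bar>
         = \<bar>summatory (\<lambda>n. \<phi> (real n)) x - \<Phi> x - c\<bar>"
        by (simp add: \<phi>_def \<Phi>_def poly_monom algebra_simps)
      also have "\<dots> \<le> C * x powr (- (9 / 10))" by (rule cC[OF x])
      also have "\<dots> \<le> C * x powr (- \<delta>')" using d x C0 by (intro mult_left_mono powr_mono) auto
      finally show "\<bar>summatory (\<lambda>n. 1 / real n * ln (real n) ^ j) x - poly (monom (1 / real (Suc j)) (Suc
          j) + [:c:]) (ln x)\<bar> \<le> C * x powr (- \<delta>')" .
    qed
  qed
qed simp

section \<open>Multiplicative functions\<close>

definition multiplicative :: "(nat \<Rightarrow> real) \<Rightarrow> bool" where
  "multiplicative f \<longleftrightarrow> f 1 = 1 \<and> (\<forall>m n. m > 0 \<longrightarrow> n > 0 \<longrightarrow> coprime m n \<longrightarrow> f (m * n) = f m * f n)"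

lemma multiplicative_1: "multiplicative f \<Longrightarrow> f 1 = 1"
  by (simp add: multiplicative_def)

lemma multiplicative_mult:
  "multiplicative f \<Longrightarrow> m > 0 \<Longrightarrow> n > 0 \<Longrightarrow> coprime m n \<Longrightarrow> f (m * n) = f m * f n"
  by (simp add: multiplicative_def)

lemma prime_power_induct [consumes 1, case_names one step]:
  fixes n :: nat
  assumes "n > 0" and one: "P 1"
    and step: "\<And>p k m. prime p \<Longrightarrow> k > 0 \<Longrightarrow> m > 0 \<Longrightarrow> coprime (p ^ k) m \<Longrightarrow> P m \<Longrightarrow> P (p ^ k * m)"
  shows "P n"
  using assms(1)
proof (induction n rule: less_induct)
  case (less n)
  show ?case
  proof (cases "n = 1")
    case False
    then obtain p where p: "prime p" "p dvd n" using prime_factor_nat by blast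
    have nu: "\<not> is_unit p" using p by auto
    obtain m where m: "n = p ^ multiplicity p n * m" "\<not> p dvd m"
      using multiplicity_decompose'[of n p] less.prems nu by auto
    have k: "multiplicity p n > 0" using p less.prems nu by (simp add: multiplicity_gt_zero_iff)
    have m0: "m > 0" using m(1) less.prems by (cases "m = 0") auto
    have "1 < p ^ multiplicity p n" by (rule one_less_power[OF prime_gt_1_nat[OF p(1)] k])
    hence "1 * m < p ^ multiplicity p n * m" using m0 by (intro mult_strict_right_mono) auto
    hence "m < n" using m(1) by simp
    moreover have "coprime (p ^ multiplicity p n) m" using p m(2) by (simp add: prime_imp_coprime)
    ultimately show ?thesis using step[OF p(1) k m0] less.IH m0 m(1) by metis
  qed (use one in simp)
qed

lemma multiplicative_eqI:
  assumes "multiplicative a" "multiplicative b" "n > 0"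
    and "\<And>p k. prime p \<Longrightarrow> a (p ^ k) = b (p ^ k)"
  shows "a n = b n"
  using assms(3)
proof (induction n rule: prime_power_induct)
  case (step p k m)
  have "p ^ k > 0" using step(1) prime_gt_0_nat by simp
  thus ?case using step assms(4)[OF step(1), of k]
    by (simp add: multiplicative_mult[OF assms(1)] multiplicative_mult[OF assms(2)])
qed (use multiplicative_1[OF assms(1)] multiplicative_1[OF assms(2)] in simp)

lemma multiplicative_le:
  assumes "multiplicative a" "multiplicative b" "n > 0"
    and "\<And>p k. prime p \<Longrightarrow> 0 \<le> a (p ^ k) \<and> a (p ^ k) \<le> b (p ^ k)"
  shows "0 \<le> a n \<and> a n \<le> b n"
  using assms(3)
proof (induction n rule: prime_power_induct)
  case (step p k m)
  have "p ^ k > 0" using step(1) prime_gt_0_nat by simp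
  thus ?case using step assms(4)[OF step(1), of k]
    by (auto simp: multiplicative_mult[OF assms(1)] multiplicative_mult[OF assms(2)] intro!: mult_mono)
qed (use multiplicative_1[OF assms(1)] multiplicative_1[OF assms(2)] in simp)

lemma multiplicative_nonneg:
  assumes "multiplicative a" "n > 0" "\<And>p k. prime p \<Longrightarrow> 0 \<le> a (p ^ k)"
  shows "0 \<le> a n"
  using multiplicative_le[OF assms(1,1,2)] assms(3) by blast

lemma sum_divisors_coprime:
  fixes g :: "nat \<Rightarrow> real"
  assumes "m > 0" "n > 0" "coprime m n"
  shows "(\<Sum>x | x dvd m * n. g x) = (\<Sum>d | d dvd m. \<Sum>e | e dvd n. g (d * e))"
proof -
  have "inj_on (\<lambda>(d, e). d * e) ({d. d dvd m} \<times> {e. e dvd n})"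
  proof (rule inj_onI, safe)
    fix d e d' e' assume de: "d dvd m" "e dvd n" "d' dvd m" "e' dvd n" "d * e = d' * e'"
    have cop: "coprime x y" if "x dvd m" "y dvd n" for x y using assms(3) that by (meson coprime_divisors)
    have "d dvd d'" "d' dvd d"
      using de cop[OF de(1,4)] cop[OF de(3,2)] coprime_dvd_mult_left_iff dvd_triv_left by metis+
    thus d: "d = d'" by (rule dvd_antisym)
    have "d > 0" using de(1) assms by (intro Nat.gr0I) auto
    thus "e = e'" using de(5) d by simp
  qed
  moreover have "(\<lambda>(d, e). d * e) ` ({d. d dvd m} \<times> {e. e dvd n}) = {x. x dvd m * n}"
    by (auto intro: mult_dvd_mono dest!: division_decomp)
  ultimately have "(\<Sum>x | x dvd m * n. g x) =
      sum (g \<circ> (\<lambda>(d, e). d * e)) ({d. d dvd m} \<times> {e. e dvd n})"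
    using sum.reindex[of "\<lambda>(d, e). d * e" "{d. d dvd m} \<times> {e. e dvd n}" g] by simp
  also have "\<dots> = (\<Sum>(d, e)\<in>{d. d dvd m} \<times> {e. e dvd n}. g (d * e))"
    by (intro sum.cong) auto
  finally show ?thesis by (simp add: sum.cartesian_product)
qed

lemma multiplicative_conv:
  assumes a: "multiplicative a" and b: "multiplicative b"
  shows "multiplicative (dirichlet_conv a b)"
  unfolding multiplicative_def
proof (intro conjI allI impI)
  show "dirichlet_conv a b 1 = 1"
    using a b by (simp add: dirichlet_conv_def multiplicative_def)
  fix m n :: nat assume mn: "m > 0" "n > 0" "coprime m n"
  have "dirichlet_conv a b (m * n) = (\<Sum>d | d dvd m. \<Sum>e | e dvd n. a (d * e) * b (m * n div (d * e)))"
    unfolding dirichlet_conv_def by (rule sum_divisors_coprime[OF mn])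
  also have "\<dots> = (\<Sum>d | d dvd m. \<Sum>e | e dvd n. (a d * b (m div d)) * (a e * b (n div e)))"
  proof (intro sum.cong refl)
    fix d e assume "d \<in> {d. d dvd m}" "e \<in> {e. e dvd n}"
    then obtain d' e' where de: "m = d * d'" "n = e * e'" by (auto elim!: dvdE)
    have pos: "d > 0" "e > 0" "d' > 0" "e' > 0" using de mn by auto
    have cop: "coprime d e" "coprime d' e'" using mn(3) de by auto
    have "m * n div (d * e) = d' * e'" "m div d = d'" "n div e = e'" using de pos by auto
    thus "a (d * e) * b (m * n div (d * e)) = (a d * b (m div d)) * (a e * b (n div e))"
      using pos cop by (simp add: multiplicative_mult[OF a] multiplicative_mult[OF b])
  qed
  also have "\<dots> = dirichlet_conv a b m * dirichlet_conv a b n"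
    unfolding dirichlet_conv_def by (simp add: sum_product)
  finally show "dirichlet_conv a b (m * n) = dirichlet_conv a b m * dirichlet_conv a b n" .
qed

lemma dirichlet_conv_prime_power:
  assumes p: "prime p"
  shows "dirichlet_conv a b (p ^ k) = (\<Sum>j=0..k. a (p ^ j) * b (p ^ (k - j)))"
proof -
  have p1: "p > 1" using p prime_gt_1_nat by blast
  have "{d. d dvd p ^ k} = (\<lambda>j. p ^ j) ` {0..k}"
    using divides_primepow_nat[OF p] by (auto simp: image_iff)
  moreover have "inj_on (\<lambda>j. p ^ j) {0..k}" using p1 by (auto simp: inj_on_def)
  ultimately have "dirichlet_conv a b (p ^ k) = (\<Sum>j=0..k. a (p ^ j) * b (p ^ k div p ^ j))"
    unfolding dirichlet_conv_def by (simp add: sum.reindex)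
  also have "\<dots> = (\<Sum>j=0..k. a (p ^ j) * b (p ^ (k - j)))"
    using p1 by (intro sum.cong) (auto simp: power_diff)
  finally show ?thesis .
qed

definition from_prime_powers :: "(nat \<Rightarrow> nat \<Rightarrow> real) \<Rightarrow> nat \<Rightarrow> real" where
  "from_prime_powers G n = (\<Prod>p\<in>prime_factors n. G p (multiplicity p n))"

lemma multiplicative_from_prime_powers: "multiplicative (from_prime_powers G)"
  unfolding multiplicative_def
proof (intro conjI allI impI)
  show "from_prime_powers G 1 = 1" by (simp add: from_prime_powers_def)
  fix m n :: nat assume mn: "m > 0" "n > 0" "coprime m n"
  have disj: "prime_factors m \<inter> prime_factors n = {}"
    using mn(3) by (metis coprime_common_divisor disjoint_iff in_prime_factors_iff not_prime_unit)
  have pf: "prime_factors (m * n) = prime_factors m \<union> prime_factors n"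
    using mn by (simp add: prime_factors_product)
  have 1: "multiplicity p (m * n) = multiplicity p m" if "p \<in> prime_factors m" for p
  proof -
    have "prime p" "\<not> p dvd n" using that disj mn by (auto simp: prime_factors_dvd)
    thus ?thesis using mn by (simp add: prime_elem_multiplicity_mult_distrib not_dvd_imp_multiplicity_0)
  qed
  have 2: "multiplicity p (m * n) = multiplicity p n" if "p \<in> prime_factors n" for p
  proof -
    have "prime p" "\<not> p dvd m" using that disj mn by (auto simp: prime_factors_dvd)
    thus ?thesis using mn by (simp add: prime_elem_multiplicity_mult_distrib not_dvd_imp_multiplicity_0)
  qed
  show "from_prime_powers G (m * n) = from_prime_powers G m * from_prime_powers G n"
    unfolding from_prime_powers_def pf using disj by (subst prod.union_disjoint) (auto simp: 1 2)
qed

lemma from_prime_powers_prime_power: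
  assumes "prime p" "G p 0 = 1"
  shows "from_prime_powers G (p ^ k) = G p k"
  using assms by (cases "k = 0") (auto simp: from_prime_powers_def prime_factorization_prime_power)

text \<open>The Bell series of \<open>f\<close> at \<open>p\<close>, which turns Dirichlet
  convolution into multiplication of power series.\<close>

definition prime_series :: "(nat \<Rightarrow> real) \<Rightarrow> nat \<Rightarrow> real fps" where
  "prime_series f p = Abs_fps (\<lambda>k. f (p ^ k))"

lemma prime_series_nth [simp]: "fps_nth (prime_series f p) k = f (p ^ k)"
  by (simp add: prime_series_def)

lemma prime_series_conv: "prime p \<Longrightarrow> prime_series (dirichlet_conv a b) p = prime_series a p * prime_series b p"
  by (rule fps_ext) (simp add: dirichlet_conv_prime_power fps_mult_nth)

lemma conv_eqI:
  assumes "multiplicative a" "multiplicative b" "multiplicative c" "n > 0"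
    "\<And>p. prime p \<Longrightarrow> prime_series a p * prime_series b p = prime_series c p"
  shows "dirichlet_conv a b n = c n"
proof (rule multiplicative_eqI[OF multiplicative_conv[OF assms(1,2)] assms(3,4)])
  fix p k :: nat assume "prime p"
  thus "dirichlet_conv a b (p ^ k) = c (p ^ k)"
    using prime_series_conv[of p a b] assms(5)[of p] by (metis prime_series_nth)
qed

definition per_index :: "(nat \<Rightarrow> real) \<Rightarrow> nat \<Rightarrow> real" where
  "per_index a n = a n / real n"

lemma per_index_conv: "per_index (dirichlet_conv a b) = dirichlet_conv (per_index a) (per_index b)"
proof
  fix n
  show "per_index (dirichlet_conv a b) n = dirichlet_conv (per_index a) (per_index b) n"
  proof (cases "n = 0")
    \<comment> \<open>Every number divides 0, so both convolutions are sums over an infinite set and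
      take the default value 0.\<close>
    case True
    have "infinite {d. d dvd (0::nat)}" by simp
    thus ?thesis using True by (simp add: per_index_def dirichlet_conv_def)
  next
    case False
    thus ?thesis unfolding per_index_def dirichlet_conv_def sum_divide_distrib
      by (intro sum.cong refl) (auto elim!: dvdE simp: field_simps)
  qed
qed

section \<open>Inequalities for sums of convolutions, and Euler products as majorants\<close>

lemma summatory_nonneg: "(\<And>n. n > 0 \<Longrightarrow> a n \<ge> 0) \<Longrightarrow> summatory a x \<ge> 0"
  unfolding summatory_def by (intro sum_nonneg) auto

lemma summatory_mono: "(\<And>n. n > 0 \<Longrightarrow> a n \<le> b n) \<Longrightarrow> summatory a x \<le> summatory b x"
  unfolding summatory_def by (intro sum_mono) auto

lemma summatory_conv_eq:
  "summatory (dirichlet_conv a b) x = (\<Sum>(m, n)\<in>hyperbola_region x. a m * b n)"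
  using summatory_conv[of a b "\<lambda>_. 1" x] by simp

lemma summatory_conv_le:
  assumes "\<And>n. n > 0 \<Longrightarrow> a n \<ge> 0" "\<And>n. n > 0 \<Longrightarrow> b n \<ge> 0" "x \<ge> 0"
  shows "summatory (dirichlet_conv a b) x \<le> summatory a x * summatory b x"
proof -
  have "real n \<le> x" if "Suc 0 \<le> m" "Suc 0 \<le> n" "real m * real n \<le> x" for m n
  proof -
    have "1 * real n \<le> real m * real n" using that by (intro mult_right_mono) auto
    thus ?thesis using that(3) by linarith
  qed
  hence "hyperbola_region x \<subseteq> {1..nat \<lfloor>x\<rfloor>} \<times> {1..nat \<lfloor>x\<rfloor>}"
    unfolding hyperbola_region_Sigma
    by (auto simp: in_floor_range_iff[unfolded One_nat_def] field_simps simp del: atLeastAtMost_iff)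
  hence "(\<Sum>(m, n)\<in>hyperbola_region x. a m * b n) \<le> (\<Sum>(m, n)\<in>{1..nat \<lfloor>x\<rfloor>} \<times> {1..nat \<lfloor>x\<rfloor>}. a m * b n)"
    using assms by (intro sum_mono2) auto
  also have "\<dots> = summatory a x * summatory b x"
    unfolding summatory_def sum_product by (simp add: sum.cartesian_product)
  finally show ?thesis unfolding summatory_conv_eq .
qed

lemma summatory_conv_ge:
  assumes "\<And>n. n > 0 \<Longrightarrow> a n \<ge> 0" "\<And>n. n > 0 \<Longrightarrow> b n \<ge> 0" "x \<ge> 0" "y \<ge> 0"
  shows "summatory a x * summatory b y \<le> summatory (dirichlet_conv a b) (x * y)"
proof -
  have "{1..nat \<lfloor>x\<rfloor>} \<times> {1..nat \<lfloor>y\<rfloor>} \<subseteq> hyperbola_region (x * y)"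
    unfolding hyperbola_region_def using assms(3,4)
    by (auto simp: in_floor_range_iff[unfolded One_nat_def] intro!: mult_mono simp del: atLeastAtMost_iff)
  hence "(\<Sum>(m, n)\<in>{1..nat \<lfloor>x\<rfloor>} \<times> {1..nat \<lfloor>y\<rfloor>}. a m * b n) \<le> (\<Sum>(m, n)\<in>hyperbola_region (x * y). a m * b n)"
  proof (rule sum_mono2[OF finite_hyperbola_region])
    fix q assume "q \<in> hyperbola_region (x * y) - {1..nat \<lfloor>x\<rfloor>} \<times> {1..nat \<lfloor>y\<rfloor>}"
    thus "0 \<le> (case q of (m, n) \<Rightarrow> a m * b n)" using assms by (auto simp: hyperbola_region_def)
  qed
  thus ?thesis unfolding summatory_conv_eq
    unfolding summatory_def sum_product by (simp add: sum.cartesian_product)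
qed

text \<open>Induction on the set of admissible primes: splitting \<open>n\<close> into the exponent
  of \<open>p\<close> and the part free of \<open>p\<close> embeds \<open>S\<close> into a rectangle
  \<open>{0..K} \<times> S'\<close>, over which the sum of a multiplicative function
  factors.\<close>

lemma euler_product_bound_finite:
  fixes \<phi> e :: "nat \<Rightarrow> real"
  assumes \<phi>: "multiplicative \<phi>" and pos: "\<And>n. n > 0 \<Longrightarrow> \<phi> n \<ge> 0"
    and e: "\<And>p K. prime p \<Longrightarrow> (\<Sum>k=1..K. \<phi> (p ^ k)) \<le> e p"
    and "finite A" "\<And>p. p \<in> A \<Longrightarrow> prime p" "finite S" "\<And>n. n \<in> S \<Longrightarrow> n > 0 \<and> prime_factors n \<subseteq> A"
  shows "(\<Sum>n\<in>S. \<phi> n) \<le> (\<Prod>p\<in>A. 1 + e p)"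
  using assms(4-)
proof (induction A arbitrary: S rule: finite_induct)
  case empty
  have "S \<subseteq> {1}"
  proof
    fix n assume "n \<in> S"
    hence "n > 0" "prime_factors n = {}" using empty by auto
    thus "n \<in> {1}" by (metis insertI1 prime_factors_gt_0_nat prime_factorization_empty_iff
        nat_dvd_1_iff_1 neq0_conv set_mset_eq_empty_iff)
  qed
  hence "S = {} \<or> S = {1}" by auto
  thus ?case using multiplicative_1[OF \<phi>] by auto
next
  case (insert p A)
  have p: "prime p" using insert by auto
  have p0: "p > 0" "\<not> is_unit p" using p prime_gt_0_nat by auto
  define g where "g = (\<lambda>n. (multiplicity p n, n div p ^ multiplicity p n))"
  define S' where "S' = (snd \<circ> g) ` S"
  define K where "K = Max (insert 0 ((fst \<circ> g) ` S))"
  have dec: "n = p ^ fst (g n) * snd (g n)" for n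
    unfolding g_def by (simp add: multiplicity_dvd)
  have nd: "\<not> p dvd snd (g n)" "snd (g n) > 0" if "n \<in> S" for n
  proof -
    have n0: "n > 0" using that insert by auto
    show "\<not> p dvd snd (g n)" unfolding g_def using multiplicity_decompose[of n p] n0 p0 by simp
    thus "snd (g n) > 0" by (intro Nat.gr0I) auto
  qed
  have \<phi>n: "\<phi> n = \<phi> (p ^ fst (g n)) * \<phi> (snd (g n))" if "n \<in> S" for n
  proof -
    have "coprime (p ^ fst (g n)) (snd (g n))" using nd[OF that] p by (simp add: prime_imp_coprime)
    thus ?thesis using multiplicative_mult[OF \<phi>, of "p ^ fst (g n)" "snd (g n)"] nd[OF that] p0 dec[of n]
        by simp
  qed
  have inj: "inj_on g S" by (rule inj_onI) (metis dec)
  have "g ` S \<subseteq> {0..K} \<times> S'"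
  proof safe
    fix a b n assume n: "(a, b) = g n" "n \<in> S"
    have "fst (g n) \<in> insert 0 ((fst \<circ> g) ` S)" using n by auto
    hence "fst (g n) \<le> K" unfolding K_def using insert.prems(2) by (intro Max_ge) auto
    thus "a \<in> {0..K}" using n by (metis atLeastAtMost_iff fst_conv le0)
    show "b \<in> S'" unfolding S'_def using n by (metis comp_apply imageI snd_conv)
  qed
  have S'pos: "m > 0" if "m \<in> S'" for m using that nd unfolding S'_def by auto
  have "(\<Sum>n\<in>S. \<phi> n) = (\<Sum>n\<in>S. (case g n of (k, m) \<Rightarrow> \<phi> (p ^ k) * \<phi> m))"
    by (intro sum.cong) (auto simp: \<phi>n case_prod_unfold)
  also have "\<dots> = (\<Sum>(k, m)\<in>g ` S. \<phi> (p ^ k) * \<phi> m)" using inj by (simp add: sum.reindex)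
  also have "\<dots> \<le> (\<Sum>(k, m)\<in>{0..K} \<times> S'. \<phi> (p ^ k) * \<phi> m)"
    using \<open>g ` S \<subseteq> {0..K} \<times> S'\<close> insert.prems(2) S'pos p0
    by (intro sum_mono2) (auto simp: S'_def intro!: mult_nonneg_nonneg pos)
  also have "\<dots> = (\<Sum>k=0..K. \<phi> (p ^ k)) * (\<Sum>m\<in>S'. \<phi> m)"
    by (simp add: sum_product sum.cartesian_product)
  also have "\<dots> \<le> (1 + e p) * (\<Prod>p\<in>A. 1 + e p)"
  proof (intro mult_mono)
    show "(\<Sum>k=0..K. \<phi> (p ^ k)) \<le> 1 + e p"
      using e[OF p, of K] multiplicative_1[OF \<phi>] by (simp add: sum.atLeast_Suc_atMost)
    show "(\<Sum>m\<in>S'. \<phi> m) \<le> (\<Prod>p\<in>A. 1 + e p)"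
    proof (rule insert.IH)
      show "finite S'" using insert.prems by (simp add: S'_def)
      fix m assume "m \<in> S'"
      then obtain n where n: "n \<in> S" "m = snd (g n)" unfolding S'_def by auto
      have "m dvd n" using dec[of n] n by (metis dvd_triv_right)
      moreover have "n > 0" using n insert.prems by auto
      ultimately have "prime_factors m \<subseteq> insert p A" using insert.prems(3)[OF n(1)] dvd_prime_factors by
          (metis dual_order.trans neq0_conv)
      moreover have "p \<notin> prime_factors m" using nd[OF n(1)] n(2) by (auto simp: prime_factors_dvd)
      ultimately show "m > 0 \<and> prime_factors m \<subseteq> A" using nd[OF n(1)] n(2) by auto
    qed (use insert.prems in auto)
    show "0 \<le> 1 + e p" using e[OF p, of 0] by simp
    show "0 \<le> (\<Sum>m\<in>S'. \<phi> m)" using S'pos pos by (intro sum_nonneg) auto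
  qed
  also have "\<dots> = (\<Prod>p\<in>insert p A. 1 + e p)" using insert.hyps by simp
  finally show ?case .
qed

lemma euler_product_bound:
  fixes \<phi> e :: "nat \<Rightarrow> real"
  assumes \<phi>: "multiplicative \<phi>" and pos: "\<And>n. n > 0 \<Longrightarrow> \<phi> n \<ge> 0"
    and e: "\<And>p K. prime p \<Longrightarrow> (\<Sum>k=1..K. \<phi> (p ^ k)) \<le> e p"
    and e0: "\<And>n. e n \<ge> 0" and se: "summable e"
  shows "(\<Sum>n=1..N. \<phi> n) \<le> exp (suminf e)"
proof -
  define A where "A = {p\<in>{..N}. prime p}"
  have "(\<Sum>n=1..N. \<phi> n) \<le> (\<Prod>p\<in>A. 1 + e p)"
    by (rule euler_product_bound_finite[OF \<phi> pos e])
       (auto simp: A_def prime_factors_dvd dest: dvd_imp_le)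
  also have "\<dots> \<le> (\<Prod>p\<in>A. exp (e p))" using e0 by (intro prod_mono) (auto simp: add.commute exp_ge_add_one_self)
  also have "\<dots> = exp (\<Sum>p\<in>A. e p)" by (simp add: exp_sum A_def)
  also have "(\<Sum>p\<in>A. e p) \<le> suminf e" using e0 se by (intro sum_le_suminf) (auto simp: A_def)
  finally show ?thesis by simp
qed

section \<open>Partial summation\<close>

text \<open>Needed because \<open>t * poly S (ln t)\<close> has the derivative
  \<open>poly (S + pderiv S) (ln t)\<close>, so solving this equation integrates a polynomial in the
  logarithm.\<close>

lemma poly_plus_pderiv_surj:
  fixes Q :: "real poly"
  shows "\<exists>S. S + pderiv S = Q \<and> degree S = degree Q"
proof (induction "degree Q" arbitrary: Q rule: less_induct)
  case less
  show ?case
  proof (cases "degree Q = 0")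
    case True
    thus ?thesis by (intro exI[of _ Q]) (simp add: pderiv_eq_0_iff)
  next
    case False
    hence lt: "degree (pderiv Q) < degree Q" by (simp add: degree_pderiv)
    then obtain S where S: "S + pderiv S = pderiv Q" "degree S = degree (pderiv Q)" using less by blast
    show ?thesis
    proof (intro exI[of _ "Q - S"] conjI)
      show "Q - S + pderiv (Q - S) = Q" using S(1) by (simp add: pderiv_diff algebra_simps)
      have "degree S < degree Q" using S(2) lt by simp
      thus "degree (Q - S) = degree Q"
        by (metis degree_add_eq_left degree_minus diff_conv_add_uminus)
    qed
  qed
qed

lemma poly_over_power_tendsto:
  fixes Q :: "real poly"
  assumes "degree Q \<le> m"
  shows "((\<lambda>L. poly Q L / L ^ m) \<longlongrightarrow> coeff Q m) at_top"
proof -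
  have "((\<lambda>L. \<Sum>i\<le>m. coeff Q i * (L ^ i / L ^ m)) \<longlongrightarrow> (\<Sum>i\<le>m. coeff Q i * (if i = m then 1 else 0))) at_top"
  proof (intro tendsto_sum tendsto_mult tendsto_const)
    fix i assume i: "i \<in> {..m}"
    show "((\<lambda>L::real. L ^ i / L ^ m) \<longlongrightarrow> (if i = m then 1 else 0)) at_top"
    proof (cases "i = m")
      case True
      have "eventually (\<lambda>L::real. 1 = L ^ i / L ^ m) at_top"
        using eventually_gt_at_top[of 0] by eventually_elim (simp add: True)
      thus ?thesis using True by (simp add: tendsto_eventually eventually_mono)
    next
      case False
      hence "m - i > 0" using i by simp
      hence "((\<lambda>L::real. inverse (L ^ (m - i))) \<longlongrightarrow> 0) at_top"
        by (intro tendsto_inverse_0_at_top filterlim_pow_at_top filterlim_ident)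
      moreover have "eventually (\<lambda>L::real. inverse (L ^ (m - i)) = L ^ i / L ^ m) at_top"
        using eventually_gt_at_top[of 0]
        by eventually_elim (use i in \<open>simp add: power_diff field_simps\<close>)
      ultimately show ?thesis using False by (simp add: tendsto_cong)
    qed
  qed
  also have "(\<Sum>i\<le>m. coeff Q i * (if i = m then 1 else 0)) = coeff Q m"
    by (simp add: if_distrib[of "(*) _"] cong: if_cong)
  finally have "((\<lambda>L. \<Sum>i\<le>m. coeff Q i * (L ^ i / L ^ m)) \<longlongrightarrow> coeff Q m) at_top" .
  moreover have "(\<Sum>i\<le>m. coeff Q i * (L ^ i / L ^ m)) = poly Q L / L ^ m" for L
  proof -
    have "poly Q L = (\<Sum>i\<le>m. coeff Q i * L ^ i)"
      unfolding poly_altdef using assms by (intro sum.mono_neutral_left) (auto simp: coeff_eq_0)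
    thus ?thesis by (simp add: sum_divide_distrib)
  qed
  ultimately show ?thesis by simp
qed

lemma degree_eq_of_growth:
  fixes Q :: "real poly"
  assumes up: "\<And>L. L \<ge> 0 \<Longrightarrow> poly Q L \<le> C * (1 + L) ^ d"
    and lo: "\<And>L. L \<ge> 0 \<Longrightarrow> poly Q L \<ge> c * L ^ d - C'" and c: "c > 0" and d: "d > 0"
  shows "degree Q = d"
proof (rule linorder_cases[of "degree Q" d])
  assume lt: "degree Q < d"
  have "((\<lambda>L. poly Q L / L ^ d) \<longlongrightarrow> coeff Q d) at_top" using lt by (intro poly_over_power_tendsto) auto
  hence 1: "((\<lambda>L. poly Q L / L ^ d) \<longlongrightarrow> 0) at_top" using lt by (simp add: coeff_eq_0)
  have "((\<lambda>L::real. poly (monom c d - [:C':]) L / L ^ d) \<longlongrightarrow> coeff (monom c d - [:C':]) d) at_top"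
    by (intro poly_over_power_tendsto degree_diff_le) (auto simp: degree_monom_le)
  hence 2: "((\<lambda>L. (c * L ^ d - C') / L ^ d) \<longlongrightarrow> c) at_top" using d by (simp add: poly_monom coeff_pCons
      split: nat.splits)
  have "eventually (\<lambda>L. (c * L ^ d - C') / L ^ d \<le> poly Q L / L ^ d) at_top"
    using eventually_gt_at_top[of 0] by eventually_elim (use lo in \<open>auto intro!: divide_right_mono\<close>)
  from tendsto_le[OF _ 1 2 this] show ?thesis using c by simp
next
  assume gt: "degree Q > d"
  define n where "n = degree Q"
  have "((\<lambda>L. poly Q L / L ^ n) \<longlongrightarrow> coeff Q n) at_top" unfolding n_def by (intro poly_over_power_tendsto) auto
  hence 1: "((\<lambda>L. poly Q L / L ^ n) \<longlongrightarrow> lead_coeff Q) at_top" by (simp add: n_def)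
  define U where "U = smult C ([:1, 1:] ^ d)"
  have dU: "degree U \<le> d" unfolding U_def using degree_power_le[of "[:1, 1::real:]" d]
    by (metis degree_linear_power degree_smult_le)
  have "((\<lambda>L::real. poly U L / L ^ n) \<longlongrightarrow> coeff U n) at_top"
    using dU gt by (intro poly_over_power_tendsto) (auto simp: n_def)
  hence 2: "((\<lambda>L::real. C * (1 + L) ^ d / L ^ n) \<longlongrightarrow> 0) at_top"
    using dU gt by (simp add: coeff_eq_0 n_def) (simp add: U_def)
  have "eventually (\<lambda>L. poly Q L / L ^ n \<le> C * (1 + L) ^ d / L ^ n) at_top"
    using eventually_gt_at_top[of 0] by eventually_elim (use up in \<open>auto intro!: divide_right_mono\<close>)
  from tendsto_le[OF _ 2 1 this] have le: "lead_coeff Q \<le> 0" by simp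
  have 3: "((\<lambda>L::real. - C' / L ^ n) \<longlongrightarrow> 0) at_top"
    by (rule real_tendsto_divide_at_top[OF tendsto_const]) (use gt in \<open>auto intro!: filterlim_pow_at_top
        filterlim_ident simp: n_def\<close>)
  have "eventually (\<lambda>L. - C' / L ^ n \<le> poly Q L / L ^ n) at_top"
    using eventually_gt_at_top[of 0]
  proof eventually_elim
    case (elim L)
    have "- C' \<le> poly Q L" using lo[of L] elim c zero_le_power[of L d] mult_nonneg_nonneg[of c "L ^ d"]
        by linarith
    thus ?case using elim by (intro divide_right_mono) auto
  qed
  from tendsto_le[OF _ 1 3 this] have "lead_coeff Q = 0" using le by simp
  thus ?thesis using gt by auto
qed

lemma sum_powr_minus_le:
  fixes \<delta> :: real
  assumes \<delta>: "0 < \<delta>" "\<delta> \<le> 1 / 2"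
  shows "(\<Sum>n=1..<N. real n powr (- \<delta>)) \<le> 4 * real N powr (1 - \<delta>)"
proof (induction N)
  case (Suc N)
  show ?case
  proof (cases "N = 0")
    case False
    hence N: "real N \<ge> 1" by simp
    have "\<exists>z>real N. z < real N + 1 \<and>
      (real N + 1) powr (1 - \<delta>) - real N powr (1 - \<delta>) = (real N + 1 - real N) * ((1 - \<delta>) * z powr (1 - \<delta>
          - 1))"
      using N by (intro MVT2) (auto intro!: derivative_eq_intros)
    then obtain z where z: "z > real N" "z < real N + 1"
      "(real N + 1) powr (1 - \<delta>) - real N powr (1 - \<delta>) = (1 - \<delta>) * z powr (- \<delta>)" by auto
    have "real N powr (- \<delta>) \<le> 2 * (2 * real N) powr (- \<delta>)"
    proof -
      have "2 powr (- 1) \<le> 2 powr (- \<delta>)" using \<delta> by (intro powr_mono) auto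
      hence "1 \<le> 2 * 2 powr (- \<delta>)" by (simp add: powr_minus)
      hence "1 * real N powr (- \<delta>) \<le> (2 * 2 powr (- \<delta>)) * real N powr (- \<delta>)" by (intro mult_right_mono) auto
      thus ?thesis by (simp add: powr_mult)
    qed
    also have "(2 * real N) powr (- \<delta>) \<le> z powr (- \<delta>)" using z N \<delta> by (intro powr_mono2') auto
    also have "2 * z powr (- \<delta>) \<le> 4 * ((1 - \<delta>) * z powr (- \<delta>))"
    proof -
      have "2 * z powr (- \<delta>) \<le> (4 * (1 - \<delta>)) * z powr (- \<delta>)" using \<delta> by (intro mult_right_mono) auto
      thus ?thesis by (simp only: mult.assoc)
    qed
    also have "(1 - \<delta>) * z powr (- \<delta>) = (real N + 1) powr (1 - \<delta>) - real N powr (1 - \<delta>)" using z(3) by simp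
    finally show ?thesis using Suc False by (simp add: add.commute)
  qed simp
qed simp

lemma summatory_abel:
  "summatory (\<lambda>n. real n * b n) (real N) = real N * summatory b (real N) - (\<Sum>n=1..<N. summatory b (real n))"
proof (induction N)
  case (Suc N)
  show ?case
  proof (cases "N = 0")
    case False
    thus ?thesis using Suc unfolding summatory_Suc by (simp add: algebra_simps)
  qed (simp add: summatory_def)
qed (simp add: summatory_def)

lemma poly_ln_deriv:
  fixes S :: "real poly"
  assumes "t > 0"
  shows "((\<lambda>t. poly S (ln t)) has_real_derivative poly (pderiv S) (ln t) / t) (at t)"
  using DERIV_chain2[OF poly_DERIV DERIV_ln_divide[OF assms], of S] by simp

text \<open>Summation by parts gives \<open>N * Q (ln N)\<close> minus the sum of
  \<open>Q (ln n)\<close> over \<open>n < N\<close>. The latter is close to the antiderivative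
  \<open>G\<close>, that is to \<open>N * S (ln N)\<close>, and \<open>Q - S = pderiv S\<close> is
  the new main term. \<open>T\<close> measures the gap between sum and integral, and
  \<open>E\<close> the error of the hypothesis.\<close>

lemma abel_asymptotics:
  fixes Q S :: "real poly"
  assumes \<delta>: "0 < \<delta>" "\<delta> \<le> 1 / 2" and S: "S + pderiv S = Q"
    and W: "\<And>x. x \<ge> 1 \<Longrightarrow> \<bar>summatory b x - poly Q (ln x)\<bar> \<le> C * x powr (- \<delta>)"
  shows "\<exists>C'. \<forall>x\<ge>1. \<bar>summatory (\<lambda>n. real n * b n) x - x * poly (pderiv S) (ln x)\<bar> \<le> C' * x powr (1 - \<delta>)"
proof -
  have C0: "C \<ge> 0" using W[of 1] by simp
  define G where "G = (\<lambda>t. t * poly S (ln t))"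
  have dG: "(G has_real_derivative poly Q (ln t)) (at t)" if "t \<ge> 1" for t
    unfolding G_def using that S[symmetric]
    by (auto intro!: derivative_eq_intros poly_ln_deriv)
  have dQ: "((\<lambda>t. poly Q (ln t)) has_real_derivative poly (pderiv Q) (ln t) / t) (at t)" if "t \<ge> 1" for t
    using that by (intro poly_ln_deriv) auto
  obtain K1 where K1: "K1 \<ge> 0" "\<And>x. x \<ge> 1 \<Longrightarrow> \<bar>poly (pderiv Q) (ln x)\<bar> \<le> K1 * x powr (1 - \<delta>)"
    using poly_ln_le_powr[of "1 - \<delta>"] \<delta> by (metis add.commute diff_gt_0_iff_gt field_sum_of_halves
        le_less_trans less_add_same_cancel1 zero_less_divide_1_iff zero_less_numeral)
  define R where "R = pderiv S"
  obtain K2 where K2: "K2 \<ge> 0" "\<And>x. x \<ge> 1 \<Longrightarrow> \<bar>poly (R + pderiv R) (ln x)\<bar> \<le> K2 * x powr (1 - \<delta>)"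
    using poly_ln_le_powr[of "1 - \<delta>"] \<delta> by (metis add.commute diff_gt_0_iff_gt field_sum_of_halves
        le_less_trans less_add_same_cancel1 zero_less_divide_1_iff zero_less_numeral)
  define T where "T = (\<lambda>N::nat. (\<Sum>n=1..<N. poly Q (ln (real n))) - G (real N))"
  have T: "\<bar>T N - T 1\<bar> \<le> K1 * (\<Sum>n=1..<N. real n powr (- \<delta>))" if "N \<ge> 1" for N
    using that
  proof (induction N rule: dec_induct)
    case (step N)
    hence N: "real N \<ge> 1" by simp
    obtain z where z: "z > real N" "z < real N + 1" "G (real N + 1) - G (real N) = (real N + 1 - real N)
        * poly Q (ln z)"
      using MVT2[of "real N" "real N + 1" G "\<lambda>t. poly Q (ln t)"] dG N by auto
    obtain y where y: "y > real N" "y < z" "poly Q (ln z) - poly Q (ln (real N)) = (z - real N) * (poly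
        (pderiv Q) (ln y) / y)"
      using MVT2[of "real N" z "\<lambda>t. poly Q (ln t)" "\<lambda>y. poly (pderiv Q) (ln y) / y"] dQ N z by auto
    have y1: "y \<ge> 1" using y N by linarith
    have "T (Suc N) - T N = - ((z - real N) * (poly (pderiv Q) (ln y) / y))"
      unfolding T_def using z(3) y(3) step by (simp add: add.commute)
    hence "\<bar>T (Suc N) - T N\<bar> = (z - real N) * (\<bar>poly (pderiv Q) (ln y)\<bar> / y)" using z y1 by (simp add:
        abs_mult abs_divide)
    also have "\<dots> \<le> 1 * (K1 * y powr (1 - \<delta>) / y)"
      using z y1 K1 by (intro mult_mono divide_right_mono) auto
    also have "\<dots> = K1 * y powr (- \<delta>)" using y1 by (simp add: powr_diff powr_minus field_simps)
    also have "\<dots> \<le> K1 * real N powr (- \<delta>)" using K1 y N \<delta> by (intro mult_left_mono powr_mono2') auto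
    finally show ?case using step by (simp add: algebra_simps)
  qed simp
  define C2 where "C2 = C + 4 * C + 4 * K1 + \<bar>T 1\<bar>"
  have main: "\<bar>summatory (\<lambda>n. real n * b n) (real N) - real N * poly R (ln (real N))\<bar> \<le> C2 * real N powr
      (1 - \<delta>)"
    if N: "N \<ge> 1" for N
  proof -
    define p where "p = real N powr (1 - \<delta>)"
    have p1: "p \<ge> 1" unfolding p_def using N \<delta> by (intro ge_one_powr_ge_zero) auto
    have s: "(\<Sum>n=1..<N. real n powr (- \<delta>)) \<le> 4 * p" unfolding p_def by (rule sum_powr_minus_le[OF \<delta>])
    define E where "E = (\<lambda>n::nat. summatory b (real n) - poly Q (ln (real n)))"
    have E: "\<bar>E n\<bar> \<le> C * real n powr (- \<delta>)" if "n \<ge> 1" for n unfolding E_def using that by (intro W) auto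
    have "real N * poly R (ln (real N)) = real N * poly Q (ln (real N)) - G (real N)"
      unfolding R_def G_def S[symmetric] by (simp add: algebra_simps)
    hence "summatory (\<lambda>n. real n * b n) (real N) - real N * poly R (ln (real N)) =
        real N * E N - (\<Sum>n=1..<N. E n) - (T N - T 1) - T 1"
      unfolding summatory_abel T_def E_def by (simp add: sum_subtractf algebra_simps)
    moreover have "\<bar>real N * E N\<bar> \<le> C * p"
    proof -
      have "\<bar>real N * E N\<bar> \<le> real N * (C * real N powr (- \<delta>))"
        using E[OF N] by (simp add: abs_mult mult_left_mono)
      also have "\<dots> = C * p" unfolding p_def using N by (simp add: powr_diff powr_minus field_simps)
      finally show ?thesis .
    qed
    moreover have "\<bar>\<Sum>n=1..<N. E n\<bar> \<le> 4 * C * p"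
    proof -
      have "\<bar>\<Sum>n=1..<N. E n\<bar> \<le> (\<Sum>n=1..<N. C * real n powr (- \<delta>))"
        by (rule order_trans[OF sum_abs]) (intro sum_mono E, auto)
      also have "\<dots> \<le> C * (4 * p)" unfolding sum_distrib_left[symmetric] using s C0 by (intro mult_left_mono)
      finally show ?thesis by simp
    qed
    moreover have "\<bar>T N - T 1\<bar> \<le> 4 * K1 * p"
    proof -
      have "K1 * (\<Sum>n=1..<N. real n powr (- \<delta>)) \<le> K1 * (4 * p)" using s K1 by (intro mult_left_mono)
      thus ?thesis using T[OF N] by simp
    qed
    moreover have "\<bar>T 1\<bar> \<le> \<bar>T 1\<bar> * p" using p1 by (simp add: mult_le_cancel_left1)
    ultimately show ?thesis unfolding C2_def p_def[symmetric] distrib_right by linarith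
  qed
  have dR: "((\<lambda>t. t * poly R (ln t)) has_real_derivative poly (R + pderiv R) (ln t)) (at t)" if "t \<ge> 1" for t
    using that by (auto intro!: derivative_eq_intros poly_ln_deriv)
  show ?thesis
  proof (intro exI[of _ "C2 + K2"] allI impI)
    fix x :: real assume x: "x \<ge> 1"
    define N where "N = nat \<lfloor>x\<rfloor>"
    note N = floor_half_le[OF x, folded N_def]
    have N1: "N \<ge> 1" using N(1) by simp
    have "\<bar>x * poly R (ln x) - real N * poly R (ln (real N))\<bar> \<le> K2 * x powr (1 - \<delta>)"
    proof (cases "x = real N")
      case False
      hence lt: "real N < x" using N by simp
      obtain z where z: "z > real N" "z < x"
        "x * poly R (ln x) - real N * poly R (ln (real N)) = (x - real N) * poly (R + pderiv R) (ln z)"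
        using MVT2[OF lt, of "\<lambda>t. t * poly R (ln t)" "\<lambda>t. poly (R + pderiv R) (ln t)"] dR N(1) by auto
      have z1: "z \<ge> 1" using z N by linarith
      have "\<bar>x * poly R (ln x) - real N * poly R (ln (real N))\<bar> = (x - real N) * \<bar>poly (R + pderiv R) (ln z)\<bar>"
        unfolding z(3) using lt by (simp add: abs_mult)
      also have "\<dots> \<le> 1 * (K2 * z powr (1 - \<delta>))" using K2(2)[OF z1] N by (intro mult_mono) auto
      also have "\<dots> \<le> K2 * x powr (1 - \<delta>)" using z z1 K2 \<delta> by (simp, intro mult_left_mono powr_mono2) auto
      finally show ?thesis .
    qed (use K2 in simp)
    moreover have "\<bar>summatory (\<lambda>n. real n * b n) (real N) - real N * poly R (ln (real N))\<bar> \<le> C2 * x powr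
        (1 - \<delta>)"
    proof -
      have "C2 \<ge> 0" using C0 K1 by (simp add: C2_def)
      hence "C2 * real N powr (1 - \<delta>) \<le> C2 * x powr (1 - \<delta>)"
        using N \<delta> by (intro mult_left_mono powr_mono2) auto
      thus ?thesis using main[OF N1] by linarith
    qed
    moreover have "summatory (\<lambda>n. real n * b n) x = summatory (\<lambda>n. real n * b n) (real N)"
      unfolding N_def by (rule summatory_floor[symmetric]) (use x in simp)
    ultimately show "\<bar>summatory (\<lambda>n. real n * b n) x - x * poly (pderiv S) (ln x)\<bar> \<le> (C2 + K2) * x powr
        (1 - \<delta>)"
      unfolding R_def[symmetric] distrib_right by linarith
  qed
qed

section \<open>Convolutions with the tenfold divisor function\<close>

lemma summable_poly_geometric: "summable (\<lambda>k. (1 + real k) ^ 9 * 2 powr (- (15 / 1000) * real k))"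
proof -
  define Q :: "real poly" where "Q = [:1, 1:] ^ 9"
  obtain C where C: "C \<ge> 0" "\<And>L. \<bar>poly Q L\<bar> \<le> C * exp (5 / 1000 * \<bar>L\<bar>)"
    using poly_abs_le_exp[of "5 / 1000" Q] by auto
  define r where "r = exp (5 / 1000 - 15 / 1000 * ln 2 :: real)"
  \<comment> \<open>Since \<open>ln 2 \<ge> 2/3\<close>, the geometric decay has rate at least
    10/1000, twice the 5/1000 granted to the polynomial factor.\<close>
  have "5 / 1000 - 15 / 1000 * ln 2 < (0::real)" using ln2_ge_two_thirds by linarith
  hence r: "0 < r" "r < 1" unfolding r_def by auto
  show ?thesis
  proof (rule summable_comparison_test')
    show "summable (\<lambda>k. C * r ^ k)" using r by (intro summable_mult summable_geometric) auto
    fix k :: nat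
    have "(1 + real k) ^ 9 \<le> C * exp (5 / 1000 * real k)" using C(2)[of "real k"] by (simp add: Q_def)
    hence "(1 + real k) ^ 9 * 2 powr (- (15 / 1000) * real k) \<le> C * exp (5 / 1000 * real k) * 2 powr (-
        (15 / 1000) * real k)"
      by (intro mult_right_mono) auto
    also have "\<dots> = C * exp (5 / 1000 * real k) * exp (- (15 / 1000) * real k * ln 2)" by (simp add: powr_def)
    also have "\<dots> = C * r ^ k"
      unfolding r_def exp_of_nat_mult[symmetric] mult.assoc exp_add[symmetric] by (simp add: algebra_simps)
    finally show "norm ((1 + real k) ^ 9 * 2 powr (- (15 / 1000) * real k)) \<le> C * r ^ k" by simp
  qed
qed

text \<open>The exponent has two parts with separate duties: \<open>p powr (- 1055 / 1000)\<close>
  is summable over \<open>p\<close>, and the rest is at most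
  \<open>2 powr (- 15 / 1000 * k)\<close>, whose sum over \<open>k\<close> against the polynomial is
  bounded uniformly in \<open>p\<close>.\<close>

lemma multiplicative_sum_bounded:
  fixes g :: "nat \<Rightarrow> real"
  assumes g: "multiplicative g" and pos: "\<And>n. n > 0 \<Longrightarrow> g n \<ge> 0"
    and g1: "\<And>p. prime p \<Longrightarrow> g p = 0" and A: "A \<ge> 0"
    and gk: "\<And>p k. prime p \<Longrightarrow> k \<ge> 2 \<Longrightarrow>
       g (p ^ k) \<le> A * (1 + real k) ^ 9 * real p powr (- (1055 / 1000) - 15 / 1000 * real k)"
  shows "\<exists>B. \<forall>N. (\<Sum>n=1..N. g n) \<le> B"
proof -
  define s where "s = (\<lambda>k. (1 + real k) ^ 9 * 2 powr (- (15 / 1000) * real k))"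
  have ss: "summable s" unfolding s_def by (rule summable_poly_geometric)
  have s0: "s k \<ge> 0" for k by (simp add: s_def)
  define B where "B = A * suminf s"
  have B0: "B \<ge> 0" unfolding B_def using A suminf_nonneg[OF ss s0] by simp
  define e where "e = (\<lambda>p::nat. B * real p powr (- (1055 / 1000)))"
  have e: "(\<Sum>k=1..K. g (p ^ k)) \<le> e p" if p: "prime p" for p K
  proof -
    define P where "P = real p powr (- (1055 / 1000))"
    have p2: "real p \<ge> 2" using prime_ge_2_nat[OF p] by simp
    have tm: "g (p ^ k) \<le> A * P * s k" if k: "k \<ge> 1" for k
    proof (cases "k = 1")
      case True
      thus ?thesis using g1[OF p] A s0[of k] by (simp add: P_def)
    next
      case False
      hence "g (p ^ k) \<le> A * (1 + real k) ^ 9 * real p powr (- (1055 / 1000) - 15 / 1000 * real k)"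
        using k by (intro gk[OF p]) auto
      also have "real p powr (- (1055 / 1000) - 15 / 1000 * real k) = P * real p powr (- (15 / 1000) *
          real k)"
        unfolding P_def powr_add[symmetric] by simp
      also have "A * (1 + real k) ^ 9 * (P * real p powr (- (15 / 1000) * real k)) \<le>
          A * (1 + real k) ^ 9 * (P * 2 powr (- (15 / 1000) * real k))"
        using p2 A by (intro mult_left_mono powr_mono2') (auto simp: P_def)
      finally show ?thesis by (simp add: s_def mult_ac)
    qed
    have "(\<Sum>k=1..K. g (p ^ k)) \<le> (\<Sum>k=1..K. A * P * s k)" by (intro sum_mono tm) auto
    also have "\<dots> = A * P * (\<Sum>k=1..K. s k)" by (simp add: sum_distrib_left)
    also have "\<dots> \<le> A * P * suminf s"
      using A s0 ss by (intro mult_left_mono sum_le_suminf) (auto simp: P_def)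
    finally show ?thesis by (simp add: e_def B_def P_def mult_ac)
  qed
  have "summable (\<lambda>n. real n powr (- (1055 / 1000)))" by (subst summable_real_powr_iff) auto
  hence se: "summable e" unfolding e_def by (rule summable_mult)
  show ?thesis
    using euler_product_bound[OF g pos e _ se] B0 by (auto simp: e_def)
qed

section \<open>The tenfold divisor function and its Bell series
  \<open>(1 - X) ^ (-10)\<close>\<close>

definition geometric_fps :: "real fps" where
  "geometric_fps = Abs_fps (\<lambda>_. 1)"

lemma geometric_fps_mult: "(1 - fps_X) * geometric_fps = 1"
  by (rule fps_ext) (auto simp: geometric_fps_def left_diff_distrib)

lemma geometric_fps_power_bounds:
  "0 \<le> fps_nth (geometric_fps ^ Suc m) j \<and> fps_nth (geometric_fps ^ Suc m) j \<le> (1 + real j) ^ m"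
proof (induction m arbitrary: j)
  case 0
  show ?case by (simp add: geometric_fps_def)
next
  case (Suc m)
  have eq: "fps_nth (geometric_fps ^ Suc (Suc m)) j = (\<Sum>i=0..j. fps_nth (geometric_fps ^ Suc m) (j - i))"
    by (subst power_Suc) (simp add: fps_mult_nth geometric_fps_def)
  have "fps_nth (geometric_fps ^ Suc (Suc m)) j \<le> (\<Sum>i=0..j. (1 + real j) ^ m)"
    unfolding eq
  proof (rule sum_mono)
    fix i
    have "fps_nth (geometric_fps ^ Suc m) (j - i) \<le> (1 + real (j - i)) ^ m" using Suc by blast
    also have "\<dots> \<le> (1 + real j) ^ m" by (intro power_mono) auto
    finally show "fps_nth (geometric_fps ^ Suc m) (j - i) \<le> (1 + real j) ^ m" .
  qed
  also have "\<dots> = (1 + real j) ^ Suc m" by simp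
  finally show ?case using Suc unfolding eq by (auto intro: sum_nonneg)
qed

text \<open>Multiplication by \<open>1 - fps_X\<close> takes differences of neighbouring
  coefficients, which at most doubles a monotone bound.\<close>

lemma fps_difference_bound:
  fixes F :: "real fps"
  assumes "\<And>j. \<bar>fps_nth F j\<bar> \<le> b j" "mono b"
  shows "\<bar>fps_nth (F * (1 - fps_X) ^ m) k\<bar> \<le> 2 ^ m * b k"
proof (induction m arbitrary: k)
  case (Suc m)
  define G where "G = F * (1 - fps_X) ^ m"
  have b0: "b j \<ge> 0" for j using assms(1)[of j] by linarith
  have eq: "F * (1 - fps_X) ^ Suc m = G - G * fps_X" by (simp add: G_def algebra_simps)
  have "\<bar>fps_nth (G * fps_X) k\<bar> \<le> 2 ^ m * b k"
  proof (cases "k = 0")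
    case False
    have "\<bar>fps_nth G (k - 1)\<bar> \<le> 2 ^ m * b (k - 1)" unfolding G_def by (rule Suc)
    also have "\<dots> \<le> 2 ^ m * b k" by (intro mult_left_mono monoD[OF assms(2)]) auto
    finally show ?thesis using False by simp
  qed (use b0 in simp)
  moreover have "\<bar>fps_nth G k\<bar> \<le> 2 ^ m * b k" unfolding G_def by (rule Suc)
  ultimately show ?case unfolding eq by simp
qed (use assms in simp)

text \<open>Ten is reached by doubling and then as 8 + 2: a chain of four convolutions halves the
  saving 9/10 only four times, to 9/160, whereas adding one factor at a time would halve it nine
  times and fall below 3/100.\<close>

definition "tau2 = dirichlet_conv (\<lambda>_. 1) (\<lambda>_. 1)"
definition "tau4 = dirichlet_conv tau2 tau2"
definition "tau8 = dirichlet_conv tau4 tau4"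
definition "tau10 = dirichlet_conv tau8 tau2"

lemma multiplicative_one: "multiplicative (\<lambda>_. 1)"
  by (simp add: multiplicative_def)

lemma multiplicative_tau:
  "multiplicative tau2" "multiplicative tau4" "multiplicative tau8" "multiplicative tau10"
  unfolding tau10_def tau8_def tau4_def tau2_def
  by (intro multiplicative_conv multiplicative_one)+

lemma prime_series_tau10: "prime p \<Longrightarrow> prime_series tau10 p = geometric_fps ^ 10"
  unfolding tau10_def tau8_def tau4_def tau2_def
  by (simp add: prime_series_conv, simp add: prime_series_def flip: geometric_fps_def)
     (simp add: eval_nat_numeral mult_ac)

lemma tau10_prime_power_bounds:
  assumes "prime p"
  shows "0 \<le> tau10 (p ^ k)" "tau10 (p ^ k) \<le> (1 + real k) ^ 9"
  using geometric_fps_power_bounds[of 9 k] prime_series_tau10[OF assms] prime_series_nth[of tau10 p k]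
  by (simp_all add: eval_nat_numeral)

lemma conv_prime:
  assumes "multiplicative a" "multiplicative b" "prime p"
  shows "dirichlet_conv a b p = a p + b p"
  using dirichlet_conv_prime_power[OF assms(3), of a b 1] assms(1,2)
  by (simp add: multiplicative_def)

lemma tau10_prime: "prime p \<Longrightarrow> tau10 p = 10"
  unfolding tau10_def tau8_def tau4_def tau2_def
  by (simp add: conv_prime multiplicative_conv multiplicative_one)

lemma per_index_one: "per_index (\<lambda>_. 1) = (\<lambda>n. 1 / real n)"
  by (simp add: per_index_def fun_eq_iff)

lemma log_class_tau10: "log_class (9 / 160) (per_index tau10)"
proof -
  have 2: "log_class (9 / 20) (per_index tau2)"
    unfolding tau2_def per_index_conv per_index_one using log_class_conv[OF log_class_inverse
        log_class_inverse] by simp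
  have 4: "log_class (9 / 40) (per_index tau4)"
    unfolding tau4_def per_index_conv using log_class_conv[OF 2 2] by simp
  have 8: "log_class (9 / 80) (per_index tau8)"
    unfolding tau8_def per_index_conv using log_class_conv[OF 4 4] by simp
  have b2: "log_class (9 / 80) (per_index tau2)" using log_class_mono[OF 2] by simp
  show ?thesis
    unfolding tau10_def per_index_conv using log_class_conv[OF 8 b2] by simp
qed

lemma tau_nonneg: "0 \<le> tau2 n" "0 \<le> tau4 n" "0 \<le> tau8 n" "0 \<le> tau10 n"
  unfolding tau10_def tau8_def tau4_def tau2_def dirichlet_conv_def
  by (auto intro!: sum_nonneg mult_nonneg_nonneg)

lemma per_index_nonneg: "0 \<le> a n \<Longrightarrow> 0 \<le> per_index a n"
  by (simp add: per_index_def)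

lemma summatory_inverse_bounds:
  assumes "x \<ge> 1"
  shows "summatory (per_index (\<lambda>_. 1)) x \<le> 1 + ln x" "ln x \<le> summatory (per_index (\<lambda>_. 1)) x"
proof -
  define N where "N = nat \<lfloor>x\<rfloor>"
  note N = floor_half_le[OF assms, folded N_def]
  have eq: "summatory (per_index (\<lambda>_. 1)) x = harm N"
    by (simp add: summatory_def per_index_def harm_def N_def divide_inverse)
  obtain M where M: "N = Suc M" using N(1) by (cases N) auto
  have "harm N \<le> ln (real N) + 1"
    using decseqD[OF decseq_harm_diff_ln, of 0 M] by (simp add: M harm_expand)
  also have "ln (real N) \<le> ln x" using N assms by (subst ln_le_cancel_iff) auto
  finally show "summatory (per_index (\<lambda>_. 1)) x \<le> 1 + ln x" unfolding eq by simp
  have "ln x \<le> ln (real N + 1)" using N assms by (subst ln_le_cancel_iff) auto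
  also have "\<dots> \<le> harm N" using ln_le_harm[of N] by (simp add: add.commute)
  finally show "ln x \<le> summatory (per_index (\<lambda>_. 1)) x" unfolding eq .
qed

lemma summatory_tau10_le:
  assumes "x \<ge> 1"
  shows "summatory (per_index tau10) x \<le> (1 + ln x) ^ 10"
proof -
  define w where "w = summatory (per_index (\<lambda>_. 1)) x"
  have w0: "w \<ge> 0" unfolding w_def by (intro summatory_nonneg per_index_nonneg) auto
  have x0: "x \<ge> 0" using assms by simp
  have 2: "summatory (per_index tau2) x \<le> w * w"
    unfolding tau2_def per_index_conv w_def by (intro summatory_conv_le per_index_nonneg x0) auto
  have 4: "summatory (per_index tau4) x \<le> (w * w) * (w * w)"
    unfolding tau4_def per_index_conv
    by (rule order_trans[OF summatory_conv_le]) (intro per_index_nonneg tau_nonneg x0 mult_mono 2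
        summatory_nonneg mult_nonneg_nonneg w0)+
  have 8: "summatory (per_index tau8) x \<le> ((w * w) * (w * w)) * ((w * w) * (w * w))"
    unfolding tau8_def per_index_conv
    by (rule order_trans[OF summatory_conv_le]) (intro per_index_nonneg tau_nonneg x0 mult_mono 4
        summatory_nonneg mult_nonneg_nonneg w0)+
  have "summatory (per_index tau10) x \<le> (((w * w) * (w * w)) * ((w * w) * (w * w))) * (w * w)"
    unfolding tau10_def per_index_conv
    by (rule order_trans[OF summatory_conv_le]) (intro per_index_nonneg tau_nonneg x0 mult_mono 8 2
        summatory_nonneg mult_nonneg_nonneg w0)+
  also have "\<dots> = w ^ 10" by (simp add: eval_nat_numeral)
  also have "\<dots> \<le> (1 + ln x) ^ 10"
    using w0 summatory_inverse_bounds(1)[OF assms] unfolding w_def by (intro power_mono)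
  finally show ?thesis .
qed

text \<open>Ten factors that are at most \<open>x\<close> each have a product of at most
  \<open>x ^ 10\<close>. Applied at a tenth root this costs only the constant factor
  \<open>10 ^ 10\<close>.\<close>

lemma summatory_tau10_ge:
  assumes "x \<ge> 1"
  shows "ln x ^ 10 \<le> summatory (per_index tau10) (x ^ 10)"
proof -
  define w where "w = summatory (per_index (\<lambda>_. 1)) x"
  have w0: "w \<ge> 0" unfolding w_def by (intro summatory_nonneg per_index_nonneg) auto
  have x0: "x \<ge> 0" using assms by simp
  have 2: "w * w \<le> summatory (per_index tau2) (x * x)"
    unfolding tau2_def per_index_conv w_def by (intro summatory_conv_ge per_index_nonneg x0) auto
  have 4: "(w * w) * (w * w) \<le> summatory (per_index tau4) ((x * x) * (x * x))"
    unfolding tau4_def per_index_conv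
    by (rule order_trans[OF _ summatory_conv_ge]) (intro per_index_nonneg tau_nonneg x0 mult_mono 2
        summatory_nonneg mult_nonneg_nonneg w0)+
  have 8: "((w * w) * (w * w)) * ((w * w) * (w * w)) \<le> summatory (per_index tau8) (((x * x) * (x * x)) *
      ((x * x) * (x * x)))"
    unfolding tau8_def per_index_conv
    by (rule order_trans[OF _ summatory_conv_ge]) (intro per_index_nonneg tau_nonneg x0 mult_mono 4
        summatory_nonneg mult_nonneg_nonneg w0)+
  have "ln x ^ 10 \<le> w ^ 10"
    using assms summatory_inverse_bounds(2)[OF assms] unfolding w_def by (intro power_mono) auto
  also have "w ^ 10 = (((w * w) * (w * w)) * ((w * w) * (w * w))) * (w * w)" by (simp add: eval_nat_numeral)
  also have "\<dots> \<le> summatory (per_index tau10) ((((x * x) * (x * x)) * ((x * x) * (x * x))) * (x * x))"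
    unfolding tau10_def per_index_conv
    by (rule order_trans[OF _ summatory_conv_ge]) (intro per_index_nonneg tau_nonneg x0 mult_mono 8 2
        summatory_nonneg mult_nonneg_nonneg w0)+
  also have "(((x * x) * (x * x)) * ((x * x) * (x * x))) * (x * x) = x ^ 10" by (simp add: eval_nat_numeral)
  finally show ?thesis .
qed

text \<open>The range \<open>z < 1\<close> is included because the series over \<open>m\<close> in
  the main argument runs over all \<open>m\<close>, with \<open>z = x / m\<close>. There the sum is
  empty, and the polynomial is dominated by \<open>z powr (- (3 / 100))\<close>, which is large for
  small \<open>z\<close>.\<close>

lemma summatory_tau10_asymptotics:
  obtains Q :: "real poly" and C where
    "\<And>z. z > 0 \<Longrightarrow> \<bar>summatory (per_index tau10) z - poly Q (ln z)\<bar> \<le> C * z powr (- (3 / 100))"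
proof -
  have "poly_log (9 / 160) (summatory (\<lambda>n. per_index tau10 n * ln (real n) ^ 0))"
    using log_class_tau10 unfolding log_class_def by blast
  then obtain Q where Q: "small_error (9 / 160) (\<lambda>x. summatory (per_index tau10) x - poly Q (ln x))"
    unfolding poly_log_def by auto
  obtain C1 where C1: "C1 \<ge> 0"
    "\<And>x. x \<ge> 1 \<Longrightarrow> \<bar>summatory (per_index tau10) x - poly Q (ln x)\<bar> \<le> C1 * x powr (- (3 / 100))"
    by (rule small_errorE[OF Q, of "3 / 100"]) auto
  obtain C2 where C2: "C2 \<ge> 0" "\<And>L. \<bar>poly Q L\<bar> \<le> C2 * exp (3 / 100 * \<bar>L\<bar>)"
    using poly_abs_le_exp[of "3 / 100" Q] by auto
  show ?thesis
  proof (rule that[of Q "C1 + C2"])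
    fix z :: real assume z: "z > 0"
    have p: "z powr (- (3 / 100)) \<ge> 0" by simp
    have m: "C1 * z powr (- (3 / 100)) \<ge> 0" "C2 * z powr (- (3 / 100)) \<ge> 0" using C1(1) C2(1) by simp_all
    show "\<bar>summatory (per_index tau10) z - poly Q (ln z)\<bar> \<le> (C1 + C2) * z powr (- (3 / 100))"
    proof (cases "z \<ge> 1")
      case True
      thus ?thesis using C1(2)[OF True] m unfolding distrib_right by linarith
    next
      case False
      have "summatory (per_index tau10) z = 0" using False z by (simp add: summatory_def)
      moreover have "\<bar>poly Q (ln z)\<bar> \<le> C2 * z powr (- (3 / 100))"
        using C2(2)[of "ln z"] False z by (simp add: powr_def)
      ultimately show ?thesis using m unfolding distrib_right by linarith
    qed
  qed
qed

text \<open>Nine tenths of \<open>e \<le> 19 * (k - 1) / 20\<close> plus one tenth of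
  \<open>e \<le> k - 2\<close>. The two lines cross at \<open>k = 21\<close>, where the result is
  sharp. The outcome has both features that \<open>multiplicative_sum_bounded\<close> asks for: a
  constant below -1 and a negative slope in \<open>k\<close>.\<close>

lemma exponent_bound:
  fixes k :: nat
  assumes "k \<ge> 2"
  shows "real (19 * (k - 1) div 20) - 97 / 100 * real k \<le> - (1055 / 1000) - 15 / 1000 * real k"
proof -
  define e where "e = 19 * (k - 1) div 20"
  obtain j where j: "k = Suc (Suc j)" using le_Suc_ex[OF assms] by auto
  have e: "e \<le> j" "20 * e \<le> 19 * Suc j" unfolding e_def j by simp_all
  have "real (20 * e) \<le> real (19 * Suc j)" using e(2) by (simp only: of_nat_le_iff)
  hence "20 * real e \<le> 19 * (real j + 1)" by simp
  hence "900 * (20 * real e) \<le> 900 * (19 * (real j + 1))" by (intro mult_left_mono) auto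
  moreover have "2000 * real e \<le> 2000 * real j" using e(1) by simp
  ultimately have "900 * (20 * real e) + 2000 * real e \<le> 900 * (19 * (real j + 1)) + 2000 * real j"
    by (rule add_mono)
  hence "real e * 20000 \<le> 17100 + real j * 19100" by (simp add: algebra_simps)
  thus ?thesis unfolding e_def[symmetric] unfolding j of_nat_Suc by (simp add: field_simps)
qed

section \<open>Asymptotics of the sums of a multiplicative function close to the tenfold divisor
  function\<close>

lemma summable_of_bounded_sums:
  fixes a :: "nat \<Rightarrow> real"
  assumes "\<And>n. a n \<ge> 0" "a 0 = 0" "\<And>N. (\<Sum>n=1..N. a n) \<le> B"
  shows "summable a"
proof (rule summableI_nonneg_bounded)
  fix n
  have "sum a {..<n} \<le> sum a {0..n}" using assms(1) by (intro sum_mono2) auto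
  also have "\<dots> = sum a {1..n}" using assms(2) by (simp add: sum.atLeast_Suc_atMost)
  also have "\<dots> \<le> B" by (rule assms)
  finally show "sum a {..<n} \<le> B" .
qed (rule assms)

text \<open>With \<open>H m = h m / m\<close>, the sum of \<open>f n / n\<close> up to
  \<open>x\<close> equals the series of \<open>H m * W (x / m)\<close>. Replacing \<open>W\<close>
  by its polynomial and collecting powers of \<open>ln m\<close> gives a polynomial in
  \<open>ln x\<close>, and the total error is governed by the series of
  \<open>\<bar>H m\<bar> * m powr (3 / 100)\<close>. The polynomial has degree 10; removing the
  weights \<open>1 / n\<close> differentiates and leaves degree 9.\<close>

theorem multiplicative_asymptotics:
  fixes f :: "nat \<Rightarrow> real"
  assumes f: "multiplicative f" and f0: "\<And>n. f n \<ge> 0" and fp: "\<And>p. prime p \<Longrightarrow> f p = 10"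
    and A: "A \<ge> 0" and fk: "\<And>p k. prime p \<Longrightarrow> f (p ^ k) \<le> A * (1 + real k) ^ 8 * real (p ^ (19 * (k - 1)
        div 20))"
  shows "\<exists>P :: real poly. degree P = 9 \<and>
    (\<exists>C. \<forall>x\<ge>1. \<bar>summatory f x - x * poly P (ln x)\<bar> \<le> C * x powr (97 / 100))"
proof -
  \<comment> \<open>The Bell series of \<open>f\<close> divided by that of
    \<open>tau10\<close>.\<close>
  define G where "G = (\<lambda>p k. fps_nth (prime_series f p * (1 - fps_X) ^ 10) k)"
  define h where "h = from_prime_powers G"
  have f1: "f 1 = 1" by (rule multiplicative_1[OF f])
  have G0: "G p 0 = 1" for p using f1 by (simp add: G_def fps_power_zeroth)
  have h: "multiplicative h" unfolding h_def by (rule multiplicative_from_prime_powers)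
  have psh: "prime_series h p = prime_series f p * (1 - fps_X) ^ 10" if "prime p" for p
    by (rule fps_ext) (simp only: prime_series_nth h_def from_prime_powers_prime_power[of p G, OF that
        G0], simp only: G_def)
  have conv: "dirichlet_conv h tau10 n = f n" if "n > 0" for n
  proof (rule conv_eqI[OF h multiplicative_tau(4) f that])
    fix p :: nat assume p: "prime p"
    have "prime_series h p * prime_series tau10 p = prime_series f p * ((1 - fps_X) * geometric_fps) ^ 10"
      unfolding psh[OF p] prime_series_tau10[OF p] power_mult_distrib by (simp add: mult.assoc)
    thus "prime_series h p * prime_series tau10 p = prime_series f p" by (simp add: geometric_fps_mult)
  qed
  have hp: "h p = 0" if p: "prime p" for p
    using conv[of p] conv_prime[OF h multiplicative_tau(4) p] fp[OF p] tau10_prime[OF p]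
        prime_gt_0_nat[OF p] by simp
  have hk: "\<bar>h (p ^ k)\<bar> \<le> 1024 * A * (1 + real k) ^ 9 * real (p ^ (19 * (k - 1) div 20))" if p: "prime p"
      for p k
  proof -
    define b where "b = (\<lambda>k. A * (1 + real k) ^ 8 * real (p ^ (19 * (k - 1) div 20)))"
    have p1: "p \<ge> 1" using p prime_ge_1_nat by blast
    have "mono b"
    proof (rule monoI)
      fix i j :: nat assume ij: "i \<le> j"
      have "p ^ (19 * (i - 1) div 20) \<le> p ^ (19 * (j - 1) div 20)"
        using p1 ij by (intro power_increasing div_le_mono mult_le_mono2 diff_le_mono)
      thus "b i \<le> b j" unfolding b_def using A ij
        by (intro mult_mono power_mono) (auto simp del: of_nat_power)
    qed
    moreover have "\<bar>fps_nth (prime_series f p) j\<bar> \<le> b j" for j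
      using fk[OF p, of j] f0 by (simp add: b_def)
    ultimately have "\<bar>fps_nth (prime_series f p * (1 - fps_X) ^ 10) k\<bar> \<le> 2 ^ 10 * b k"
      by (intro fps_difference_bound)
    hence "\<bar>h (p ^ k)\<bar> \<le> 1024 * b k" using prime_series_nth[of h p k] unfolding psh[OF p] by simp
    also have "b k \<le> A * (1 + real k) ^ 9 * real (p ^ (19 * (k - 1) div 20))"
      unfolding b_def using A by (intro mult_right_mono mult_left_mono power_increasing) auto
    finally show ?thesis by (simp add: mult_ac)
  qed
  \<comment> \<open>As 97/100 = 1 - 3/100, this is
    \<open>\<bar>H m\<bar> * m powr (3 / 100)\<close>. The factor \<open>m powr (3 / 100)\<close> is
    just what the error term of \<open>W\<close> at \<open>x / m\<close> produces, and it also
    absorbs every power of \<open>ln m\<close>.\<close>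
  define a where "a = (\<lambda>m. \<bar>h m\<bar> * real m powr (- (97 / 100)))"
  have a0: "a m \<ge> 0" for m by (simp add: a_def)
  have "multiplicative a"
    unfolding multiplicative_def a_def
    using multiplicative_1[OF h] by (auto simp: multiplicative_mult[OF h] abs_mult powr_mult)
  moreover have "a (p ^ k) \<le> (1024 * A) * (1 + real k) ^ 9 * real p powr (- (1055 / 1000) - 15 / 1000 *
      real k)"
    if p: "prime p" and k: "k \<ge> 2" for p k
  proof -
    have p1: "real p \<ge> 1" using prime_ge_1_nat[OF p] by simp
    have pw: "real (p ^ j) = real p powr real j" for j using p1 by (simp add: powr_realpow)
    have pw2: "real (p ^ k) powr (- (97 / 100)) = real p powr (- (97 / 100) * real k)"
      unfolding pw powr_powr by (simp add: mult.commute)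
    have "a (p ^ k) \<le> 1024 * A * (1 + real k) ^ 9 * real (p ^ (19 * (k - 1) div 20)) * real (p ^ k) powr
        (- (97 / 100))"
      unfolding a_def by (intro mult_right_mono hk[OF p]) auto
    also have "\<dots> = 1024 * A * (1 + real k) ^ 9 * (real p powr real (19 * (k - 1) div 20) * real p powr (-
        (97 / 100) * real k))"
      unfolding pw2 unfolding pw by (simp only: mult.assoc)
    also have "real p powr real (19 * (k - 1) div 20) * real p powr (- (97 / 100) * real k) =
        real p powr (real (19 * (k - 1) div 20) - 97 / 100 * real k)" unfolding powr_add[symmetric] by simp
    also have "1024 * A * (1 + real k) ^ 9 * \<dots> \<le> 1024 * A * (1 + real k) ^ 9 * real p powr (- (1055 /
        1000) - 15 / 1000 * real k)"
      using A p1 by (intro mult_left_mono powr_mono exponent_bound[OF k]) auto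
    finally show ?thesis .
  qed
  ultimately obtain B where B: "\<And>N. (\<Sum>n=1..N. a n) \<le> B"
    using multiplicative_sum_bounded[of a "1024 * A"] A a0 hp by (auto simp: a_def)
  have sa: "summable a" by (rule summable_of_bounded_sums[OF a0 _ B]) (simp add: a_def)
  define H where "H = per_index h"
  have Ha: "\<bar>H m\<bar> * real m powr (3 / 100) = a m" for m
  proof (cases "m = 0")
    case False
    have "real m powr (3 / 100) / real m = real m powr (3 / 100 - 1)" unfolding powr_diff using False by simp
    thus ?thesis by (simp add: H_def per_index_def a_def abs_divide) (metis mult.commute
        times_divide_eq_right)
  qed (simp add: H_def per_index_def a_def)
  have Hle: "\<bar>H m\<bar> \<le> a m" for m
  proof (cases "m = 0")
    case False
    hence "1 \<le> real m powr (3 / 100)" by (intro ge_one_powr_ge_zero) auto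
    hence "\<bar>H m\<bar> * 1 \<le> \<bar>H m\<bar> * real m powr (3 / 100)" by (intro mult_left_mono) auto
    thus ?thesis using Ha by simp
  qed (simp add: H_def per_index_def a_def)
  define W where "W = summatory (per_index tau10)"
  obtain Q :: "real poly" and C where QC: "\<And>z. z > 0 \<Longrightarrow> \<bar>W z - poly Q (ln z)\<bar> \<le> C * z powr (- (3 / 100))"
    using summatory_tau10_asymptotics unfolding W_def by blast
  have C0: "C \<ge> 0" using QC[of 1] by simp
  obtain N R where R: "\<And>L M. poly Q (L - M) = (\<Sum>s<(N::nat). poly (R s) L * M ^ s)"
    using poly_diff_expand by blast
  define c where "c = (\<lambda>s. \<Sum>m. H m * ln (real m) ^ s)"
  have sc: "summable (\<lambda>m. H m * ln (real m) ^ s)" for s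
  proof -
    obtain K where K: "K \<ge> 0" "\<And>x::real. x \<ge> 1 \<Longrightarrow> \<bar>poly (monom 1 s) (ln x)\<bar> \<le> K * x powr (3 / 100)"
      using poly_ln_le_powr[of "3 / 100" "monom 1 s"] by auto
    show ?thesis
    proof (rule summable_comparison_test')
      show "summable (\<lambda>m. K * a m)" by (intro summable_mult sa)
      fix m :: nat
      show "norm (H m * ln (real m) ^ s) \<le> K * a m"
      proof (cases "m = 0")
        case False
        hence "\<bar>ln (real m) ^ s\<bar> \<le> K * real m powr (3 / 100)" using K(2)[of "real m"] by (simp add:
            poly_monom)
        hence "\<bar>H m\<bar> * \<bar>ln (real m) ^ s\<bar> \<le> \<bar>H m\<bar> * (K * real m powr (3 / 100))" by (intro mult_left_mono) auto
        also have "\<dots> = K * a m" unfolding Ha[symmetric] by simp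
        finally show ?thesis by (simp add: abs_mult)
      qed (simp add: H_def per_index_def a_def)
    qed
  qed
  define Qf where "Qf = (\<Sum>s<N. smult (c s) (R s))"
  define Wf where "Wf = summatory (per_index f)"
  have Wf_conv: "Wf x = summatory (dirichlet_conv H (per_index tau10)) x" for x
    unfolding Wf_def H_def per_index_conv[symmetric] summatory_def
    by (intro sum.cong) (auto simp: per_index_def conv)
  define C1 where "C1 = C * suminf a"
  have C1: "\<bar>Wf x - poly Qf (ln x)\<bar> \<le> C1 * x powr (- (3 / 100))" if x: "x \<ge> 1" for x
  proof -
    \<comment> \<open>\<open>W\<close> vanishes below 1, so the finite convolution sum is already an
      infinite series and can be subtracted term by term from the series for
      \<open>poly Qf (ln x)\<close>.\<close>
    have s1: "(\<lambda>m. H m * W (x / real m)) sums (\<Sum>m\<in>{1..nat \<lfloor>x\<rfloor>}. H m * W (x / real m))"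
    proof (rule sums_finite)
      fix m assume m: "m \<notin> {1..nat \<lfloor>x\<rfloor>}"
      show "H m * W (x / real m) = 0"
      proof (cases "m = 0")
        case False
        hence "x < real m" using m in_floor_range_iff[of m x] by auto
        hence "x / real m < 1" using False by simp
        hence "nat \<lfloor>x / real m\<rfloor> = 0" by (simp add: floor_less_iff)
        thus ?thesis by (simp add: W_def summatory_def)
      qed (simp add: H_def per_index_def)
    qed simp
    have "Wf x = (\<Sum>m\<in>{1..nat \<lfloor>x\<rfloor>}. H m * W (x / real m))"
      unfolding Wf_conv summatory_conv_eq sum_hyperbola_region W_def ..
    with s1 have s1: "(\<lambda>m. H m * W (x / real m)) sums Wf x" by simp
    have "(\<lambda>m. \<Sum>s<N. poly (R s) (ln x) * (H m * ln (real m) ^ s)) sums (\<Sum>s<N. poly (R s) (ln x) * c s)"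
      unfolding c_def by (intro sums_sum sums_mult summable_sums sc)
    moreover have "(\<Sum>s<N. poly (R s) (ln x) * (H m * ln (real m) ^ s)) = H m * poly Q (ln x - ln (real
        m))" for m
      unfolding R sum_distrib_left by (simp add: mult_ac)
    moreover have "(\<Sum>s<N. poly (R s) (ln x) * c s) = poly Qf (ln x)"
      unfolding Qf_def poly_sum by (simp add: mult_ac)
    ultimately have s2: "(\<lambda>m. H m * poly Q (ln x - ln (real m))) sums poly Qf (ln x)" by simp
    define D where "D = (\<lambda>m. H m * W (x / real m) - H m * poly Q (ln x - ln (real m)))"
    have sD: "D sums (Wf x - poly Qf (ln x))" unfolding D_def by (rule sums_diff[OF s1 s2])
    have Dle: "norm (D m) \<le> C * x powr (- (3 / 100)) * a m" for m
    proof (cases "m = 0")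
      case False
      have m: "real m > 0" using False by simp
      have "D m = H m * (W (x / real m) - poly Q (ln (x / real m)))"
        using m x by (simp add: D_def ln_div algebra_simps)
      hence "norm (D m) \<le> \<bar>H m\<bar> * (C * (x / real m) powr (- (3 / 100)))"
        using QC[of "x / real m"] m x by (simp add: abs_mult mult_left_mono)
      also have "(x / real m) powr (- (3 / 100)) = x powr (- (3 / 100)) * real m powr (3 / 100)"
        using m x by (simp add: powr_divide powr_minus field_simps)
      also have "\<bar>H m\<bar> * (C * (x powr (- (3 / 100)) * real m powr (3 / 100))) = C * x powr (- (3 / 100))
          * a m"
        unfolding Ha[symmetric] by simp
      finally show ?thesis .
    qed (simp add: D_def H_def per_index_def a_def)
    have "\<bar>Wf x - poly Qf (ln x)\<bar> \<le> (\<Sum>m. C * x powr (- (3 / 100)) * a m)"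
      using norm_suminf_le[OF Dle summable_mult[OF sa]] unfolding sums_unique[OF sD, symmetric] by simp
    also have "\<dots> = C1 * x powr (- (3 / 100))" using suminf_mult[OF sa, of "C * x powr (- (3 / 100))"] by
        (simp add: C1_def mult_ac)
    finally show ?thesis .
  qed
  have C1': "\<bar>Wf x - poly Qf (ln x)\<bar> \<le> C1" if x: "x \<ge> 1" for x
  proof -
    have C10: "C1 \<ge> 0" unfolding C1_def using C0 suminf_nonneg[OF sa a0] by simp
    have "x powr (- (3 / 100)) \<le> x powr 0" using x by (intro powr_mono) auto
    hence "C1 * x powr (- (3 / 100)) \<le> C1 * 1" using C10 x by (intro mult_left_mono) auto
    thus ?thesis using C1[OF x] by simp
  qed
  \<comment> \<open>\<open>tau10 \<le> f * r\<close>, where \<open>r\<close> has bounded logarithmic sums, forces the full growth of order \<open>ln x ^ 10\<close>.\<close>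
  define r where "r = from_prime_powers (\<lambda>p k. if k = 0 then 1 else if k = 1 then 0 else tau10 (p ^ k))"
  have r: "multiplicative r" unfolding r_def by (rule multiplicative_from_prime_powers)
  have rk: "r (p ^ k) = (if k = 0 then 1 else if k = 1 then 0 else tau10 (p ^ k))" if "prime p" for p k
    unfolding r_def by (rule from_prime_powers_prime_power[OF that]) simp
  have r0: "r n \<ge> 0" if "n > 0" for n
    by (rule multiplicative_nonneg[OF r that]) (auto simp: rk tau10_prime_power_bounds)
  have "multiplicative (per_index r)"
    unfolding multiplicative_def per_index_def
    using multiplicative_1[OF r] by (auto simp: multiplicative_mult[OF r])
  moreover have "per_index r (p ^ k) \<le> 1 * (1 + real k) ^ 9 * real p powr (- (1055 / 1000) - 15 / 1000 *
      real k)"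
    if p: "prime p" and k: "k \<ge> 2" for p k
  proof -
    have p1: "real p \<ge> 1" using prime_ge_1_nat[OF p] by simp
    have "per_index r (p ^ k) = tau10 (p ^ k) * real p powr (- real k)"
      using k p1 by (simp add: per_index_def rk[OF p] powr_minus powr_realpow divide_inverse)
    also have "\<dots> \<le> (1 + real k) ^ 9 * real p powr (- (1055 / 1000) - 15 / 1000 * real k)"
      using k p1 tau10_prime_power_bounds[OF p] by (intro mult_mono powr_mono) auto
    finally show ?thesis by simp
  qed
  moreover have "per_index r p = 0" if "prime p" for p
    using rk[OF that, of 1] by (simp add: per_index_def)
  moreover have "per_index r n \<ge> 0" if "n > 0" for n using r0[OF that] by (rule per_index_nonneg)
  ultimately obtain B2 where B2: "\<And>N. (\<Sum>n=1..N. per_index r n) \<le> B2"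
    using multiplicative_sum_bounded[of "per_index r" 1] by auto
  have B2_1: "B2 \<ge> 1" using B2[of 1] multiplicative_1[OF r] by (simp add: per_index_def)
  have tau_le: "tau10 n \<le> dirichlet_conv f r n" if "n > 0" for n
  proof -
    have "tau10 (p ^ k) \<le> dirichlet_conv f r (p ^ k)" if p: "prime p" for p k
    proof -
      have p0: "p > 0" using p prime_gt_0_nat by blast
      have nn: "0 \<le> f (p ^ j) * r (p ^ (k - j))" for j using f0 r0 p0 by simp
      consider "k = 0" | "k = 1" | "k \<ge> 2" by linarith
      thus ?thesis
      proof cases
        case 1
        thus ?thesis using multiplicative_1[OF multiplicative_tau(4)] multiplicative_1[OF
            multiplicative_conv[OF f r]] by simp
      next
        case 2
        thus ?thesis using conv_prime[OF f r p] fp[OF p] rk[OF p, of 1] tau10_prime[OF p] by simp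
      next
        case 3
        have "tau10 (p ^ k) = f (p ^ 0) * r (p ^ (k - 0))" using rk[OF p, of k] f1 3 by simp
        also have "\<dots> \<le> (\<Sum>j=0..k. f (p ^ j) * r (p ^ (k - j)))"
          by (rule member_le_sum) (use nn in auto)
        finally show ?thesis by (simp add: dirichlet_conv_prime_power[OF p])
      qed
    qed
    thus ?thesis using multiplicative_le[OF multiplicative_tau(4) multiplicative_conv[OF f r] that]
        tau10_prime_power_bounds(1) by blast
  qed
  \<comment> \<open>Cancellation in the coefficients of \<open>Qf\<close> cannot be excluded by
    looking at them, so the degree is read off from growth. From above, \<open>H \<le> a\<close> and
    the sums of \<open>a\<close> are bounded; from below, \<open>tau_le\<close> bounds the divisor
    sums by \<open>B2\<close> times those of \<open>f\<close>.\<close>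
  have degQ: "degree Qf = 10"
  proof (rule degree_eq_of_growth)
    show "(1 / (B2 * 10 ^ 10)) > 0" using B2_1 by simp
    show "(10::nat) > 0" by simp
    fix L :: real assume L: "L \<ge> 0"
    define x where "x = exp L"
    have x: "x \<ge> 1" "ln x = L" using L by (auto simp: x_def)
    have "Wf x \<le> summatory (dirichlet_conv a (per_index tau10)) x"
      unfolding Wf_conv
    proof (rule summatory_mono)
      fix n :: nat assume "n > 0"
      show "dirichlet_conv H (per_index tau10) n \<le> dirichlet_conv a (per_index tau10) n"
        unfolding dirichlet_conv_def
      proof (rule sum_mono)
        fix d
        have "H d \<le> a d" using Hle[of d] by linarith
        thus "H d * per_index tau10 (n div d) \<le> a d * per_index tau10 (n div d)"
          by (intro mult_right_mono per_index_nonneg tau_nonneg)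
      qed
    qed
    also have "\<dots> \<le> summatory a x * W x" unfolding W_def
      using x by (intro summatory_conv_le a0 per_index_nonneg tau_nonneg) auto
    also have "\<dots> \<le> B * (1 + L) ^ 10"
    proof (intro mult_mono)
      show "summatory a x \<le> B" unfolding summatory_def by (rule B)
      show "W x \<le> (1 + L) ^ 10" unfolding W_def using summatory_tau10_le[OF x(1)] x(2) by simp
      show "0 \<le> W x" unfolding W_def by (intro summatory_nonneg per_index_nonneg tau_nonneg)
      show "0 \<le> B" using B[of 0] by simp
    qed
    finally have 1: "Wf x \<le> B * (1 + L) ^ 10" .
    have C10: "C1 \<ge> 0" using C1'[of 1] by simp
    have "1 \<le> (1 + L) ^ 10" using L by (intro one_le_power) auto
    hence "C1 * 1 \<le> C1 * (1 + L) ^ 10" using C10 by (intro mult_left_mono)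
    thus "poly Qf L \<le> (B + C1) * (1 + L) ^ 10"
      using 1 C1'[OF x(1)] x(2) unfolding distrib_right by simp
    define y where "y = exp (L / 10)"
    have y: "y \<ge> 1" "ln y = L / 10" "y ^ 10 = x"
      using L by (auto simp: y_def x_def simp flip: exp_of_nat_mult)
    have "(L / 10) ^ 10 \<le> W x" using summatory_tau10_ge[OF y(1)] y unfolding W_def by simp
    also have "W x \<le> summatory (dirichlet_conv (per_index f) (per_index r)) x"
      unfolding W_def per_index_conv[symmetric]
      by (rule summatory_mono) (use tau_le in \<open>auto simp: per_index_def intro!: divide_right_mono\<close>)
    also have "\<dots> \<le> Wf x * summatory (per_index r) x" unfolding Wf_def
      using x f0 r0 by (intro summatory_conv_le per_index_nonneg) auto
    also have "\<dots> \<le> Wf x * B2"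
    proof (intro mult_left_mono)
      show "summatory (per_index r) x \<le> B2" unfolding summatory_def by (rule B2)
      show "0 \<le> Wf x" unfolding Wf_def by (intro summatory_nonneg per_index_nonneg f0)
    qed
    finally have "1 / (B2 * 10 ^ 10) * L ^ 10 \<le> Wf x" using B2_1 by (simp add: field_simps)
    thus "1 / (B2 * 10 ^ 10) * L ^ 10 - C1 \<le> poly Qf L" using C1'[OF x(1), unfolded x(2)] by linarith
  qed
  obtain S where S: "S + pderiv S = Qf" "degree S = degree Qf" using poly_plus_pderiv_surj by blast
  obtain C3 where C3: "\<And>x. x \<ge> 1 \<Longrightarrow>
      \<bar>summatory (\<lambda>n. real n * per_index f n) x - x * poly (pderiv S) (ln x)\<bar> \<le> C3 * x powr (1 - 3 / 100)"
    using abel_asymptotics[of "3 / 100" S Qf "per_index f" C1] S(1) C1 unfolding Wf_def by auto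
  have eq: "summatory (\<lambda>n. real n * per_index f n) x = summatory f x" for x
    unfolding summatory_def by (intro sum.cong) (auto simp: per_index_def)
  show ?thesis
  proof (intro exI[of _ "pderiv S"] conjI exI[of _ C3] allI impI)
    show "degree (pderiv S) = 9" using S(2) degQ by (simp add: degree_pderiv)
    fix x :: real assume "x \<ge> 1"
    from C3[OF this] show "\<bar>summatory f x - x * poly (pderiv S) (ln x)\<bar> \<le> C3 * x powr (97 / 100)"
      unfolding eq by simp
  qed
qed

section \<open>Counting solutions of quadratic congruences\<close>

lemma prime_power_dvd_mult_cancel:
  fixes p :: int
  assumes "prime p" "\<not> p ^ Suc j dvd x" "p ^ d dvd x * y"
  shows "p ^ (d - j) dvd y"
proof (cases "d \<le> j")
  case False
  have x0: "x \<noteq> 0" using assms(2) by auto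
  have p0: "p \<noteq> 0" "\<not> is_unit p" using assms(1) by auto
  define m where "m = multiplicity p x"
  obtain x' where x': "x = p ^ m * x'" "\<not> p dvd x'"
    using multiplicity_decompose'[OF x0 p0(2)] unfolding m_def by metis
  have mj: "m \<le> j"
    using assms(2) x0 p0(2) unfolding m_def
    by (meson multiplicity_dvd' not_less_eq_eq)
  have "p ^ m * p ^ (d - m) dvd p ^ m * (x' * y)"
    using assms(3) mj False unfolding x'(1) by (simp flip: power_add add: mult.assoc)
  hence "p ^ (d - m) dvd x' * y" using p0 by simp
  moreover have "coprime (p ^ (d - m)) x'"
    using assms(1) x'(2) by (simp add: prime_imp_coprime)
  ultimately have "p ^ (d - m) dvd y" by (simp add: coprime_dvd_mult_right_iff)
  thus ?thesis using mj by (meson diff_le_mono2 dvd_trans le_imp_power_dvd)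
qed auto

lemma card_congruent_le:
  fixes S :: "int set" and q N x1 :: int
  assumes S: "S \<subseteq> {0..<N}" and q: "q > 0" "q dvd N" and cong: "\<And>x. x \<in> S \<Longrightarrow> q dvd x - x1"
  shows "card S \<le> nat (N div q)"
proof -
  have inj: "inj_on (\<lambda>x. x div q) S"
  proof (rule inj_onI)
    fix x y assume xy: "x \<in> S" "y \<in> S" "x div q = y div q"
    have "q dvd (x - x1) - (y - x1)" using cong[OF xy(1)] cong[OF xy(2)] by (rule dvd_diff)
    hence "x mod q = y mod q" by (simp add: mod_eq_dvd_iff)
    thus "x = y" using xy(3) by (metis mult_div_mod_eq)
  qed
  have "(\<lambda>x. x div q) ` S \<subseteq> {0..<N div q}"
  proof safe
    fix x assume "x \<in> S"
    hence x: "0 \<le> x" "x < N" using S by auto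
    have "x div q < N div q"
    proof (rule ccontr)
      assume "\<not> x div q < N div q"
      hence "N div q * q \<le> x div q * q" using q by (intro mult_right_mono) auto
      also have "\<dots> \<le> x" using q by (metis div_mult_mod_eq le_add_same_cancel1 pos_mod_sign)
      finally show False using q x by simp
    qed
    thus "x div q \<in> {0..<N div q}" using x q by (simp add: pos_imp_zdiv_nonneg_iff)
  qed
  hence "card ((\<lambda>x. x div q) ` S) \<le> card {0..<N div q}" by (intro card_mono) auto
  thus ?thesis using card_image[OF inj] by simp
qed

lemma card_congruent_power_le:
  fixes S :: "int set" and p :: nat
  assumes "S \<subseteq> {0..<int p ^ m}" "p > 0" "j \<le> m" "\<And>x. x \<in> S \<Longrightarrow> int p ^ j dvd x - x1"
  shows "card S \<le> p ^ (m - j)"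
proof -
  have "card S \<le> nat (int p ^ m div int p ^ j)"
    using assms by (intro card_congruent_le[of _ _ _ x1]) (auto intro: le_imp_power_dvd)
  also have "int p ^ m div int p ^ j = int p ^ (m - j)"
    using assms by (simp add: power_diff)
  also have "nat \<dots> = p ^ (m - j)" by (simp add: nat_power_eq)
  finally show ?thesis .
qed

lemma card_le_fibre_bound:
  assumes fin: "finite S" and im: "f ` S \<subseteq> T" "finite T" "card T \<le> M"
    and fib: "\<And>t. t \<in> T \<Longrightarrow> card {s \<in> S. f s = t} \<le> K"
  shows "card S \<le> M * K"
proof -
  have "S = (\<Union>t\<in>T. {s \<in> S. f s = t})" using im by auto
  hence "card S \<le> (\<Sum>t\<in>T. card {s \<in> S. f s = t})" by (metis card_UN_le im(2))
  also have "\<dots> \<le> (\<Sum>t\<in>T. K)" by (intro sum_mono fib)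
  also have "\<dots> \<le> M * K" using im(3) by simp
  finally show ?thesis .
qed

lemma card_Un_le2:
  assumes "S \<subseteq> A \<union> B" "finite A" "finite B" "card A \<le> K" "card B \<le> K"
  shows "card S \<le> 2 * K"
proof -
  have "card S \<le> card (A \<union> B)" using assms by (intro card_mono) auto
  also have "\<dots> \<le> card A + card B" by (rule card_Un_le)
  finally show ?thesis using assms by simp
qed

text \<open>
  The factors \<open>x - x1\<close> and \<open>x + x1 + D\<close> add up to \<open>2 * x + D\<close>, so they cannot both be divisible
  by a higher power of \<open>p\<close> than the latter.
\<close>

lemma card_quadratic_roots_le:
  fixes S :: "int set" and p :: nat
  assumes p: "prime p" and S: "S \<subseteq> {0..<int p ^ (m + h)}" and jm: "j \<le> m"
    and h: "\<And>x. x \<in> S \<Longrightarrow> int p ^ h dvd x - x1"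
    and q: "\<And>x. x \<in> S \<Longrightarrow> int p ^ (m + h) dvd (x - x1) * (x + x1 + D)"
    and j: "\<And>x. j < m \<Longrightarrow> x \<in> S \<Longrightarrow> \<not> int p ^ Suc j dvd 2 * x + D"
  shows "card S \<le> 2 * p ^ j"
proof (cases "j = m")
  case True
  have "card S \<le> p ^ (m + h - h)"
    using S h prime_gt_0_nat[OF p] by (intro card_congruent_power_le[of _ _ _ _ x1]) auto
  thus ?thesis using True by simp
next
  case False
  hence jm: "j < m" using jm by simp
  define A where "A = {x\<in>S. int p ^ (m + h - j) dvd x - x1}"
  define B where "B = {x\<in>S. int p ^ (m + h - j) dvd x - (- x1 - D)}"
  have pp: "prime (int p)" using p by simp
  have fin: "finite S" using S finite_subset by blast
  have "S \<subseteq> A \<union> B"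
  proof
    fix x assume x: "x \<in> S"
    have "\<not> (int p ^ Suc j dvd (x - x1) \<and> int p ^ Suc j dvd (x + x1 + D))"
    proof
      assume "int p ^ Suc j dvd (x - x1) \<and> int p ^ Suc j dvd (x + x1 + D)"
      hence "int p ^ Suc j dvd (x - x1) + (x + x1 + D)" using dvd_add by blast
      thus False using j[OF jm x] by (simp add: algebra_simps)
    qed
    hence "int p ^ (m + h - j) dvd x + x1 + D \<or> int p ^ (m + h - j) dvd x - x1"
      using prime_power_dvd_mult_cancel[OF pp _ q[OF x]]
        prime_power_dvd_mult_cancel[OF pp, of j "x + x1 + D" "m + h" "x - x1"] q[OF x]
      by (auto simp: mult.commute)
    thus "x \<in> A \<union> B" using x unfolding A_def B_def by (auto simp: algebra_simps)
  qed
  moreover have "card A \<le> p ^ (m + h - (m + h - j))"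
    using S prime_gt_0_nat[OF p] unfolding A_def
    by (intro card_congruent_power_le[of _ _ _ _ x1]) auto
  moreover have "card B \<le> p ^ (m + h - (m + h - j))"
    using S prime_gt_0_nat[OF p] unfolding B_def
    by (intro card_congruent_power_le[of _ _ _ _ "- x1 - D"]) auto
  moreover have "m + h - (m + h - j) = j" using jm by simp
  ultimately show ?thesis
    using fin by (intro card_Un_le2[of S A B]) (auto simp: A_def B_def)
qed

text \<open>For odd \<open>p\<close> the solutions lie in one class modulo \<open>p ^ i\<close>. For
  \<open>p = 2\<close> the coefficient 2 costs one power of \<open>p\<close>, which is the factor 2
  in the bound.\<close>

lemma card_double_congruent_le:
  fixes p :: nat
  assumes p: "prime p" and i: "i \<le> c"
  shows "card {w\<in>{0..<int p ^ c}. int p ^ i dvd 2 * w + D} \<le> 2 * p ^ (c - i)"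
proof (cases "{w\<in>{0..<int p ^ c}. int p ^ i dvd 2 * w + D} = {}")
  case False
  define S where "S = {w\<in>{0..<int p ^ c}. int p ^ i dvd 2 * w + D}"
  then obtain x1 where x1: "x1 \<in> S" using False by auto
  have d: "int p ^ i dvd 2 * (x - x1)" if "x \<in> S" for x
  proof -
    have "int p ^ i dvd (2 * x + D) - (2 * x1 + D)"
      using that x1 unfolding S_def by (intro dvd_diff) auto
    thus ?thesis by (simp add: algebra_simps)
  qed
  have SI: "S \<subseteq> {0..<int p ^ c}" by (auto simp: S_def)
  have p0: "p > 0" using p prime_gt_0_nat by blast
  have pp: "prime (int p)" using p by simp
  have "card S \<le> 2 * p ^ (c - i)"
  proof (cases "p = 2")
    case False
    have "coprime p 2" using False p by (metis primes_coprime two_is_prime_nat)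
    hence "coprime (int p ^ i) 2" by (metis coprime_int_iff coprime_power_left_iff of_nat_numeral)
    hence "int p ^ i dvd x - x1" if "x \<in> S" for x
      using d[OF that] coprime_dvd_mult_right_iff by blast
    hence "card S \<le> p ^ (c - i)" using SI p0 i by (intro card_congruent_power_le[of _ _ _ _ x1])
    thus ?thesis by simp
  next
    case True
    show ?thesis
    proof (cases i)
      case 0
      have "card S \<le> p ^ (c - 0)" using SI p0 i by (intro card_congruent_power_le[of _ _ _ _ x1]) auto
      thus ?thesis using 0 by simp
    next
      case (Suc i')
      have "int p ^ i' dvd x - x1" if "x \<in> S" for x
      proof -
        have "2 * int p ^ i' dvd 2 * (x - x1)" using d[OF that] by (simp add: Suc True)
        thus ?thesis unfolding dvd_mult_cancel_left by simp
      qed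
      hence "card S \<le> p ^ (c - i')" using SI p0 i Suc by (intro card_congruent_power_le[of _ _ _ _ x1]) auto
      also have "c - i' = Suc (c - i)" using Suc i by simp
      finally show ?thesis using True by simp
    qed
  qed
  thus ?thesis by (simp add: S_def)
next
  case True
  show ?thesis by (simp only: True) simp
qed

text \<open>The last two congruences say that the value of
  \<open>X\<^sup>2 + D * X - (C1, C2)\<close> at \<open>(w, v)\<close> is a multiple of
  \<open>(p ^ c, t)\<close>: the first component determines the multiple, which is the
  \<open>div\<close> term, and the second has to agree modulo \<open>p ^ (c' + h)\<close>. The pairs
  \<open>(w, v)\<close> and \<open>(z, u)\<close> of a normal form are both of this kind, with
  different \<open>D\<close>, \<open>C1\<close>, \<open>C2\<close>.\<close>

definition quadratic_pairs :: "nat \<Rightarrow> nat \<Rightarrow> nat \<Rightarrow> nat \<Rightarrow> int \<Rightarrow> int \<Rightarrow> int \<Rightarrow> int \<Rightarrow> (int \<times> int) set" where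
  "quadratic_pairs p c c' h t D C1 C2 =
     {(w, v). w \<in> {0..<int p ^ c} \<and> v \<in> {0..<int p ^ (c' + h)} \<and> int p ^ h dvd v - w \<and>
        int p ^ c dvd w\<^sup>2 + D * w - C1 \<and>
        int p ^ (c' + h) dvd v\<^sup>2 + D * v - C2 - (w\<^sup>2 + D * w - C1) div int p ^ c * t}"

lemma finite_quadratic_pairs [simp]: "finite (quadratic_pairs p c c' h t D C1 C2)"
proof (rule finite_subset)
  show "quadratic_pairs p c c' h t D C1 C2 \<subseteq> {0..<int p ^ c} \<times> {0..<int p ^ (c' + h)}"
    by (auto simp: quadratic_pairs_def)
qed auto

text \<open>Fixing \<open>w\<close> fixes the \<open>div\<close> term, so two solutions
  \<open>v\<close> and \<open>v1\<close> satisfy \<open>(v - v1) * (v + v1 + D) \<equiv> 0\<close>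
  modulo \<open>p ^ (c' + h)\<close>; both are congruent to \<open>w\<close> modulo
  \<open>p ^ h\<close>.\<close>

lemma quadratic_pairs_fst_fibre:
  assumes p: "prime p" and j: "j \<le> c'" and S: "S \<subseteq> quadratic_pairs p c c' h t D C1 C2"
    and nj: "\<And>w v. (w, v) \<in> S \<Longrightarrow> j < c' \<Longrightarrow> \<not> int p ^ Suc j dvd 2 * v + D"
  shows "card {x \<in> S. fst x = w0} \<le> 2 * p ^ j"
proof (cases "{x \<in> S. fst x = w0} = {}")
  case False
  then obtain v1 where v1: "(w0, v1) \<in> S" by auto
  define V where "V = snd ` {x \<in> S. fst x = w0}"
  have V: "(w0, v) \<in> S" if "v \<in> V" for v using that unfolding V_def by auto
  have inj: "inj_on snd {x \<in> S. fst x = w0}" by (auto simp: inj_on_def)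
  have q1: "(w0, v1) \<in> quadratic_pairs p c c' h t D C1 C2" using v1 S by auto
  have "card V \<le> 2 * p ^ j"
  proof (rule card_quadratic_roots_le[OF p _ j, of V h v1 D])
    show "V \<subseteq> {0..<int p ^ (c' + h)}"
    proof
      fix v assume "v \<in> V"
      hence "(w0, v) \<in> quadratic_pairs p c c' h t D C1 C2" using V S by blast
      thus "v \<in> {0..<int p ^ (c' + h)}" by (simp add: quadratic_pairs_def)
    qed
  next
    fix v assume v: "v \<in> V"
    have q: "(w0, v) \<in> quadratic_pairs p c c' h t D C1 C2" using V[OF v] S by auto
    have q': "int p ^ h dvd v - w0" "int p ^ h dvd v1 - w0"
      using q q1 unfolding quadratic_pairs_def by auto
    have "int p ^ h dvd (v - w0) - (v1 - w0)" using q' by (rule dvd_diff)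
    thus "int p ^ h dvd v - v1" by simp
    have "int p ^ (c' + h) dvd (v\<^sup>2 + D * v - C2 - (w0\<^sup>2 + D * w0 - C1) div int p ^ c * t) -
        (v1\<^sup>2 + D * v1 - C2 - (w0\<^sup>2 + D * w0 - C1) div int p ^ c * t)"
      by (rule dvd_diff) (use q q1 in \<open>auto simp: quadratic_pairs_def\<close>)
    also have "\<dots> = (v - v1) * (v + v1 + D)" by (simp add: algebra_simps power2_eq_square)
    finally show "int p ^ (c' + h) dvd (v - v1) * (v + v1 + D)" .
  next
    fix v assume "j < c'" "v \<in> V"
    thus "\<not> int p ^ Suc j dvd 2 * v + D" using nj V by blast
  qed
  thus ?thesis unfolding V_def using card_image[OF inj] by simp
next
  case True
  show ?thesis by (simp only: True) simp
qed

text \<open>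
  The pairs are the solutions of a quadratic equation in the quotient of the order
  \<open>{(w, v). w \<equiv> v (mod p ^ h)}\<close> by the ideal generated by \<open>(p ^ c, t)\<close>.  Adding multiples of the
  generator moves a pair to one with prescribed second component, which makes the two
  components play symmetric roles.
\<close>

lemma quadratic_pairs_snd_fibre:
  assumes p: "prime p" and i: "i \<le> c" and S: "S \<subseteq> quadratic_pairs p c c' h t D C1 C2"
    and t: "t = int p ^ c' * s" "coprime s (int p ^ h)" "int p ^ h dvd t - int p ^ c"
    and ni: "\<And>w v. (w, v) \<in> S \<Longrightarrow> i < c \<Longrightarrow> \<not> int p ^ Suc i dvd 2 * w + D"
  shows "card {x \<in> S. snd x mod int p ^ c' = v0} \<le> 2 * p ^ i"
proof (cases "{x \<in> S. snd x mod int p ^ c' = v0} = {}")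
  case False
  then obtain w1 v1 where wv1: "(w1, v1) \<in> S" "v1 mod int p ^ c' = v0" by auto
  have q1: "(w1, v1) \<in> quadratic_pairs p c c' h t D C1 C2" using wv1 S by auto
  define P where "P = int p"
  have P0: "P > 0" using p prime_gt_0_nat unfolding P_def by simp
  \<comment> \<open>The roots of a single quadratic congruence modulo \<open>p ^ (c + h)\<close>, in
    the class of \<open>w1\<close> modulo \<open>p ^ h\<close>: the situation of the other fibre
    with \<open>c\<close> in place of \<open>c'\<close>.\<close>
  define T where "T = {x\<in>{0..<P ^ (c + h)}. P ^ h dvd x - w1 \<and>
      P ^ (c + h) dvd (x - w1) * (x + w1 + D) \<and> (i < c \<longrightarrow> \<not> P ^ Suc i dvd 2 * x + D)}"
  \<comment> \<open>Undoes the shift by a multiple of the generator: the residue modulo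
    \<open>p ^ c\<close> is \<open>w\<close>, and the quotient tells which multiple of
    \<open>t\<close> has to be added to \<open>v1\<close>.\<close>
  define \<Psi> where "\<Psi> = (\<lambda>x. (x mod P ^ c, (v1 + (x mod P ^ c - x) div P ^ c * t) mod P ^ (c' + h)))"
  have TI: "T \<subseteq> {0..<P ^ (c + h)}" unfolding T_def by blast
  hence finT: "finite T" using finite_subset by blast
  have cT: "card T \<le> 2 * p ^ i"
    using TI unfolding P_def
    by (rule card_quadratic_roots_le[OF p _ i, of T h w1 D]) (simp_all add: T_def P_def)
  have "{x \<in> S. snd x mod int p ^ c' = v0} \<subseteq> \<Psi> ` T"
  proof safe
    fix w v assume wv: "(w, v) \<in> S" "v0 = snd (w, v) mod int p ^ c'"
    have q: "(w, v) \<in> quadratic_pairs p c c' h t D C1 C2" using wv S by auto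
    define \<alpha> where "\<alpha> = (w\<^sup>2 + D * w - C1) div P ^ c"
    define \<alpha>1 where "\<alpha>1 = (w1\<^sup>2 + D * w1 - C1) div P ^ c"
    have \<alpha>: "w\<^sup>2 + D * w - C1 = P ^ c * \<alpha>" and \<alpha>1: "w1\<^sup>2 + D * w1 - C1 = P ^ c * \<alpha>1"
      using q q1 unfolding quadratic_pairs_def \<alpha>_def \<alpha>1_def P_def by auto
    define r1 where "r1 = v\<^sup>2 + D * v - C2 - \<alpha> * t"
    define r2 where "r2 = v1\<^sup>2 + D * v1 - C2 - \<alpha>1 * t"
    have r12: "P ^ (c' + h) dvd r1" "P ^ (c' + h) dvd r2"
      using q q1 unfolding quadratic_pairs_def r1_def r2_def \<alpha>_def \<alpha>1_def P_def by auto
    have "P ^ c' dvd v - v1" using wv wv1 by (simp add: P_def mod_eq_dvd_iff dvd_diff_commute)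
    then obtain j0 where j0: "v - v1 = P ^ c' * j0" by blast
    obtain s' where s': "P ^ h dvd s * s' - 1"
      using t(2) unfolding P_def
      by (metis cong_iff_dvd_diff cong_solve_coprime_int)
    \<comment> \<open>Since \<open>s'\<close> inverts \<open>s\<close> modulo \<open>p ^ h\<close>,
      \<open>i0 * t\<close> agrees with \<open>v - v1\<close> modulo \<open>p ^ (c' + h)\<close>.
      Subtracting \<open>i0\<close> times \<open>(p ^ c, t)\<close> therefore moves
      \<open>(w, v)\<close> to \<open>(x0, v1)\<close>.\<close>
    define i0 where "i0 = s' * j0"
    define r3 where "r3 = v - v1 - i0 * t"
    have "r3 = P ^ c' * - ((s * s' - 1) * j0)"
      unfolding r3_def j0 i0_def t(1) P_def[symmetric] by (simp add: algebra_simps)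
    hence r3: "P ^ (c' + h) dvd r3" using s' by (simp add: power_add)
    define x0 where "x0 = w - i0 * P ^ c"
    define x where "x = x0 mod P ^ (c + h)"
    define n where "n = x0 div P ^ (c + h)"
    have x: "x = x0 - P ^ (c + h) * n" unfolding x_def n_def by (simp add: minus_mult_div_eq_mod)
    have w: "0 \<le> w" "w < P ^ c" and v: "0 \<le> v" "v < P ^ (c' + h)"
      using q by (auto simp: quadratic_pairs_def P_def)
    have xe: "x = w - P ^ c * (i0 + P ^ h * n)"
      unfolding x x0_def by (simp add: algebra_simps power_add)
    hence xc: "x mod P ^ c = w"
      using w by (metis mod_mult_self4 mod_pos_pos_trivial mult.commute diff_add_cancel add.commute)
    have dx: "(x mod P ^ c - x) div P ^ c = i0 + P ^ h * n"
      unfolding xc using xe P0 by simp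
    have hv: "P ^ h dvd v - w" "P ^ h dvd v1 - w1"
      using q q1 by (auto simp: quadratic_pairs_def P_def)
    have ht: "P ^ h dvd t - P ^ c" using t(3) by (simp add: P_def)
    have tP: "P ^ (c' + h) dvd t * y" if "P ^ h dvd y" for y
      using that unfolding t(1) P_def[symmetric] power_add
      by (metis dvd_mult_left dvd_refl mult.assoc mult_dvd_mono dvd_mult)
    have vx: "v = (v1 + (x mod P ^ c - x) div P ^ c * t) mod P ^ (c' + h)"
    proof -
      have "P ^ (c' + h) dvd v - (v1 + (i0 + P ^ h * n) * t)"
      proof -
        have "v - (v1 + (i0 + P ^ h * n) * t) = r3 - t * (P ^ h * n)"
          unfolding r3_def by (simp add: algebra_simps)
        moreover have "P ^ (c' + h) dvd t * (P ^ h * n)" by (rule tP) simp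
        ultimately show ?thesis using r3 by simp
      qed
      hence "v mod P ^ (c' + h) = (v1 + (i0 + P ^ h * n) * t) mod P ^ (c' + h)"
        by (simp add: mod_eq_dvd_iff)
      thus ?thesis unfolding dx using v by simp
    qed
    have "x \<in> T" unfolding T_def
    proof (intro CollectI conjI impI)
      show "x \<in> {0..<P ^ (c + h)}" using P0 by (simp add: x_def)
      have "x - w1 = (v1 - w1) - (v - w) + (r3 + i0 * (t - P ^ c)) - P ^ h * (P ^ c * n)"
        unfolding xe r3_def by (simp add: algebra_simps)
      moreover have "P ^ h dvd r3" using r3 by (meson dvd_trans le_add2 le_imp_power_dvd)
      ultimately show "P ^ h dvd x - w1" using hv ht
        by (metis dvd_add dvd_diff dvd_mult dvd_triv_left)
      \<comment> \<open>\<open>\<beta>\<close> is the cofactor of \<open>p ^ c\<close> in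
        \<open>(x0 - w1) * (x0 + w1 + D)\<close>. Subtracting the equations for the second
        components shows that \<open>p ^ (c' + h)\<close> divides \<open>\<beta> * t\<close>, and
        \<open>t\<close> contains \<open>p\<close> only to the power \<open>c'\<close> as far as
        this matters, so \<open>p ^ h\<close> divides \<open>\<beta>\<close>.\<close>
      define \<beta> where "\<beta> = \<alpha> - i0 * (2 * w + D) + i0\<^sup>2 * P ^ c - \<alpha>1"
      have "\<beta> * t = r2 - r1 + r3 * (v + v1 + D) + i0 * (t * (2 * (v - w))) - i0 * t * r3
          - i0\<^sup>2 * (t * (t - P ^ c))"
        unfolding \<beta>_def r1_def r2_def r3_def by (simp add: algebra_simps power2_eq_square)
      moreover have "P ^ (c' + h) dvd t * (2 * (v - w))" "P ^ (c' + h) dvd t * (t - P ^ c)"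
        by (rule tP, rule dvd_mult, rule hv(1)) (rule tP, rule ht)
      ultimately have "P ^ (c' + h) dvd \<beta> * t" using r12 r3 by (simp add: dvd_diff)
      hence "P ^ c' * P ^ h dvd P ^ c' * (\<beta> * s)"
        unfolding t(1) P_def[symmetric] power_add by (simp add: algebra_simps)
      hence "P ^ h dvd \<beta> * s" using P0 by simp
      hence \<beta>: "P ^ h dvd \<beta>" using t(2) unfolding P_def[symmetric]
        by (metis coprime_commute coprime_dvd_mult_left_iff)
      have e: "(x0 - w1) * (x0 + w1 + D) = P ^ c * \<beta>"
      proof -
        have "(x0 - w1) * (x0 + w1 + D) = (w\<^sup>2 + D * w - C1) - (w1\<^sup>2 + D * w1 - C1) - P ^ c * (i0 * (2 * w
            + D)) + P ^ c * (i0\<^sup>2 * P ^ c)"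
          unfolding x0_def by (simp add: algebra_simps power2_eq_square)
        thus ?thesis unfolding \<alpha> \<alpha>1 \<beta>_def by (simp add: algebra_simps)
      qed
      have "(x - w1) * (x + w1 + D) = P ^ c * \<beta> - P ^ (c + h) * (n * (2 * x0 + D - P ^ (c + h) * n))"
        unfolding x e[symmetric] by (simp add: algebra_simps power2_eq_square)
      thus "P ^ (c + h) dvd (x - w1) * (x + w1 + D)" using \<beta> by (simp add: power_add)
      assume ic: "i < c"
      have "\<not> P ^ Suc i dvd 2 * w + D" using ni[OF wv(1) ic] by (simp add: P_def)
      moreover have "P ^ Suc i dvd P ^ c" using ic by (intro le_imp_power_dvd) auto
      moreover have "2 * w + D = (2 * x + D) + P ^ c * (2 * (i0 + P ^ h * n))"
        unfolding xe by (simp add: algebra_simps)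
      ultimately show "\<not> P ^ Suc i dvd 2 * x + D" by (metis dvd_add dvd_mult2)
    qed
    moreover have "(w, v) = \<Psi> x" using vx xc unfolding \<Psi>_def by simp
    ultimately show "(w, v) \<in> \<Psi> ` T" by blast
  qed
  hence "card {x \<in> S. snd x mod int p ^ c' = v0} \<le> card T"
    using finT by (meson card_image_le card_mono finite_imageI le_trans)
  thus ?thesis using cT by simp
next
  case True
  show ?thesis by (simp only: True) simp
qed

lemma prime_power_valuation:
  fixes p x :: int
  assumes "prime p"
  obtains i where "i \<le> c" "p ^ i dvd x" "i < c \<longrightarrow> \<not> p ^ Suc i dvd x"
proof (cases "p ^ c dvd x")
  case True
  thus ?thesis using that[of c] by simp
next
  case False
  define i where "i = (LEAST i. \<not> p ^ i dvd x)"
  have i: "\<not> p ^ i dvd x" "i \<le> c" unfolding i_def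
    using LeastI[of "\<lambda>i. \<not> p ^ i dvd x" c] Least_le[of "\<lambda>i. \<not> p ^ i dvd x" c] False by auto
  hence "i \<noteq> 0" by (intro notI) auto
  then obtain k where k: "i = Suc k" using not0_implies_Suc by blast
  have "p ^ k dvd x" using not_less_Least[of k "\<lambda>i. \<not> p ^ i dvd x"] k unfolding i_def by auto
  thus ?thesis using that[of k] i k by auto
qed

text \<open>Sort the pairs by the valuations \<open>i\<close> and \<open>j\<close> of the
  derivatives \<open>2 * w + D\<close> and \<open>2 * v + D\<close>, capped at \<open>c\<close> and
  \<open>c'\<close>. Counting by \<open>w\<close> first gives \<open>4 * p ^ (c - i + j)\<close>,
  counting by \<open>v\<close> first gives \<open>4 * p ^ (c' - j + i)\<close>. These exponents add
  up to \<open>c + c'\<close>, so the smaller one is at most half of it.\<close>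

lemma card_quadratic_pairs_le:
  assumes p: "prime p"
    and t: "t = int p ^ c' * s" "coprime s (int p ^ h)" "int p ^ h dvd t - int p ^ c"
  shows "card (quadratic_pairs p c c' h t D C1 C2) \<le> 4 * ((c + 1) * (c' + 1)) * p ^ ((c + c') div 2)"
proof -
  define X where "X = quadratic_pairs p c c' h t D C1 C2"
  define Y where "Y = (\<lambda>i j. {x \<in> X. (int p ^ i dvd 2 * fst x + D \<and> (i < c \<longrightarrow> \<not> int p ^ Suc i dvd 2 * fst
      x + D)) \<and>
      (int p ^ j dvd 2 * snd x + D \<and> (j < c' \<longrightarrow> \<not> int p ^ Suc j dvd 2 * snd x + D))})"
  have pp: "prime (int p)" using p by simp
  have p1: "p \<ge> 1" using p prime_ge_1_nat by blast
  have finX: "finite X" by (simp add: X_def)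
  have finY: "finite (Y i j)" for i j using finX by (simp add: Y_def)
  have YX: "Y i j \<subseteq> quadratic_pairs p c c' h t D C1 C2" for i j by (auto simp: Y_def X_def)
  have bound: "card (Y i j) \<le> 4 * p ^ ((c + c') div 2)" if ij: "i \<le> c" "j \<le> c'" for i j
  proof -
    have "card (Y i j) \<le> (2 * p ^ (c - i)) * (2 * p ^ j)"
    proof (rule card_le_fibre_bound[OF finY, where f = fst])
      show "fst ` Y i j \<subseteq> {w\<in>{0..<int p ^ c}. int p ^ i dvd 2 * w + D}"
        by (auto simp: Y_def X_def quadratic_pairs_def)
      show "card {w\<in>{0..<int p ^ c}. int p ^ i dvd 2 * w + D} \<le> 2 * p ^ (c - i)"
        by (rule card_double_congruent_le[OF p ij(1)])
      show "card {s \<in> Y i j. fst s = w} \<le> 2 * p ^ j" for w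
        by (rule quadratic_pairs_fst_fibre[OF p ij(2) YX]) (simp add: Y_def)
    qed (rule finite_subset[OF Collect_restrict], simp)
    moreover have "card (Y i j) \<le> (2 * p ^ (c' - j)) * (2 * p ^ i)"
    proof (rule card_le_fibre_bound[OF finY, where f = "\<lambda>x. snd x mod int p ^ c'"])
      show "(\<lambda>x. snd x mod int p ^ c') ` Y i j \<subseteq> {v\<in>{0..<int p ^ c'}. int p ^ j dvd 2 * v + D}"
      proof (intro image_subsetI CollectI conjI)
        fix x assume x: "x \<in> Y i j"
        show "snd x mod int p ^ c' \<in> {0..<int p ^ c'}" using p1 by simp
        have "2 * (snd x mod int p ^ c') + D = (2 * snd x + D) - int p ^ c' * (2 * (snd x div int p ^ c'))"
          by (simp add: algebra_simps flip: minus_mult_div_eq_mod)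
        moreover have "int p ^ j dvd int p ^ c'" using ij by (simp add: le_imp_power_dvd)
        ultimately show "int p ^ j dvd 2 * (snd x mod int p ^ c') + D"
          using x unfolding Y_def by (metis (mono_tags, lifting) dvd_diff dvd_mult2 mem_Collect_eq)
      qed
      show "card {v\<in>{0..<int p ^ c'}. int p ^ j dvd 2 * v + D} \<le> 2 * p ^ (c' - j)"
        by (rule card_double_congruent_le[OF p ij(2)])
      show "card {s \<in> Y i j. snd s mod int p ^ c' = v} \<le> 2 * p ^ i" for v
        by (rule quadratic_pairs_snd_fibre[OF p ij(1) YX t]) (simp add: Y_def)
    qed (rule finite_subset[OF Collect_restrict], simp)
    ultimately have "card (Y i j) \<le> 4 * p ^ (c - i + j)" "card (Y i j) \<le> 4 * p ^ (c' - j + i)"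
      by (simp_all add: power_add)
    moreover have "c - i + j \<le> (c + c') div 2 \<or> c' - j + i \<le> (c + c') div 2" using ij by linarith
    ultimately show ?thesis
      using power_increasing[OF _ p1, of "c - i + j" "(c + c') div 2"]
        power_increasing[OF _ p1, of "c' - j + i" "(c + c') div 2"] by linarith
  qed
  have "X \<subseteq> (\<Union>(i,j)\<in>{..c}\<times>{..c'}. Y i j)"
  proof
    fix x assume x: "x \<in> X"
    obtain i where i: "i \<le> c" "int p ^ i dvd 2 * fst x + D" "i < c \<longrightarrow> \<not> int p ^ Suc i dvd 2 * fst x + D"
      using prime_power_valuation[OF pp] by blast
    obtain j where j: "j \<le> c'" "int p ^ j dvd 2 * snd x + D" "j < c' \<longrightarrow> \<not> int p ^ Suc j dvd 2 * snd x + D"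
      using prime_power_valuation[OF pp] by blast
    have "x \<in> Y i j" using x i j unfolding Y_def by blast
    thus "x \<in> (\<Union>(i,j)\<in>{..c}\<times>{..c'}. Y i j)" using i j by blast
  qed
  hence "card X \<le> card (\<Union>(i,j)\<in>{..c}\<times>{..c'}. Y i j)"
    using finY by (intro card_mono) auto
  also have "\<dots> \<le> (\<Sum>(i,j)\<in>{..c}\<times>{..c'}. card (Y i j))"
    using card_UN_le[of "{..c}\<times>{..c'}" "\<lambda>(i,j). Y i j"] by (simp add: case_prod_unfold)
  also have "\<dots> \<le> (\<Sum>(i,j)\<in>{..c}\<times>{..c'}. 4 * p ^ ((c + c') div 2))"
    using bound by (intro sum_mono) auto
  also have "\<dots> = 4 * ((c + 1) * (c' + 1)) * p ^ ((c + c') div 2)"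
    by (simp add: card_cartesian_product algebra_simps)
  finally show ?thesis by (simp add: X_def)
qed

text \<open>The factors differ by \<open>p ^ b\<close>, so they are not both divisible by
  \<open>p ^ (b + 1)\<close>. Hence \<open>w\<close> is congruent to 0 or to \<open>p ^ b\<close>
  modulo \<open>p ^ (c - b)\<close>.\<close>

lemma card_idempotent_like_le:
  fixes p :: nat
  assumes p: "prime p"
  shows "card {w\<in>{0..<int p ^ c}. int p ^ c dvd w * (w - int p ^ b)} \<le> 2 * p ^ b"
proof (cases "b \<le> c")
  case True
  define A where "A = (\<lambda>z. {w\<in>{0..<int p ^ c}. int p ^ (c - b) dvd w - z})"
  have pp: "prime (int p)" and p0: "p > 0" using p prime_gt_0_nat by auto
  have c: "card (A z) \<le> p ^ b" for z
  proof -
    have "card (A z) \<le> p ^ (c - (c - b))"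
      by (rule card_congruent_power_le[of _ p c "c - b" z]) (use p0 in \<open>auto simp: A_def\<close>)
    thus ?thesis using True by simp
  qed
  have fin: "finite (A z)" for z
    by (rule finite_subset[of _ "{0..<int p ^ c}"]) (auto simp: A_def)
  have "int p ^ (c - b) dvd w - 0 \<or> int p ^ (c - b) dvd w - int p ^ b"
    if w: "int p ^ c dvd w * (w - int p ^ b)" for w
  proof -
    have "\<not> (int p ^ Suc b dvd w \<and> int p ^ Suc b dvd w - int p ^ b)"
    proof
      assume "int p ^ Suc b dvd w \<and> int p ^ Suc b dvd w - int p ^ b"
      hence "int p ^ Suc b dvd w - (w - int p ^ b)" using dvd_diff by blast
      thus False using pp by (simp add: prime_int_iff)
    qed
    thus ?thesis using prime_power_dvd_mult_cancel[OF pp _ w, of b]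
        prime_power_dvd_mult_cancel[OF pp, of b "w - int p ^ b" c w] w by (auto simp: mult.commute)
  qed
  hence "{w\<in>{0..<int p ^ c}. int p ^ c dvd w * (w - int p ^ b)} \<subseteq> A 0 \<union> A (int p ^ b)"
    unfolding A_def by auto
  from card_Un_le2[OF this fin fin c c] show ?thesis .
next
  case False
  have "card {w\<in>{0..<int p ^ c}. int p ^ c dvd w * (w - int p ^ b)} \<le> card {0..<int p ^ c}"
    by (intro card_mono) auto
  also have "\<dots> = p ^ c" by (simp add: nat_power_eq)
  also have "\<dots> \<le> p ^ b" using False p prime_ge_1_nat by (intro power_increasing) auto
  finally show ?thesis by simp
qed

text \<open>A bound independent of \<open>c\<close> and \<open>c'\<close>, better than the previous
  one when \<open>b\<close> is small. There are at most \<open>2 * p ^ b\<close> values of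
  \<open>w\<close>. As \<open>p ^ c'\<close> divides \<open>t\<close>, also
  \<open>v * (v - p ^ b)\<close> vanishes modulo \<open>p ^ c'\<close>. If
  \<open>c' > 2 * b\<close>, this keeps the derivative \<open>2 * v - p ^ b\<close> from being
  divisible by \<open>p ^ (b + 1)\<close>, so fibres have at most \<open>2 * p ^ b\<close> elements;
  otherwise the root count with exponent \<open>c' \<le> 2 * b\<close> is enough.\<close>

lemma card_quadratic_pairs_le':
  assumes p: "prime p" and t: "int p ^ c' dvd t"
  shows "card (quadratic_pairs p c c' h t (- (int p ^ b)) 0 0) \<le> 4 * p ^ (3 * b)"
proof -
  define X where "X = quadratic_pairs p c c' h t (- (int p ^ b)) 0 0"
  define j where "j = min c' (if c' \<le> 2 * b then c' else b)"
  have pp: "prime (int p)" using p by simp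
  have p1: "p \<ge> 1" using p prime_ge_1_nat by blast
  have "card X \<le> (2 * p ^ b) * (2 * p ^ j)"
  proof (rule card_le_fibre_bound[where f = fst])
    show "finite X" by (simp add: X_def)
    show "fst ` X \<subseteq> {w\<in>{0..<int p ^ c}. int p ^ c dvd w * (w - int p ^ b)}"
      by (auto simp: X_def quadratic_pairs_def algebra_simps power2_eq_square)
    show "card {w\<in>{0..<int p ^ c}. int p ^ c dvd w * (w - int p ^ b)} \<le> 2 * p ^ b"
      by (rule card_idempotent_like_le[OF p])
    show "card {x \<in> X. fst x = w0} \<le> 2 * p ^ j" for w0
    proof (rule quadratic_pairs_fst_fibre[OF p])
      show "j \<le> c'" by (simp add: j_def)
      show "X \<subseteq> quadratic_pairs p c c' h t (- (int p ^ b)) 0 0" by (simp add: X_def)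
      fix w v assume wv: "(w, v) \<in> X" "j < c'"
      have jb: "j = b" "c' > 2 * b" using wv(2) by (auto simp: j_def split: if_splits)
      have d: "int p ^ (c' + h) dvd v\<^sup>2 + - (int p ^ b) * v - 0 - (w\<^sup>2 + - (int p ^ b) * w - 0) div int p ^
          c * t"
        using wv(1) by (auto simp: X_def quadratic_pairs_def)
      have "int p ^ c' dvd v\<^sup>2 + - (int p ^ b) * v - 0 - (w\<^sup>2 + - (int p ^ b) * w - 0) div int p ^ c * t"
        using d by (rule power_le_dvd) simp
      hence "int p ^ c' dvd (v\<^sup>2 + - (int p ^ b) * v - 0 - (w\<^sup>2 + - (int p ^ b) * w - 0) div int p ^ c * t)
         + (w\<^sup>2 + - (int p ^ b) * w - 0) div int p ^ c * t"
        using t by (intro dvd_add) auto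
      hence v: "int p ^ c' dvd v * (v - int p ^ b)" by (simp add: algebra_simps power2_eq_square)
      have "\<not> int p ^ Suc b dvd 2 * v - int p ^ b"
      proof
        assume a: "int p ^ Suc b dvd 2 * v - int p ^ b"
        have nb: "\<not> int p ^ Suc b dvd int p ^ b" using pp by (simp add: prime_int_iff)
        have e: "Suc b \<le> c' - b" using jb by simp
        show False
        proof (cases "int p ^ Suc b dvd v")
          case True
          have "int p ^ Suc b dvd 2 * v - (2 * v - int p ^ b)" by (rule dvd_diff[OF dvd_mult[OF True] a])
          also have "2 * v - (2 * v - int p ^ b) = int p ^ b" by simp
          finally show False using nb by blast
        next
          case False
          hence "int p ^ (c' - b) dvd v - int p ^ b" using prime_power_dvd_mult_cancel[OF pp _ v] by simp
          hence "int p ^ Suc b dvd v - int p ^ b" using e by (rule power_le_dvd)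
          hence "int p ^ Suc b dvd (2 * v - int p ^ b) - 2 * (v - int p ^ b)" by (intro dvd_diff[OF a]
              dvd_mult)
          also have "(2 * v - int p ^ b) - 2 * (v - int p ^ b) = int p ^ b" by simp
          finally show False using nb by blast
        qed
      qed
      thus "\<not> int p ^ Suc j dvd 2 * v + - (int p ^ b)" using jb by simp
    qed
  qed (rule finite_subset[OF Collect_restrict], simp)
  also have "(2 * p ^ b) * (2 * p ^ j) = 4 * p ^ (b + j)" by (simp add: power_add)
  also have "\<dots> \<le> 4 * p ^ (3 * b)"
    using p1 by (intro mult_left_mono power_increasing) (auto simp: j_def)
  finally show ?thesis by (simp add: X_def)
qed

section \<open>The entries \<open>t\<close> and \<open>y\<close>, and the complete system of
  congruences\<close>

lemma card_self_multiples_le: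
  fixes p :: nat
  assumes p: "prime p"
  shows "card {t\<in>{0..<int p ^ (c' + h)}. int p ^ c' dvd t \<and> int p ^ h dvd t - int p ^ c} \<le> p ^ min h c'"
proof -
  define S where "S = {t\<in>{0..<int p ^ (c' + h)}. int p ^ c' dvd t \<and> int p ^ h dvd t - int p ^ c}"
  have p0: "p > 0" using p prime_gt_0_nat by blast
  have S: "S \<subseteq> {0..<int p ^ (c' + h)}" unfolding S_def by blast
  have "card S \<le> p ^ (c' + h - c')"
    by (rule card_congruent_power_le[OF S p0, of _ 0]) (auto simp: S_def)
  moreover have "card S \<le> p ^ (c' + h - h)"
    by (rule card_congruent_power_le[OF S p0, of _ "int p ^ c"]) (auto simp: S_def)
  ultimately show ?thesis by (simp add: S_def min_def)
qed

text \<open>One of the two factors is divisible by \<open>p\<close> to at least half the power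
  \<open>b\<close>, rounded up. No information on \<open>A\<close> enters.\<close>

lemma card_square_like_le:
  fixes p :: nat
  assumes p: "prime p"
  shows "card {y\<in>{0..<int p ^ b}. int p ^ b dvd y * (y - A)} \<le> 2 * p ^ (b div 2)"
proof -
  define e where "e = b - b div 2"
  define Y where "Y = (\<lambda>z. {w\<in>{0..<int p ^ b}. int p ^ e dvd w - z})"
  have pp: "prime (int p)" and p0: "p > 0" using p prime_gt_0_nat by auto
  have c: "card (Y z) \<le> p ^ (b div 2)" for z
  proof -
    have "card (Y z) \<le> p ^ (b - e)"
      by (rule card_congruent_power_le[of _ p b e z]) (use p0 in \<open>auto simp: Y_def e_def\<close>)
    thus ?thesis by (simp add: e_def)
  qed
  have fin: "finite (Y z)" for z unfolding Y_def by (rule finite_subset[OF Collect_restrict]) simp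
  have "int p ^ e dvd w - 0 \<or> int p ^ e dvd w - A" if w: "int p ^ b dvd w * (w - A)" for w
  proof (cases e)
    case (Suc j)
    have "int p ^ Suc j dvd w \<or> int p ^ (b - j) dvd w - A"
      using prime_power_dvd_mult_cancel[OF pp _ w] by blast
    moreover have "e \<le> b - j" using Suc unfolding e_def by linarith
    ultimately show ?thesis using Suc power_le_dvd by (metis diff_zero)
  qed simp
  hence "{y\<in>{0..<int p ^ b}. int p ^ b dvd y * (y - A)} \<subseteq> Y 0 \<union> Y A"
    unfolding Y_def by auto
  from card_Un_le2[OF this fin fin c c] show ?thesis .
qed

text \<open>What \<open>hnf_congruences\<close> yields for the off-diagonal entries of a subring
  whose Hermite diagonal is \<open>A\<close>, \<open>p ^ b\<close>, \<open>p ^ c\<close>,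
  \<open>p ^ d\<close>. The nested quotients are the multiples of lower rows subtracted while the
  square of a row is being reduced.\<close>

definition ring_tuples :: "nat \<Rightarrow> int \<Rightarrow> nat \<Rightarrow> nat \<Rightarrow> nat \<Rightarrow> (int \<times> int \<times> int \<times> int \<times> int \<times> int) set" where
  "ring_tuples p A b c d = {(y, w, z, t, v, u).
     y \<in> {0..<int p ^ b} \<and> w \<in> {0..<int p ^ c} \<and> z \<in> {0..<int p ^ c} \<and>
     t \<in> {0..<int p ^ d} \<and> v \<in> {0..<int p ^ d} \<and> u \<in> {0..<int p ^ d} \<and>
     int p ^ b dvd y * (y - A) \<and> int p ^ d dvd t * (t - int p ^ c) \<and>
     int p ^ d dvd t * (v - w) \<and> int p ^ d dvd t * (u - z) \<and>
     int p ^ c dvd w\<^sup>2 - int p ^ b * w \<and>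
     int p ^ d dvd v\<^sup>2 - int p ^ b * v - (w\<^sup>2 - int p ^ b * w) div int p ^ c * t \<and>
     int p ^ c dvd z\<^sup>2 - A * z - y * (y - A) div int p ^ b * w \<and>
     int p ^ d dvd u\<^sup>2 - A * u - y * (y - A) div int p ^ b * v -
       (z\<^sup>2 - A * z - y * (y - A) div int p ^ b * w) div int p ^ c * t}"

lemma finite_ring_tuples: "finite (ring_tuples p A b c d)"
  by (rule finite_subset[of _ "{0..<int p ^ b} \<times> {0..<int p ^ c} \<times> {0..<int p ^ c} \<times>
     {0..<int p ^ d} \<times> {0..<int p ^ d} \<times> {0..<int p ^ d}"]) (auto simp: ring_tuples_def)

text \<open>Once the valuation \<open>c'\<close> of \<open>t\<close> is fixed, the factor
  \<open>t\<close> cancels from three of the congruences and leaves \<open>t \<equiv> p ^ c\<close>,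
  \<open>v \<equiv> w\<close> and \<open>u \<equiv> z\<close> modulo \<open>p ^ h\<close>. Then
  \<open>(w, v)\<close> and \<open>(z, u)\<close> are quadratic pairs, and the bounds for
  \<open>y\<close>, \<open>t\<close> and the two pairs multiply. For \<open>c' = d\<close> the
  coprimality is vacuous, which covers \<open>t = 0\<close>.\<close>

lemma card_ring_tuples_valuation_le:
  assumes p: "prime p" and "c' \<le> d"
  shows "card {(y, w, z, t, v, u) \<in> ring_tuples p A b c d.
           \<exists>s. t = int p ^ c' * s \<and> coprime s (int p ^ (d - c'))}
      \<le> 32 * ((c + 1) * (d + 1))\<^sup>2 * p ^ (19 * (b + c + d) div 20)"
proof -
  define h where "h = d - c'"
  have d: "d = c' + h" using assms by (simp add: h_def)
  define X where "X = {(y, w, z, t, v, u) \<in> ring_tuples p A b c d.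
           \<exists>s. t = int p ^ c' * s \<and> coprime s (int p ^ h)}"
  have finX: "finite X" using finite_ring_tuples[of p A b c d]
    unfolding X_def by (rule rev_finite_subset) auto
  have p1: "p \<ge> 1" and pp: "prime (int p)" using p prime_ge_1_nat by auto
  define x where "x = (c + c') div 2"
  define TT where "TT = {t\<in>{0..<int p ^ (c' + h)}. int p ^ c' dvd t \<and> int p ^ h dvd t - int p ^ c}"
  define YY where "YY = {y\<in>{0..<int p ^ b}. int p ^ b dvd y * (y - A)}"
  define M where "M = (2 * p ^ (b div 2)) * p ^ min h c'"
  define K1 where "K1 = 4 * ((c + 1) * (d + 1)) * p ^ min (3 * b) x"
  define K2 where "K2 = 4 * ((c + 1) * (d + 1)) * p ^ x"
  have cancel: "int p ^ h dvd q" if "t = int p ^ c' * s" "coprime s (int p ^ h)" "int p ^ d dvd t * q"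
      for t s q
  proof -
    have "int p ^ c' * int p ^ h dvd int p ^ c' * (s * q)"
      using that by (simp add: d power_add mult.assoc)
    hence "int p ^ h dvd s * q" using p1 by simp
    thus ?thesis using that(2) by (simp add: coprime_commute coprime_dvd_mult_right_iff)
  qed
  have XD: "t \<in> TT" "y \<in> YY" "(w, v) \<in> quadratic_pairs p c c' h t (- (int p ^ b)) 0 0"
    "(z, u) \<in> quadratic_pairs p c c' h t (- A) (y * (y - A) div int p ^ b * w) (y * (y - A) div int p ^ b
        * v)"
    "\<exists>s. t = int p ^ c' * s \<and> coprime s (int p ^ h) \<and> int p ^ h dvd t - int p ^ c"
    if R0: "(y, w, z, t, v, u) \<in> X" for y w z t v u
  proof -
    obtain s where s: "t = int p ^ c' * s" "coprime s (int p ^ h)" using R0 by (auto simp: X_def)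
    have R: "(y, w, z, t, v, u) \<in> ring_tuples p A b c d" using R0 by (auto simp: X_def)
    have h: "int p ^ h dvd t - int p ^ c" "int p ^ h dvd v - w" "int p ^ h dvd u - z"
      by (rule cancel[OF s], use R in \<open>simp add: ring_tuples_def\<close>)+
    show "t \<in> TT" using R h s by (auto simp: ring_tuples_def TT_def d)
    show "y \<in> YY" using R by (auto simp: ring_tuples_def YY_def)
    show "(w, v) \<in> quadratic_pairs p c c' h t (- (int p ^ b)) 0 0"
      using R h by (auto simp: ring_tuples_def quadratic_pairs_def d)
    show "(z, u) \<in> quadratic_pairs p c c' h t (- A) (y * (y - A) div int p ^ b * w) (y * (y - A) div int
        p ^ b * v)"
      using R h by (auto simp: ring_tuples_def quadratic_pairs_def d)
    show "\<exists>s. t = int p ^ c' * s \<and> coprime s (int p ^ h) \<and> int p ^ h dvd t - int p ^ c" using s h by blast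
  qed
  show ?thesis
  proof (cases "X = {}")
    case True
    show ?thesis unfolding h_def[symmetric] X_def[symmetric] by (simp only: True) simp
  next
    case False
    then obtain t0 where t0: "t0 \<in> TT" using XD(1) by fastforce
    \<comment> \<open>Otherwise \<open>p ^ (c + 1)\<close> would divide both \<open>t0\<close> and
      \<open>t0 - p ^ c\<close>. The consequence used below is
      \<open>2 * min h c' \<le> c + c'\<close>.\<close>
    have hc: "c' \<le> c \<or> h \<le> c"
    proof (rule ccontr)
      assume "\<not> (c' \<le> c \<or> h \<le> c)"
      hence "int p ^ Suc c dvd t0" "int p ^ Suc c dvd t0 - int p ^ c"
        using t0 unfolding TT_def by (auto intro: power_le_dvd simp del: power_Suc)
      hence "int p ^ Suc c dvd t0 - (t0 - int p ^ c)" by (rule dvd_diff)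
      thus False using pp by (simp add: prime_int_iff)
    qed
    have leK2: "card (quadratic_pairs p c c' h t D C1 C2) \<le> 4 * ((c + 1) * (d + 1)) * p ^ x"
      if "t = int p ^ c' * s" "coprime s (int p ^ h)" "int p ^ h dvd t - int p ^ c" for t s D C1 C2
    proof -
      have "4 * ((c + 1) * (c' + 1)) * p ^ x \<le> 4 * ((c + 1) * (d + 1)) * p ^ x"
        by (intro mult_right_mono mult_left_mono) (auto simp: d)
      thus ?thesis using card_quadratic_pairs_le[OF p that] unfolding x_def by (rule le_trans[rotated])
    qed
    have "card X \<le> M * (K1 * K2)"
    proof (rule card_le_fibre_bound[OF finX, where f = "\<lambda>(y, w, z, t, v, u). (y, t)" and T = "YY \<times> TT"])
      show "(\<lambda>(y, w, z, t, v, u). (y, t)) ` X \<subseteq> YY \<times> TT"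
        using XD(1,2) by fastforce
      show "finite (YY \<times> TT)" unfolding YY_def TT_def
        by (intro finite_cartesian_product; rule finite_subset[OF Collect_restrict]; simp)
      show "card (YY \<times> TT) \<le> M" unfolding card_cartesian_product M_def YY_def TT_def
        by (intro mult_mono card_square_like_le[OF p] card_self_multiples_le[OF p]) auto
      fix yt assume "yt \<in> YY \<times> TT"
      obtain y t where yt: "yt = (y, t)" by (cases yt)
      define Z where "Z = {s \<in> X. (case s of (y, w, z, t, v, u) \<Rightarrow> (y, t)) = yt}"
      show "card {s \<in> X. (case s of (y, w, z, t, v, u) \<Rightarrow> (y, t)) = yt} \<le> K1 * K2"
      proof (cases "Z = {}")
        case True
        thus ?thesis by (simp only: Z_def[symmetric]) simp
      next
        case False
        then obtain q where "q \<in> Z" by blast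
        moreover obtain y1 w1 z1 t1 v1 u1 where "q = (y1, w1, z1, t1, v1, u1)" by (cases q)
        ultimately have "(y, w1, z1, t, v1, u1) \<in> X" unfolding Z_def yt by auto
        from XD(5)[OF this] obtain s
          where s: "t = int p ^ c' * s" "coprime s (int p ^ h)" "int p ^ h dvd t - int p ^ c" by blast
        have "card Z \<le> K1 * K2"
        proof (rule card_le_fibre_bound[where f = "\<lambda>(y, w, z, t, v, u). (w, v)"
              and T = "quadratic_pairs p c c' h t (- (int p ^ b)) 0 0"])
          show "finite Z" using finX by (simp add: Z_def)
          show "(\<lambda>(y, w, z, t, v, u). (w, v)) ` Z \<subseteq> quadratic_pairs p c c' h t (- (int p ^ b)) 0 0"
            using XD(3) unfolding Z_def yt by fastforce
          show "card (quadratic_pairs p c c' h t (- (int p ^ b)) 0 0) \<le> K1"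
          proof (cases "3 * b \<le> x")
            case True
            have "card (quadratic_pairs p c c' h t (- (int p ^ b)) 0 0) \<le> 4 * p ^ (3 * b)"
              using s by (intro card_quadratic_pairs_le'[OF p]) auto
            also have "\<dots> \<le> 4 * ((c + 1) * (d + 1)) * p ^ (3 * b)" by (intro mult_right_mono) auto
            finally show ?thesis using True unfolding K1_def by (simp add: min_def)
          next
            case False
            thus ?thesis using leK2[OF s] unfolding K1_def by (simp add: min_def)
          qed
          fix wv assume "wv \<in> quadratic_pairs p c c' h t (- (int p ^ b)) 0 0"
          obtain w v where wv: "wv = (w, v)" by (cases wv)
          define Q where "Q = quadratic_pairs p c c' h t (- A) (y * (y - A) div int p ^ b * w) (y * (y -
              A) div int p ^ b * v)"
          have "{s \<in> Z. (case s of (y, w, z, t, v, u) \<Rightarrow> (w, v)) = wv} \<subseteq> (\<lambda>(z, u). (y, w, z, t, v, u)) ` Q"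
            using XD(4) unfolding Z_def yt wv Q_def by force
          hence "card {s \<in> Z. (case s of (y, w, z, t, v, u) \<Rightarrow> (w, v)) = wv} \<le> card Q"
            by (rule surj_card_le[rotated]) (simp add: Q_def)
          also have "\<dots> \<le> K2" unfolding Q_def K2_def by (rule leK2[OF s])
          finally show "card {s \<in> Z. (case s of (y, w, z, t, v, u) \<Rightarrow> (w, v)) = wv} \<le> K2" .
        qed simp
        thus ?thesis by (simp add: Z_def)
      qed
    qed
    also have "M * (K1 * K2) = 32 * ((c + 1) * (d + 1))\<^sup>2 * p ^ (b div 2 + min h c' + min (3 * b) x + x)"
      unfolding M_def K1_def K2_def by (simp add: power_add power2_eq_square algebra_simps)
    also have "\<dots> \<le> 32 * ((c + 1) * (d + 1))\<^sup>2 * p ^ (19 * (b + c + d) div 20)"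
    proof (intro mult_left_mono power_increasing p1)
      \<comment> \<open>This is where 19/20 originates. Bound \<open>min (3 * b) x\<close> by 3/20
        of \<open>3 * b\<close> plus 17/20 of \<open>x\<close>. Then \<open>b\<close> has the
        coefficient 1/2 + 9/20 = 19/20, and \<open>c + c'\<close> has 37/40. What remains of 19/20
        of \<open>c + c' + h\<close> is 1/40 of \<open>c + c'\<close> plus 19/20 of
        \<open>h\<close>, and this covers \<open>min h c'\<close> by \<open>hc\<close>. Equality
        occurs for \<open>b = 2\<close>, \<open>c = c' = h = 6\<close>.\<close>
      have "20 * (b div 2 + min h c' + min (3 * b) x + x) \<le> 19 * (b + c + d)"
        using hc unfolding d x_def by (auto simp: min_def)
      thus "b div 2 + min h c' + min (3 * b) x + x \<le> 19 * (b + c + d) div 20" by simp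
    qed auto
    finally show ?thesis unfolding X_def h_def .
  qed
qed

lemma card_ring_tuples_le:
  assumes p: "prime p"
  shows "card (ring_tuples p A b c d) \<le> 32 * (1 + (b + c + d)) ^ 5 * p ^ (19 * (b + c + d) div 20)"
proof -
  define V where "V = (\<lambda>c'. {(y, w, z, t, v, u) \<in> ring_tuples p A b c d.
           \<exists>s. t = int p ^ c' * s \<and> coprime s (int p ^ (d - c'))})"
  define K where "K = 32 * ((c + 1) * (d + 1))\<^sup>2 * p ^ (19 * (b + c + d) div 20)"
  have pp: "prime (int p)" using p by simp
  have fin: "finite (V c')" for c' using finite_ring_tuples[of p A b c d]
    unfolding V_def by (rule rev_finite_subset) auto
  have "\<exists>c'\<le>d. \<exists>s. t = int p ^ c' * s \<and> coprime s (int p ^ (d - c'))" if "0 \<le> t" "t < int p ^ d" for t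
  proof -
    obtain i where i: "i \<le> d" "int p ^ i dvd t" "i < d \<longrightarrow> \<not> int p ^ Suc i dvd t"
      using prime_power_valuation[OF pp] by blast
    obtain s where s: "t = int p ^ i * s" using i(2) by blast
    have "coprime s (int p ^ (d - i))"
    proof (cases "i < d")
      case True
      hence "\<not> int p dvd s" using i(3) s by (auto simp: mult.commute mult_dvd_mono)
      hence "coprime (int p) s" using pp by (simp add: prime_imp_coprime)
      thus ?thesis by (simp add: coprime_commute)
    qed simp
    thus ?thesis using i s by blast
  qed
  hence "ring_tuples p A b c d \<subseteq> (\<Union>c'\<in>{..d}. V c')"
    unfolding V_def ring_tuples_def by fastforce
  hence "card (ring_tuples p A b c d) \<le> card (\<Union>c'\<in>{..d}. V c')"
    using fin by (intro card_mono) auto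
  also have "\<dots> \<le> (\<Sum>c'\<in>{..d}. card (V c'))" by (rule card_UN_le) simp
  also have "\<dots> \<le> (\<Sum>c'\<in>{..d}. K)"
    unfolding V_def K_def by (intro sum_mono card_ring_tuples_valuation_le[OF p]) auto
  also have "\<dots> = 32 * ((d + 1) * ((c + 1) * (d + 1))\<^sup>2) * p ^ (19 * (b + c + d) div 20)"
    by (simp add: K_def algebra_simps)
  also have "\<dots> \<le> 32 * (1 + (b + c + d)) ^ 5 * p ^ (19 * (b + c + d) div 20)"
  proof (intro mult_right_mono mult_left_mono)
    define n where "n = 1 + (b + c + d)"
    have "(d + 1) * ((c + 1) * (d + 1))\<^sup>2 \<le> n * (n * n)\<^sup>2"
      by (intro mult_mono power_mono) (auto simp: n_def)
    also have "\<dots> = n ^ 5" by (simp add: power2_eq_square eval_nat_numeral)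
    finally show "(d + 1) * ((c + 1) * (d + 1))\<^sup>2 \<le> (1 + (b + c + d)) ^ 5" by (simp add: n_def)
  qed auto
  finally show ?thesis .
qed

section \<open>Subrings in Hermite normal form\<close>

definition unital_subring :: "(int ^ 5) set \<Rightarrow> bool" where
  "unital_subring S \<longleftrightarrow> 1 \<in> S \<and> (\<forall>x\<in>S. \<forall>y\<in>S. x - y \<in> S \<and> x * y \<in> S)"

lemma a_inv_Z5: "\<ominus>\<^bsub>Z5\<^esub> x = - x"
proof -
  interpret cring Z5 by (rule cring_Z5)
  show ?thesis by (rule minus_equality) (auto simp: Z5_def)
qed

lemma subring_Z5_iff: "subring S Z5 \<longleftrightarrow> unital_subring S"
proof
  assume "subring S Z5"
  note S = subringE[OF this]
  have m: "x * y \<in> S" and p: "x + y \<in> S" and i: "- x \<in> S" if "x \<in> S" "y \<in> S" for x y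
    using S(5)[OF that(1)] S(6,7)[OF that] a_inv_Z5[of x] by (auto simp: Z5_def)
  have "x - y \<in> S" if "x \<in> S" "y \<in> S" for x y using p[OF that(1) i[OF that(2,2)]] by simp
  moreover have "1 \<in> S" using S(3) by (simp add: Z5_def)
  ultimately show "unital_subring S" using m unfolding unital_subring_def by blast
next
  assume S: "unital_subring S"
  interpret cring Z5 by (rule cring_Z5)
  have d: "x - y \<in> S" "x * y \<in> S" if "x \<in> S" "y \<in> S" for x y using S that unfolding unital_subring_def by
      blast+
  have 1: "1 \<in> S" using S unfolding unital_subring_def by blast
  have 0: "0 \<in> S" using d(1)[OF 1 1] by simp
  have i: "- x \<in> S" if "x \<in> S" for x using d(1)[OF 0 that] by simp
  have a: "x + y \<in> S" if "x \<in> S" "y \<in> S" for x y using d(1)[OF that(1) i[OF that(2)]] by simp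
  show "subring S Z5"
    by (rule subringI) (use 1 d a i in \<open>auto simp: a_inv_Z5, auto simp: Z5_def\<close>)
qed

lemma unital_subringD:
  assumes "unital_subring S"
  shows "1 \<in> S" "x \<in> S \<Longrightarrow> y \<in> S \<Longrightarrow> x - y \<in> S" "x \<in> S \<Longrightarrow> y \<in> S \<Longrightarrow> x * y \<in> S" "0 \<in> S"
    "x \<in> S \<Longrightarrow> - x \<in> S" "x \<in> S \<Longrightarrow> y \<in> S \<Longrightarrow> x + y \<in> S"
proof -
  have d: "x - y \<in> S" "x * y \<in> S" if "x \<in> S" "y \<in> S" for x y
    using assms that unfolding unital_subring_def by blast+
  have 1: "1 \<in> S" using assms unfolding unital_subring_def by blast
  have 0: "0 \<in> S" using d(1)[OF 1 1] by simp
  have i: "- x \<in> S" if "x \<in> S" for x using d(1)[OF 0 that] by simp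
  show "1 \<in> S" "x \<in> S \<Longrightarrow> y \<in> S \<Longrightarrow> x - y \<in> S" "x \<in> S \<Longrightarrow> y \<in> S \<Longrightarrow> x * y \<in> S" "0 \<in> S"
    "x \<in> S \<Longrightarrow> - x \<in> S" using 1 d 0 i by blast+
  show "x + y \<in> S" if "x \<in> S" "y \<in> S" using d(1)[OF that(1) i[OF that(2)]] by simp
qed

lemma unital_subring_scale:
  assumes S: "unital_subring S" and x: "x \<in> S"
  shows "n *s x \<in> S"
proof (induction n rule: int_induct[of _ 0])
  case base
  show ?case using unital_subringD(4)[OF S] by simp
next
  case (step1 i)
  have "(i + 1) *s x = i *s x + x" by (simp add: vec_eq_iff algebra_simps)
  thus ?case using unital_subringD(6)[OF S step1(2) x] by simp
next
  case (step2 i)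
  have "(i - 1) *s x = i *s x - x" by (simp add: vec_eq_iff algebra_simps)
  thus ?case using unital_subringD(2)[OF S step2(2) x] by simp
qed

section \<open>Cosets and the index\<close>

definition coset_of :: "(int ^ 5) set \<Rightarrow> int ^ 5 \<Rightarrow> (int ^ 5) set" where
  "coset_of S a = {y. y - a \<in> S}"

lemma a_rcosets_Z5: "a_rcosets\<^bsub>Z5\<^esub> S = range (coset_of S)"
proof -
  have "S +>\<^bsub>Z5\<^esub> a = coset_of S a" for a
  proof -
    have "S +>\<^bsub>Z5\<^esub> a = (\<lambda>h. h + a) ` S" by (auto simp: a_r_coset_def' Z5_def)
    also have "\<dots> = coset_of S a"
      unfolding coset_of_def by (auto simp: image_iff) (metis diff_add_cancel)
    finally show ?thesis .
  qed
  thus ?thesis by (auto simp: A_RCOSETS_def' Z5_def)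
qed

lemma coset_of_eq_iff:
  assumes S: "unital_subring S"
  shows "coset_of S a = coset_of S b \<longleftrightarrow> a - b \<in> S"
proof
  assume "coset_of S a = coset_of S b"
  moreover have "a \<in> coset_of S a" using unital_subringD(4)[OF S] by (simp add: coset_of_def)
  ultimately show "a - b \<in> S" by (auto simp: coset_of_def)
next
  assume ab: "a - b \<in> S"
  have "y - b \<in> S" if "y - a \<in> S" for y using unital_subringD(6)[OF S that ab] by simp
  moreover have "y - a \<in> S" if "y - b \<in> S" for y using unital_subringD(2)[OF S that ab] by simp
  ultimately show "coset_of S a = coset_of S b" by (auto simp: coset_of_def)
qed

definition has_index :: "(int ^ 5) set \<Rightarrow> nat \<Rightarrow> bool" where
  "has_index S n \<longleftrightarrow> finite (range (coset_of S)) \<and> card (range (coset_of S)) = n"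

lemma has_index_unique: "has_index S m \<Longrightarrow> has_index S n \<Longrightarrow> m = n"
  by (simp add: has_index_def)

lemma has_index_pos: "has_index S n \<Longrightarrow> n > 0"
  unfolding has_index_def by (metis UNIV_I card_gt_0_iff image_is_empty UNIV_not_empty)

lemma has_index_transversal:
  assumes S: "unital_subring S" and T: "finite T" "\<And>x. \<exists>t\<in>T. x - t \<in> S"
    "\<And>t t'. t \<in> T \<Longrightarrow> t' \<in> T \<Longrightarrow> t - t' \<in> S \<Longrightarrow> t = t'"
  shows "has_index S (card T)"
proof -
  have "range (coset_of S) = coset_of S ` T"
    using T(2) coset_of_eq_iff[OF S] by (auto simp: image_iff)
  moreover have "inj_on (coset_of S) T" using T(3) coset_of_eq_iff[OF S] by (auto simp: inj_on_def)
  ultimately show ?thesis using T(1) by (simp add: has_index_def card_image)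
qed

text \<open>Cosets of \<open>S\<close> map onto cosets of \<open>S'\<close>; as the two finite
  numbers agree, the map is injective, and \<open>S'\<close> consists of a single coset of
  \<open>S\<close>.\<close>

lemma has_index_subset_eq:
  assumes S: "unital_subring S" "has_index S n" and S': "unital_subring S'" "has_index S' n" and sub: "S \<subseteq> S'"
  shows "S = S'"
proof -
  define g where "g = (\<lambda>X. \<Union>x\<in>X. coset_of S' x)"
  have g: "g (coset_of S a) = coset_of S' a" for a
  proof -
    have "coset_of S' x = coset_of S' a" if "x \<in> coset_of S a" for x
      using that sub coset_of_eq_iff[OF S'(1)] by (auto simp: coset_of_def)
    moreover have "a \<in> coset_of S a" using unital_subringD(4)[OF S(1)] by (simp add: coset_of_def)
    ultimately show ?thesis unfolding g_def by blast
  qed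
  have "g ` range (coset_of S) = range (coset_of S')" using g by (auto simp: image_image)
  hence inj: "inj_on g (range (coset_of S))"
    using S(2) S'(2) by (intro eq_card_imp_inj_on) (auto simp: has_index_def)
  have "x \<in> S" if "x \<in> S'" for x
  proof -
    have "coset_of S' x = coset_of S' 0" using that coset_of_eq_iff[OF S'(1)] by simp
    hence "g (coset_of S x) = g (coset_of S 0)" by (simp add: g)
    hence "coset_of S x = coset_of S 0" using inj by (auto dest: inj_onD)
    thus ?thesis using coset_of_eq_iff[OF S(1)] by simp
  qed
  thus ?thesis using sub by blast
qed

section \<open>Hermite normal form with respect to a chosen order of the coordinates\<close>

lemma int_subgroup_generator:
  fixes J :: "int set"
  assumes diff: "\<And>a b. a \<in> J \<Longrightarrow> b \<in> J \<Longrightarrow> a - b \<in> J" and scale: "\<And>a n. a \<in> J \<Longrightarrow> n * a \<in> J"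
    and pos: "m \<in> J" "m > 0"
  obtains g where "g > 0" "g \<in> J" "\<And>a. a \<in> J \<Longrightarrow> g dvd a"
proof -
  define n where "n = (LEAST n. n > 0 \<and> int n \<in> J)"
  have "nat m > 0 \<and> int (nat m) \<in> J" using pos by simp
  hence n: "n > 0" "int n \<in> J" unfolding n_def by (metis (mono_tags, lifting) LeastI)+
  have "int n dvd a" if "a \<in> J" for a
  proof (rule ccontr)
    assume nd: "\<not> int n dvd a"
    have "a - (a div int n) * int n \<in> J" by (rule diff[OF that scale[OF n(2)]])
    hence "a mod int n \<in> J" by (simp add: minus_div_mult_eq_mod)
    moreover have "a mod int n > 0" "a mod int n < int n"
      using nd n(1) pos_mod_sign[of "int n" a] pos_mod_bound[of "int n" a]
      unfolding dvd_eq_mod_eq_0 by linarith+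
    ultimately have "nat (a mod int n) > 0 \<and> int (nat (a mod int n)) \<in> J" "nat (a mod int n) < n" by auto
    thus False using not_less_Least[of "nat (a mod int n)" "\<lambda>n. n > 0 \<and> int n \<in> J"] unfolding n_def by blast
  qed
  thus ?thesis using that[of "int n"] n by auto
qed

text \<open>An arbitrary enumeration of the five indices, so that two coordinates known to be
  congruent can be put in front.\<close>

locale coordinates =
  fixes i j k l e :: 5
  assumes dist: "distinct [i, j, k, l, e]"
begin

lemma UNIV_eq: "UNIV = {i, j, k, l, e}"
proof (rule sym, rule card_subset_eq)
  show "card {i, j, k, l, e} = card (UNIV :: 5 set)" using dist by simp
qed auto

definition V :: "int \<Rightarrow> int \<Rightarrow> int \<Rightarrow> int \<Rightarrow> int \<Rightarrow> int ^ 5" where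
  "V a b c d f = (\<chi> m. if m = i then a else if m = j then b else if m = k then c else if m = l then d else f)"

lemma V_nth [simp]: "V a b c d f $ i = a" "V a b c d f $ j = b" "V a b c d f $ k = c"
  "V a b c d f $ l = d" "V a b c d f $ e = f"
  using dist by (auto simp: V_def)

lemma vec_eq_coords: "x = y \<longleftrightarrow> x $ i = y $ i \<and> x $ j = y $ j \<and> x $ k = y $ k \<and> x $ l = y $ l \<and> x $ e = y $ e"
  for x y :: "int ^ 5"
proof -
  have "x = y \<longleftrightarrow> (\<forall>m\<in>UNIV. x $ m = y $ m)" by (simp add: vec_eq_iff)
  thus ?thesis unfolding UNIV_eq by simp
qed

lemma V_eta: "V (x $ i) (x $ j) (x $ k) (x $ l) (x $ e) = x"
  by (simp add: vec_eq_coords)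

lemma V_ops:
  "V a b c d f - V a' b' c' d' f' = V (a - a') (b - b') (c - c') (d - d') (f - f')"
  "V a b c d f * V a' b' c' d' f' = V (a * a') (b * b') (c * c') (d * d') (f * f')"
  "n *s V a b c d f = V (n * a) (n * b) (n * c) (n * d) (n * f)"
  "1 = V 1 1 1 1 1"
  by (simp_all add: vec_eq_coords)

text \<open>The divisibility clauses say that each diagonal entry generates the ideal of leading
  coefficients at its place. The first row of the basis is 1, which every unital subring contains,
  so only four rows are recorded.\<close>

definition hnf :: "(int ^ 5) set \<Rightarrow> int \<Rightarrow> int \<Rightarrow> int \<Rightarrow> int \<Rightarrow> int \<Rightarrow> int \<Rightarrow> int \<Rightarrow> int \<Rightarrow> int \<Rightarrow> int \<Rightarrow> bool" where
  "hnf S A B C D y w z t v u \<longleftrightarrow>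
     A > 0 \<and> B > 0 \<and> C > 0 \<and> D > 0 \<and> y \<in> {0..<B} \<and> w \<in> {0..<C} \<and> z \<in> {0..<C} \<and>
     t \<in> {0..<D} \<and> v \<in> {0..<D} \<and> u \<in> {0..<D} \<and>
     V 0 A y z u \<in> S \<and> V 0 0 B w v \<in> S \<and> V 0 0 0 C t \<in> S \<and> V 0 0 0 0 D \<in> S \<and>
     (\<forall>a b c d. V 0 a b c d \<in> S \<longrightarrow> A dvd a) \<and> (\<forall>b c d. V 0 0 b c d \<in> S \<longrightarrow> B dvd b) \<and>
     (\<forall>c d. V 0 0 0 c d \<in> S \<longrightarrow> C dvd c) \<and> (\<forall>d. V 0 0 0 0 d \<in> S \<longrightarrow> D dvd d)"

context
  fixes S assumes S: "unital_subring S"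
begin

lemma V_diff_scale:
  "V a b c d f \<in> S \<Longrightarrow> V a' b' c' d' f' \<in> S \<Longrightarrow>
    V (a - n * a') (b - n * b') (c - n * c') (d - n * d') (f - n * f') \<in> S"
  using unital_subringD(2)[OF S, OF _ unital_subring_scale[OF S]] by (metis V_ops(1,3))

lemma V_const: "V n n n n n \<in> S"
  using unital_subring_scale[OF S unital_subringD(1)[OF S], of n] by (simp add: V_ops)

lemma hnf_exists:
  assumes fin: "finite (range (coset_of S))"
  shows "\<exists>A B C D y w z t v u. hnf S A B C D y w z t v u"
proof -
  \<comment> \<open>Pigeonhole: two of the infinitely many multiples of \<open>x\<close> lie in the
    same coset.\<close>
  have ex: "\<exists>n>0. n *s x \<in> S" for x
  proof -
    have "finite (range (\<lambda>n::nat. coset_of S (int n *s x)))"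
      by (rule finite_subset[OF _ fin]) auto
    hence "\<not> inj (\<lambda>n::nat. coset_of S (int n *s x))" using range_inj_infinite by blast
    then obtain m n :: nat where mn: "m \<noteq> n" "coset_of S (int m *s x) = coset_of S (int n *s x)"
      by (auto simp: inj_def)
    have 1: "(int m - int n) *s x \<in> S"
      using mn(2) unfolding coset_of_eq_iff[OF S] by (simp add: vector_sub_rdistrib)
    have 2: "(int n - int m) *s x \<in> S"
      using mn(2)[symmetric] unfolding coset_of_eq_iff[OF S] by (simp add: vector_sub_rdistrib)
    show ?thesis
    proof (cases "m < n")
      case True
      show ?thesis by (rule exI[of _ "int n - int m"], rule conjI[OF _ 2]) (use True in simp)
    next
      case False
      show ?thesis by (rule exI[of _ "int m - int n"], rule conjI[OF _ 1]) (use False mn(1) in simp)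
    qed
  qed
  have closed: "V 0 (n * b) (n * c) (n * d) (n * f) \<in> S" if "V 0 b c d f \<in> S" for n b c d f
    using unital_subring_scale[OF S that, of n] by (simp add: V_ops)
  have minus: "V 0 (b - b') (c - c') (d - d') (f - f') \<in> S" if "V 0 b c d f \<in> S" "V 0 b' c' d' f' \<in> S"
      for b c d f b' c' d' f'
    using unital_subringD(2)[OF S that] by (simp add: V_ops)
  obtain D where D: "D > 0" "V 0 0 0 0 D \<in> S" "\<And>d. V 0 0 0 0 d \<in> S \<Longrightarrow> D dvd d"
  proof -
    obtain m where m: "m > 0" "V 0 0 0 0 m \<in> S" using ex[of "V 0 0 0 0 1"] by (auto simp: V_ops)
    show ?thesis
    proof (rule int_subgroup_generator[of "{d. V 0 0 0 0 d \<in> S}" m])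
      show "a - b \<in> {d. V 0 0 0 0 d \<in> S}" if ab: "a \<in> {d. V 0 0 0 0 d \<in> S}" "b \<in> {d. V 0 0 0 0 d \<in> S}" for a b
        using minus[of 0 0 0 a 0 0 0 b] ab by simp
      show "n * a \<in> {d. V 0 0 0 0 d \<in> S}" if ab: "a \<in> {d. V 0 0 0 0 d \<in> S}" for a n
        using closed[of 0 0 0 a n] ab by simp
    qed (use m that in auto)
  qed
  obtain C t0 where C: "C > 0" "V 0 0 0 C t0 \<in> S" "\<And>c d. V 0 0 0 c d \<in> S \<Longrightarrow> C dvd c"
  proof -
    obtain m where m: "m > 0" "V 0 0 0 m 0 \<in> S" using ex[of "V 0 0 0 1 0"] by (auto simp: V_ops)
    show ?thesis
    proof (rule int_subgroup_generator[of "{c. \<exists>d. V 0 0 0 c d \<in> S}" m])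
      show "m \<in> {c. \<exists>d. V 0 0 0 c d \<in> S}" using m by blast
      show "a - b \<in> {c. \<exists>d. V 0 0 0 c d \<in> S}" if ab: "a \<in> {c. \<exists>d. V 0 0 0 c d \<in> S}" "b \<in> {c. \<exists>d. V 0 0 0
          c d \<in> S}" for a b
      proof -
        obtain d d' where "V 0 0 0 a d \<in> S" "V 0 0 0 b d' \<in> S" using ab by blast
        from minus[OF this] have "V 0 0 0 (a - b) (d - d') \<in> S" by simp
        thus ?thesis by blast
      qed
      show "n * a \<in> {c. \<exists>d. V 0 0 0 c d \<in> S}" if ab: "a \<in> {c. \<exists>d. V 0 0 0 c d \<in> S}" for a n
      proof -
        obtain d where "V 0 0 0 a d \<in> S" using ab by blast
        from closed[OF this, of n] have "V 0 0 0 (n * a) (n * d) \<in> S" by simp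
        thus ?thesis by blast
      qed
    next
      fix g assume g: "g > 0" "g \<in> {c. \<exists>d. V 0 0 0 c d \<in> S}" "\<And>a. a \<in> {c. \<exists>d. V 0 0 0 c d \<in> S} \<Longrightarrow> g dvd a"
      obtain d where "V 0 0 0 g d \<in> S" using g(2) by blast
      thus ?thesis by (rule that[OF g(1)]) (use g(3) in blast)
    qed (use m in simp)
  qed
  obtain B w0 v0 where B: "B > 0" "V 0 0 B w0 v0 \<in> S" "\<And>b c d. V 0 0 b c d \<in> S \<Longrightarrow> B dvd b"
  proof -
    obtain m where m: "m > 0" "V 0 0 m 0 0 \<in> S" using ex[of "V 0 0 1 0 0"] by (auto simp: V_ops)
    show ?thesis
    proof (rule int_subgroup_generator[of "{b. \<exists>c d. V 0 0 b c d \<in> S}" m])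
      show "m \<in> {b. \<exists>c d. V 0 0 b c d \<in> S}" using m by blast
      show "a - b \<in> {b. \<exists>c d. V 0 0 b c d \<in> S}" if ab: "a \<in> {b. \<exists>c d. V 0 0 b c d \<in> S}" "b \<in> {b. \<exists>c d. V
          0 0 b c d \<in> S}" for a b
      proof -
        obtain c d c' d' where "V 0 0 a c d \<in> S" "V 0 0 b c' d' \<in> S" using ab by blast
        from minus[OF this] have "V 0 0 (a - b) (c - c') (d - d') \<in> S" by simp
        thus ?thesis by blast
      qed
      show "n * a \<in> {b. \<exists>c d. V 0 0 b c d \<in> S}" if ab: "a \<in> {b. \<exists>c d. V 0 0 b c d \<in> S}" for a n
      proof -
        obtain c d where "V 0 0 a c d \<in> S" using ab by blast
        from closed[OF this, of n] have "V 0 0 (n * a) (n * c) (n * d) \<in> S" by simp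
        thus ?thesis by blast
      qed
    next
      fix g assume g: "g > 0" "g \<in> {b. \<exists>c d. V 0 0 b c d \<in> S}" "\<And>a. a \<in> {b. \<exists>c d. V 0 0 b c d \<in> S} \<Longrightarrow> g dvd a"
      obtain c d where "V 0 0 g c d \<in> S" using g(2) by blast
      thus ?thesis by (rule that[OF g(1)]) (use g(3) in blast)
    qed (use m in simp)
  qed
  obtain A y0 z0 u0 where A: "A > 0" "V 0 A y0 z0 u0 \<in> S" "\<And>a b c d. V 0 a b c d \<in> S \<Longrightarrow> A dvd a"
  proof -
    obtain m where m: "m > 0" "V 0 m 0 0 0 \<in> S" using ex[of "V 0 1 0 0 0"] by (auto simp: V_ops)
    show ?thesis
    proof (rule int_subgroup_generator[of "{a. \<exists>b c d. V 0 a b c d \<in> S}" m])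
      show "m \<in> {a. \<exists>b c d. V 0 a b c d \<in> S}" using m by blast
      show "a - b \<in> {a. \<exists>b c d. V 0 a b c d \<in> S}" if ab: "a \<in> {a. \<exists>b c d. V 0 a b c d \<in> S}" "b \<in> {a. \<exists>b c
          d. V 0 a b c d \<in> S}" for a b
        using ab minus by blast
      show "n * a \<in> {a. \<exists>b c d. V 0 a b c d \<in> S}" if ab: "a \<in> {a. \<exists>b c d. V 0 a b c d \<in> S}" for a n
        using ab closed by blast
    next
      fix g assume g: "g > 0" "g \<in> {a. \<exists>b c d. V 0 a b c d \<in> S}" "\<And>a. a \<in> {a. \<exists>b c d. V 0 a b c d \<in> S} \<Longrightarrow>
          g dvd a"
      obtain b c d where "V 0 g b c d \<in> S" using g(2) by blast
      thus ?thesis by (rule that[OF g(1)]) (use g(3) in blast)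
    qed (use m in simp)
  qed
  \<comment> \<open>The rows are reduced from the bottom up, and each row from left to right:
    clearing an entry subtracts a multiple of a lower row, which alters the entries to the
    right.\<close>
  define t where "t = t0 mod D"
  have t: "V 0 0 0 C t \<in> S" using V_diff_scale[OF C(2) D(2), of "t0 div D"]
    by (simp add: t_def minus_div_mult_eq_mod)
  define w v where "w = w0 mod C" and "v = (v0 - (w0 div C) * t) mod D"
  have "V 0 0 B w (v0 - (w0 div C) * t) \<in> S" using V_diff_scale[OF B(2) t, of "w0 div C"]
    by (simp add: w_def minus_div_mult_eq_mod)
  from V_diff_scale[OF this D(2), of "(v0 - (w0 div C) * t) div D"]
  have wv: "V 0 0 B w v \<in> S" by (simp add: v_def minus_div_mult_eq_mod)
  define y z1 u1 where "y = y0 mod B" and "z1 = z0 - (y0 div B) * w" and "u1 = u0 - (y0 div B) * v"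
  define z u2 where "z = z1 mod C" and "u2 = u1 - (z1 div C) * t"
  define u where "u = u2 mod D"
  have "V 0 A y z1 u1 \<in> S" using V_diff_scale[OF A(2) wv, of "y0 div B"]
    by (simp add: y_def z1_def u1_def minus_div_mult_eq_mod)
  from V_diff_scale[OF this t, of "z1 div C"]
  have "V 0 A y z u2 \<in> S" by (simp add: z_def u2_def minus_div_mult_eq_mod)
  from V_diff_scale[OF this D(2), of "u2 div D"]
  have yzu: "V 0 A y z u \<in> S" by (simp add: u_def minus_div_mult_eq_mod)
  have "hnf S A B C D y w z t v u"
    unfolding hnf_def using A(1,3) B(1,3) C(1,3) D t wv yzu
    by (auto simp: y_def w_def z_def t_def v_def u_def)
  thus ?thesis by blast
qed

end

definition hnf_span where
  "hnf_span A B C D y w z t v u =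
     {V n1 (n1 + n2 * A) (n1 + n2 * y + n3 * B) (n1 + n2 * z + n3 * w + n4 * C)
        (n1 + n2 * u + n3 * v + n4 * t + n5 * D) | n1 n2 n3 n4 n5. True}"

context
  fixes S A B C D y w z t v u
  assumes S: "unital_subring S" and H: "hnf S A B C D y w z t v u"
begin

lemma hnfD:
  "A > 0" "B > 0" "C > 0" "D > 0"
  "V 0 A y z u \<in> S" "V 0 0 B w v \<in> S" "V 0 0 0 C t \<in> S" "V 0 0 0 0 D \<in> S"
  "V 0 a b c d \<in> S \<Longrightarrow> A dvd a" "V 0 0 b c d \<in> S \<Longrightarrow> B dvd b" "V 0 0 0 c d \<in> S \<Longrightarrow> C dvd c"
  "V 0 0 0 0 d \<in> S \<Longrightarrow> D dvd d"
  using H unfolding hnf_def by blast+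

lemma hnf_decompose:
  assumes "V 0 a b c d \<in> S"
  shows "\<exists>n2 n3 n4 n5. a = n2 * A \<and> b = n2 * y + n3 * B \<and> c = n2 * z + n3 * w + n4 * C \<and>
    d = n2 * u + n3 * v + n4 * t + n5 * D"
proof -
  obtain n2 where n2: "a = n2 * A" using hnfD(9)[OF assms] by (metis dvdE mult.commute)
  have 1: "V 0 0 (b - n2 * y) (c - n2 * z) (d - n2 * u) \<in> S"
    using V_diff_scale[OF S assms hnfD(5), of n2] by (simp add: n2)
  obtain n3 where n3: "b - n2 * y = n3 * B" using hnfD(10)[OF 1] by (metis dvdE mult.commute)
  have 2: "V 0 0 0 (c - n2 * z - n3 * w) (d - n2 * u - n3 * v) \<in> S"
    using V_diff_scale[OF S 1 hnfD(6), of n3] by (simp add: n3)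
  obtain n4 where n4: "c - n2 * z - n3 * w = n4 * C" using hnfD(11)[OF 2] by (metis dvdE mult.commute)
  have 3: "V 0 0 0 0 (d - n2 * u - n3 * v - n4 * t) \<in> S"
    using V_diff_scale[OF S 2 hnfD(7), of n4] by (simp add: n4)
  obtain n5 where n5: "d - n2 * u - n3 * v - n4 * t = n5 * D" using hnfD(12)[OF 3] by (metis dvdE
      mult.commute)
  show ?thesis using n2 n3 n4 n5 by (intro exI[of _ n2] exI[of _ n3] exI[of _ n4] exI[of _ n5]) auto
qed

lemma hnf_combination:
  "V n1 (n1 + n2 * A) (n1 + n2 * y + n3 * B) (n1 + n2 * z + n3 * w + n4 * C)
     (n1 + n2 * u + n3 * v + n4 * t + n5 * D) \<in> S"
proof -
  note 1 = V_diff_scale[OF S V_const[OF S, of n1] hnfD(5), of "- n2"]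
  note 2 = V_diff_scale[OF S 1 hnfD(6), of "- n3"]
  note 3 = V_diff_scale[OF S 2 hnfD(7), of "- n4"]
  note 4 = V_diff_scale[OF S 3 hnfD(8), of "- n5"]
  show ?thesis using 4 by simp
qed

lemma hnf_span_eq: "S = hnf_span A B C D y w z t v u"
proof
  show "hnf_span A B C D y w z t v u \<subseteq> S"
    unfolding hnf_span_def using hnf_combination by blast
  show "S \<subseteq> hnf_span A B C D y w z t v u"
  proof
    fix x assume x: "x \<in> S"
    define n1 where "n1 = x $ i"
    have "V n1 (x $ j) (x $ k) (x $ l) (x $ e) \<in> S" using x V_eta[of x] by (simp add: n1_def)
    from V_diff_scale[OF S this V_const[OF S, of 1], of n1]
    have "V 0 (x $ j - n1) (x $ k - n1) (x $ l - n1) (x $ e - n1) \<in> S" by simp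
    from hnf_decompose[OF this] obtain n2 n3 n4 n5 where n: "x $ j - n1 = n2 * A"
      "x $ k - n1 = n2 * y + n3 * B" "x $ l - n1 = n2 * z + n3 * w + n4 * C"
      "x $ e - n1 = n2 * u + n3 * v + n4 * t + n5 * D" by blast
    have "x = V n1 (n1 + n2 * A) (n1 + n2 * y + n3 * B) (n1 + n2 * z + n3 * w + n4 * C)
        (n1 + n2 * u + n3 * v + n4 * t + n5 * D)"
      unfolding vec_eq_coords V_nth using n by (simp add: n1_def)
    thus "x \<in> hnf_span A B C D y w z t v u" unfolding hnf_span_def by blast
  qed
qed

lemma hnf_index: "has_index S (nat (A * B * C * D))"
proof -
  define T where "T = (\<lambda>(a, b, c, d). V 0 a b c d) ` ({0..<A} \<times> {0..<B} \<times> {0..<C} \<times> {0..<D})"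
  have inj: "inj_on (\<lambda>(a, b, c, d). V 0 a b c d) ({0..<A} \<times> {0..<B} \<times> {0..<C} \<times> {0..<D})"
    by (rule inj_onI) (auto simp: vec_eq_coords)
  have cT: "card T = nat (A * B * C * D)"
    unfolding T_def card_image[OF inj] using hnfD(1-4)
    by (simp add: card_cartesian_product nat_mult_distrib mult.assoc)
  have "has_index S (card T)"
  proof (rule has_index_transversal[OF S])
    show "finite T" by (simp add: T_def)
    fix x :: "int ^ 5"
    define n1 where "n1 = x $ i"
    define x2 where "x2 = x $ j - n1"
    define n2 where "n2 = x2 div A"
    define x3 where "x3 = x $ k - n1 - n2 * y"
    define n3 where "n3 = x3 div B"
    define x4 where "x4 = x $ l - n1 - n2 * z - n3 * w"
    define n4 where "n4 = x4 div C"
    define x5 where "x5 = x $ e - n1 - n2 * u - n3 * v - n4 * t"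
    define n5 where "n5 = x5 div D"
    define s where "s = V 0 (x2 mod A) (x3 mod B) (x4 mod C) (x5 mod D)"
    have sT: "s \<in> T" unfolding T_def s_def using hnfD(1-4)
      by (intro image_eqI[of _ _ "(x2 mod A, x3 mod B, x4 mod C, x5 mod D)"]) auto
    have mods: "x2 mod A = x2 - n2 * A" "x3 mod B = x3 - n3 * B" "x4 mod C = x4 - n4 * C" "x5 mod D = x5
        - n5 * D"
      by (simp_all add: n2_def n3_def n4_def n5_def minus_div_mult_eq_mod)
    have "x - s = V n1 (n1 + n2 * A) (n1 + n2 * y + n3 * B) (n1 + n2 * z + n3 * w + n4 * C)
     (n1 + n2 * u + n3 * v + n4 * t + n5 * D)"
      unfolding s_def mods vec_eq_coords by (simp add: n1_def x2_def x3_def x4_def x5_def)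
    thus "\<exists>t\<in>T. x - t \<in> S" using sT hnf_combination by metis
  next
    have small: "r = r'" if "m dvd r - r'" "0 \<le> r" "r < m" "0 \<le> r'" "r' < m" for r r' m :: int
      using that by (metis mod_eq_dvd_iff mod_pos_pos_trivial)
    fix s s' assume s: "s \<in> T" "s' \<in> T" "s - s' \<in> S"
    obtain a b c d where abcd: "s = V 0 a b c d" "0 \<le> a" "a < A" "0 \<le> b" "b < B" "0 \<le> c" "c < C" "0 \<le> d"
        "d < D"
      using s(1) unfolding T_def by auto
    obtain a' b' c' d' where abcd': "s' = V 0 a' b' c' d'" "0 \<le> a'" "a' < A" "0 \<le> b'" "b' < B" "0 \<le> c'"
        "c' < C" "0 \<le> d'" "d' < D"
      using s(2) unfolding T_def by auto
    have 1: "V 0 (a - a') (b - b') (c - c') (d - d') \<in> S" using s(3) by (simp add: abcd abcd' V_ops)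
    have a: "a = a'" using small[OF hnfD(9)[OF 1]] abcd abcd' by simp
    have 2: "V 0 0 (b - b') (c - c') (d - d') \<in> S" using 1 a by simp
    have b: "b = b'" using small[OF hnfD(10)[OF 2]] abcd abcd' by simp
    have 3: "V 0 0 0 (c - c') (d - d') \<in> S" using 2 b by simp
    have c: "c = c'" using small[OF hnfD(11)[OF 3]] abcd abcd' by simp
    have 4: "V 0 0 0 0 (d - d') \<in> S" using 3 c by simp
    have d: "d = d'" using small[OF hnfD(12)[OF 4]] abcd abcd' by simp
    show "s = s'" using a b c d abcd(1) abcd'(1) by simp
  qed
  thus ?thesis by (simp only: cT)
qed

text \<open>Lagrange's theorem for the quotient group, by back substitution: the multiples of the
  last four unit vectors by \<open>D\<close>, \<open>C * D\<close>, \<open>B * C * D\<close> and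
  \<open>A * B * C * D\<close> lie in \<open>S\<close> one after the other.\<close>

lemma hnf_index_scale: "(A * B * C * D) *s x \<in> S"
proof -
  have e5: "V 0 0 0 0 (n * D) \<in> S" for n using unital_subring_scale[OF S hnfD(8), of n] by (simp add: V_ops)
  have e4: "V 0 0 0 (n * (C * D)) 0 \<in> S" for n
  proof -
    have "V 0 0 0 (n * D * C) (n * D * t) \<in> S" using unital_subring_scale[OF S hnfD(7), of "n * D"] by
        (simp add: V_ops)
    from unital_subringD(2)[OF S this e5[of "n * t"]] show ?thesis by (simp add: V_ops algebra_simps)
  qed
  have e3: "V 0 0 (n * (B * C * D)) 0 0 \<in> S" for n
  proof -
    have "V 0 0 (n * C * D * B) (n * C * D * w) (n * C * D * v) \<in> S"
      using unital_subring_scale[OF S hnfD(6), of "n * C * D"] by (simp add: V_ops)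
    from unital_subringD(2)[OF S unital_subringD(2)[OF S this e5[of "n * C * v"]] e4[of "n * w"]]
    show ?thesis by (simp add: V_ops algebra_simps)
  qed
  have e2: "V 0 (n * (A * B * C * D)) 0 0 0 \<in> S" for n
  proof -
    have "V 0 (n * B * C * D * A) (n * B * C * D * y) (n * B * C * D * z) (n * B * C * D * u) \<in> S"
      using unital_subring_scale[OF S hnfD(5), of "n * B * C * D"] by (simp add: V_ops)
    from unital_subringD(2)[OF S unital_subringD(2)[OF S unital_subringD(2)[OF S this e5[of "n * B * C *
        u"]] e4[of "n * B * z"]] e3[of "n * y"]]
    show ?thesis by (simp add: V_ops algebra_simps)
  qed
  define N where "N = A * B * C * D"
  have "V (N * x $ i) (N * x $ i) (N * x $ i) (N * x $ i) (N * x $ i) \<in> S" by (rule V_const[OF S])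
  from unital_subringD(2)[OF S unital_subringD(2)[OF S unital_subringD(2)[OF S unital_subringD(2)[OF S this
      e2[of "x $ i - x $ j"]] e3[of "A * (x $ i - x $ k)"]] e4[of "A * B * (x $ i - x $ l)"]] e5[of "A *
          B * C * (x $ i - x $ e)"]]
  have "V (N * x $ i) (N * x $ j) (N * x $ k) (N * x $ l) (N * x $ e) \<in> S"
    by (simp add: V_ops N_def algebra_simps)
  thus ?thesis using V_ops(3)[of N "x $ i" "x $ j" "x $ k" "x $ l" "x $ e"] by (simp add: V_eta N_def)
qed

text \<open>Each diagonal entry divides \<open>m\<close>. The exponent is 4, not 5, because 1
  accounts for one of the five rows.\<close>

lemma hnf_index_dvd:
  assumes "\<And>x. m *s x \<in> S"
  shows "A * B * C * D dvd m ^ 4"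
proof -
  have "V 0 m 0 0 0 \<in> S" "V 0 0 m 0 0 \<in> S" "V 0 0 0 m 0 \<in> S" "V 0 0 0 0 m \<in> S"
    using assms[of "V 0 1 0 0 0"] assms[of "V 0 0 1 0 0"] assms[of "V 0 0 0 1 0"] assms[of "V 0 0 0 0 1"]
    by (simp_all add: V_ops)
  hence "A dvd m" "B dvd m" "C dvd m" "D dvd m" using hnfD(9-12) by blast+
  hence "A * B * C * D dvd m * m * m * m" by (intro mult_dvd_mono)
  thus ?thesis by (simp add: eval_nat_numeral mult.assoc)
qed

text \<open>Products of rows stay in \<open>S\<close>; they are reduced by lower rows until a
  divisibility clause of \<open>hnf\<close> applies. With \<open>r1\<close>, \<open>r2\<close>,
  \<open>r3\<close> for the rows led by \<open>A\<close>, \<open>B\<close>, \<open>C\<close>, the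
  products are \<open>r3 * r3\<close>, \<open>r3 * r2\<close>, \<open>r3 * r1\<close>,
  \<open>r2 * r2\<close> and \<open>r1 * r1\<close>. Necessary conditions are all that an upper
  bound asks for.\<close>

lemma hnf_congruences:
  "B dvd y * (y - A)" "D dvd t * (t - C)" "D dvd t * (v - w)" "D dvd t * (u - z)"
  "C dvd w\<^sup>2 - B * w" "D dvd v\<^sup>2 - B * v - (w\<^sup>2 - B * w) div C * t"
  "C dvd z\<^sup>2 - A * z - y * (y - A) div B * w"
  "D dvd u\<^sup>2 - A * u - y * (y - A) div B * v - (z\<^sup>2 - A * z - y * (y - A) div B * w) div C * t"
proof -
  have m: "V a b c d f \<in> S \<Longrightarrow> V a' b' c' d' f' \<in> S \<Longrightarrow> V (a * a') (b * b') (c * c') (d * d') (f * f') \<in> S"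
      for a b c d f a' b' c' d' f'
    using unital_subringD(3)[OF S] by (metis V_ops(2))
  have "V 0 0 0 0 (t * t - C * t) \<in> S"
    using V_diff_scale[OF S m[OF hnfD(7) hnfD(7)] hnfD(7), of C] by simp
  from hnfD(12)[OF this] show "D dvd t * (t - C)" by (simp add: algebra_simps)
  have "V 0 0 0 0 (t * v - w * t) \<in> S"
    using V_diff_scale[OF S m[OF hnfD(7) hnfD(6)] hnfD(7), of w] by (simp add: mult.commute)
  from hnfD(12)[OF this] show "D dvd t * (v - w)" by (simp add: algebra_simps)
  have "V 0 0 0 0 (t * u - z * t) \<in> S"
    using V_diff_scale[OF S m[OF hnfD(7) hnfD(5)] hnfD(7), of z] by (simp add: mult.commute)
  from hnfD(12)[OF this] show "D dvd t * (u - z)" by (simp add: algebra_simps)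
  have 1: "V 0 0 0 (w\<^sup>2 - B * w) (v\<^sup>2 - B * v) \<in> S"
    using V_diff_scale[OF S m[OF hnfD(6) hnfD(6)] hnfD(6), of B] by (simp add: power2_eq_square)
  from hnfD(11)[OF 1] show c1: "C dvd w\<^sup>2 - B * w" .
  have "V 0 0 0 0 (v\<^sup>2 - B * v - (w\<^sup>2 - B * w) div C * t) \<in> S"
    using V_diff_scale[OF S 1 hnfD(7), of "(w\<^sup>2 - B * w) div C"] c1 by simp
  from hnfD(12)[OF this] show "D dvd v\<^sup>2 - B * v - (w\<^sup>2 - B * w) div C * t" .
  have 2: "V 0 0 (y * (y - A)) (z\<^sup>2 - A * z) (u\<^sup>2 - A * u) \<in> S"
    using V_diff_scale[OF S m[OF hnfD(5) hnfD(5)] hnfD(5), of A] by (simp add: power2_eq_square algebra_simps)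
  from hnfD(10)[OF 2] show c2: "B dvd y * (y - A)" .
  have 3: "V 0 0 0 (z\<^sup>2 - A * z - y * (y - A) div B * w) (u\<^sup>2 - A * u - y * (y - A) div B * v) \<in> S"
    using V_diff_scale[OF S 2 hnfD(6), of "y * (y - A) div B"] c2 by simp
  from hnfD(11)[OF 3] show c3: "C dvd z\<^sup>2 - A * z - y * (y - A) div B * w" .
  have "V 0 0 0 0 (u\<^sup>2 - A * u - y * (y - A) div B * v - (z\<^sup>2 - A * z - y * (y - A) div B * w) div C * t) \<in> S"
    using V_diff_scale[OF S 3 hnfD(7), of "(z\<^sup>2 - A * z - y * (y - A) div B * w) div C"] c3 by simp
  from hnfD(12)[OF this]
  show "D dvd u\<^sup>2 - A * u - y * (y - A) div B * v - (z\<^sup>2 - A * z - y * (y - A) div B * w) div C * t" .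
qed

end

end

section \<open>Subrings of prime power index\<close>

definition rings_of_index :: "nat \<Rightarrow> (int ^ 5) set set" where
  "rings_of_index n = {S. unital_subring S \<and> has_index S n}"

lemma coordinates_extend:
  assumes "i \<noteq> j"
  obtains k l e where "coordinates i j k l e"
proof -
  have "card (UNIV - {i, j} :: 5 set) = 3" using assms by (subst card_Diff_subset) auto
  then obtain k l e where kle: "UNIV - {i, j} = {k, l, e}" "k \<noteq> l" "k \<noteq> e" "l \<noteq> e"
    unfolding card_3_iff by auto
  have "k \<in> UNIV - {i, j}" "l \<in> UNIV - {i, j}" "e \<in> UNIV - {i, j}" unfolding kle by auto
  hence "coordinates i j k l e" unfolding coordinates_def using assms kle(2-4) by auto
  thus ?thesis by (rule that)
qed

lemma coordinates_obtain:
  obtains i j k l e where "coordinates i j k l e"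
proof -
  have "(0::5) \<noteq> 1" by simp
  then obtain k l e where "coordinates 0 1 k l e" by (rule coordinates_extend)
  thus ?thesis by (rule that)
qed

lemma index_scale_mem:
  assumes S: "S \<in> rings_of_index n"
  shows "int n *s x \<in> S"
proof -
  have S1: "unital_subring S" "has_index S n" using S by (auto simp: rings_of_index_def)
  obtain i j k l e where c: "coordinates i j k l e" by (rule coordinates_obtain)
  interpret coordinates i j k l e by (rule c)
  obtain A B C D y w z t v u where H: "hnf S A B C D y w z t v u"
    using hnf_exists[OF S1(1)] S1(2) unfolding has_index_def by blast
  have "nat (A * B * C * D) = n" using has_index_unique[OF hnf_index[OF S1(1) H] S1(2)] .
  moreover have "A * B * C * D > 0" using hnfD(1-4)[OF S1(1) H] by simp
  ultimately have "A * B * C * D = int n" by linarith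
  thus ?thesis using hnf_index_scale[OF S1(1) H, of x] by simp
qed

text \<open>The vectors with entries in \<open>{0..<m}\<close> meet every coset, so the index is
  finite, and \<open>hnf_index_dvd\<close> applies.\<close>

lemma has_index_of_scale:
  assumes S: "unital_subring S" and m: "m > 0" "\<And>x. int m *s x \<in> S"
  shows "\<exists>N. has_index S N \<and> N dvd m ^ 4"
proof -
  obtain i j k l e where c: "coordinates i j k l e" by (rule coordinates_obtain)
  interpret coordinates i j k l e by (rule c)
  define T where "T = (\<lambda>(a, b, c, d, f). V a b c d f) `
    ({0..<int m} \<times> {0..<int m} \<times> {0..<int m} \<times> {0..<int m} \<times> {0..<int m})"
  have "finite T" by (simp add: T_def)
  moreover have "range (coset_of S) \<subseteq> coset_of S ` T"
  proof
    fix X assume "X \<in> range (coset_of S)"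
    then obtain x where x: "X = coset_of S x" by auto
    define s where "s = V (x $ i mod int m) (x $ j mod int m) (x $ k mod int m) (x $ l mod int m) (x $ e
        mod int m)"
    have "s \<in> T" unfolding T_def s_def using m
      by (intro image_eqI[of _ _ "(x $ i mod int m, x $ j mod int m, x $ k mod int m, x $ l mod int m, x
          $ e mod int m)"]) auto
    moreover have "x - s = int m *s V (x $ i div int m) (x $ j div int m) (x $ k div int m) (x $ l div
        int m) (x $ e div int m)"
      unfolding s_def vec_eq_coords by (simp add: minus_mod_eq_mult_div)
    hence "coset_of S x = coset_of S s" unfolding coset_of_eq_iff[OF S] using m by simp
    ultimately show "X \<in> coset_of S ` T" using x by blast
  qed
  ultimately have fin: "finite (range (coset_of S))" using finite_subset finite_imageI by metis
  obtain A B C D y w z t v u where H: "hnf S A B C D y w z t v u"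
    using hnf_exists[OF S fin] by blast
  have pos: "A * B * C * D > 0" using hnfD(1-4)[OF S H] by simp
  have "A * B * C * D dvd int m ^ 4" by (rule hnf_index_dvd[OF S H m(2)])
  hence "int (nat (A * B * C * D)) dvd int (m ^ 4)" using pos by simp
  hence "nat (A * B * C * D) dvd m ^ 4" by (simp only: of_nat_dvd_iff)
  thus ?thesis using hnf_index[OF S H] by blast
qed

lemma finite_rings_of_index: "finite (rings_of_index n)"
proof -
  obtain i j k l e where c: "coordinates i j k l e" by (rule coordinates_obtain)
  interpret coordinates i j k l e by (rule c)
  define X where "X = {0..int n}"
  have "rings_of_index n \<subseteq> (\<lambda>(A, B, C, D, y, w, z, t, v, u). hnf_span A B C D y w z t v u) `
     (X \<times> X \<times> X \<times> X \<times> X \<times> X \<times> X \<times> X \<times> X \<times> X)"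
  proof
    fix S assume "S \<in> rings_of_index n"
    hence S: "unital_subring S" "has_index S n" by (auto simp: rings_of_index_def)
    obtain A B C D y w z t v u where H: "hnf S A B C D y w z t v u"
      using hnf_exists[OF S(1)] S(2) unfolding has_index_def by blast
    note D = hnfD(1-4)[OF S(1) H]
    have "nat (A * B * C * D) = n" using has_index_unique[OF hnf_index[OF S(1) H] S(2)] .
    moreover have pos: "A * B * C * D > 0" using D by simp
    ultimately have n: "A * B * C * D = int n" by linarith
    have "A dvd int n" "B dvd int n" "C dvd int n" "D dvd int n" unfolding n[symmetric] by simp_all
    hence "A \<le> int n" "B \<le> int n" "C \<le> int n" "D \<le> int n" using pos n by (auto intro: zdvd_imp_le)
    moreover have "0 \<le> y" "y < B" "0 \<le> w" "w < C" "0 \<le> z" "z < C" "0 \<le> t" "t < D" "0 \<le> v" "v < D" "0 \<le> u"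
        "u < D"
      using H unfolding hnf_def by auto
    ultimately have "(A, B, C, D, y, w, z, t, v, u) \<in> X \<times> X \<times> X \<times> X \<times> X \<times> X \<times> X \<times> X \<times> X \<times> X"
      unfolding X_def using D by auto
    thus "S \<in> (\<lambda>(A, B, C, D, y, w, z, t, v, u). hnf_span A B C D y w z t v u) `
       (X \<times> X \<times> X \<times> X \<times> X \<times> X \<times> X \<times> X \<times> X \<times> X)"
      by (rule rev_image_eqI) (simp add: hnf_span_eq[OF S(1) H])
  qed
  moreover have "finite (X \<times> X \<times> X \<times> X \<times> X \<times> X \<times> X \<times> X \<times> X \<times> X)"
    unfolding X_def by (intro finite_cartesian_product) auto
  ultimately show ?thesis using finite_subset finite_imageI by blast
qed

lemma pos_dvd_prime_power:
  fixes A :: int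
  assumes "prime p" "A > 0" "A dvd int p ^ k"
  obtains a where "A = int p ^ a"
proof -
  have "int (nat A) dvd int (p ^ k)" using assms by simp
  hence "nat A dvd p ^ k" by (simp only: of_nat_dvd_iff)
  then obtain a where "nat A = p ^ a" using divides_primepow_nat[OF assms(1)] by blast
  hence "A = int p ^ a" using assms(2) by (metis int_nat_eq of_nat_power less_imp_le)
  thus ?thesis by (rule that)
qed

text \<open>With \<open>i\<close> and \<open>j\<close> in the first two places, the congruence
  applied to the row led by \<open>A\<close> shows that \<open>p\<close> divides \<open>A\<close>.
  The ring is recovered from its normal form by \<open>hnf_span\<close>, and the exponent of
  \<open>A\<close> from \<open>b\<close>, \<open>c\<close>, \<open>d\<close>, since all four add up
  to \<open>k0\<close>. The at most \<open>(k0 + 1) ^ 3\<close> triples raise the exponent of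
  \<open>k0 + 1\<close> from 5 to 8.\<close>

lemma card_congruent_rings_le:
  assumes p: "prime p" and ij: "i \<noteq> j" and k0: "k0 \<ge> 1"
  shows "card {S \<in> rings_of_index (p ^ k0). \<forall>x\<in>S. int p dvd x $ i - x $ j}
     \<le> 32 * (k0 + 1) ^ 8 * p ^ (19 * (k0 - 1) div 20)"
proof -
  obtain k l e where c: "coordinates i j k l e" using coordinates_extend[OF ij] .
  interpret coordinates i j k l e by (rule c)
  have p1: "p > 1" using p prime_gt_1_nat by blast
  define I where "I = {(b, c, d) \<in> {..k0} \<times> {..k0} \<times> {..k0}. b + c + d \<le> k0 - 1}"
  define F where "F = (\<lambda>(b, c, d). (\<lambda>(y, w, z, t, v, u).
      hnf_span (int p ^ (k0 - (b + c + d))) (int p ^ b) (int p ^ c) (int p ^ d) y w z t v u) `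
      ring_tuples p (int p ^ (k0 - (b + c + d))) b c d)"
  have finI: "finite I" unfolding I_def by (rule finite_subset[of _ "{..k0} \<times> {..k0} \<times> {..k0}"]) auto
  have "{S \<in> rings_of_index (p ^ k0). \<forall>x\<in>S. int p dvd x $ i - x $ j} \<subseteq> (\<Union>q\<in>I. F q)"
  proof safe
    fix S assume S0: "S \<in> rings_of_index (p ^ k0)" and cong: "\<forall>x\<in>S. int p dvd x $ i - x $ j"
    have S: "unital_subring S" "has_index S (p ^ k0)" using S0 by (auto simp: rings_of_index_def)
    obtain A B C D y w z t v u where H: "hnf S A B C D y w z t v u"
      using hnf_exists[OF S(1)] S(2) unfolding has_index_def by blast
    note D = hnfD(1-4)[OF S(1) H]
    have "nat (A * B * C * D) = p ^ k0" using has_index_unique[OF hnf_index[OF S(1) H] S(2)] .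
    moreover have pos: "A * B * C * D > 0" using D by simp
    ultimately have n: "A * B * C * D = int p ^ k0" by (metis int_nat_eq of_nat_power less_imp_le)
    have dv: "A dvd int p ^ k0" "B dvd int p ^ k0" "C dvd int p ^ k0" "D dvd int p ^ k0"
      unfolding n[symmetric] by simp_all
    obtain a where a: "A = int p ^ a" using pos_dvd_prime_power[OF p D(1) dv(1)] .
    obtain b where b: "B = int p ^ b" using pos_dvd_prime_power[OF p D(2) dv(2)] .
    obtain c where c: "C = int p ^ c" using pos_dvd_prime_power[OF p D(3) dv(3)] .
    obtain d where d: "D = int p ^ d" using pos_dvd_prime_power[OF p D(4) dv(4)] .
    have "int p ^ (a + b + c + d) = int p ^ k0" using n unfolding a b c d by (simp add: power_add)
    hence sum: "a + b + c + d = k0" using p1 by simp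
    have "int p dvd V 0 A y z u $ i - V 0 A y z u $ j" using cong hnfD(5)[OF S(1) H] by blast
    hence "int p dvd int p ^ a" by (simp add: a)
    hence "a \<noteq> 0" using p1 by (intro notI) auto
    hence bcd: "(b, c, d) \<in> I" and ae: "a = k0 - (b + c + d)" unfolding I_def using sum by auto
    have "(y, w, z, t, v, u) \<in> ring_tuples p A b c d"
      using hnf_congruences[OF S(1) H] H unfolding ring_tuples_def hnf_def b c d by simp
    hence "S \<in> F (b, c, d)"
      unfolding F_def using hnf_span_eq[OF S(1) H] unfolding a b c d ae by (auto intro!: rev_image_eqI)
    thus "S \<in> (\<Union>q\<in>I. F q)" using bcd by blast
  qed
  moreover have finF: "finite (F q)" for q unfolding F_def by (auto simp: case_prod_unfold intro!:
      finite_ring_tuples finite_imageI)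
  ultimately have "card {S \<in> rings_of_index (p ^ k0). \<forall>x\<in>S. int p dvd x $ i - x $ j} \<le> card (\<Union>q\<in>I. F q)"
    using finI by (intro card_mono) auto
  also have "\<dots> \<le> (\<Sum>q\<in>I. card (F q))" by (rule card_UN_le[OF finI])
  also have "\<dots> \<le> (\<Sum>q\<in>I. 32 * (k0 + 1) ^ 5 * p ^ (19 * (k0 - 1) div 20))"
  proof (rule sum_mono)
    fix q assume "q \<in> I"
    then obtain b c d where q: "q = (b, c, d)" "b + c + d \<le> k0 - 1" unfolding I_def by auto
    have "card (F q) \<le> card (ring_tuples p (int p ^ (k0 - (b + c + d))) b c d)"
      unfolding F_def q by (simp add: card_image_le finite_ring_tuples)
    also have "\<dots> \<le> 32 * (1 + (b + c + d)) ^ 5 * p ^ (19 * (b + c + d) div 20)" by (rule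
        card_ring_tuples_le[OF p])
    also have "\<dots> \<le> 32 * (k0 + 1) ^ 5 * p ^ (19 * (k0 - 1) div 20)"
      using q(2) p1 by (intro mult_mono mult_left_mono power_mono power_increasing div_le_mono) auto
    finally show "card (F q) \<le> 32 * (k0 + 1) ^ 5 * p ^ (19 * (k0 - 1) div 20)" .
  qed
  also have "\<dots> = card I * (32 * (k0 + 1) ^ 5 * p ^ (19 * (k0 - 1) div 20))" by simp
  also have "card I \<le> card ({..k0} \<times> {..k0} \<times> {..k0})" unfolding I_def by (intro card_mono) auto
  also have "card ({..k0} \<times> {..k0} \<times> {..k0}) = (k0 + 1) ^ 3" by (simp add: card_cartesian_product
      power3_eq_cube)
  also have "(k0 + 1) ^ 3 * (32 * (k0 + 1) ^ 5 * p ^ (19 * (k0 - 1) div 20)) = 32 * (k0 + 1) ^ 8 * p ^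
      (19 * (k0 - 1) div 20)"
    by (simp add: power_add[symmetric] flip: mult.assoc)
  finally show ?thesis by simp
qed

lemma has_index_UNIV: "has_index UNIV 1"
proof -
  have "coset_of UNIV = (\<lambda>_. UNIV)" by (auto simp: coset_of_def)
  thus ?thesis by (simp add: has_index_def)
qed

lemma rings_of_index_1: "rings_of_index 1 = {UNIV}"
proof
  show "rings_of_index 1 \<subseteq> {UNIV}"
  proof
    fix S assume S: "S \<in> rings_of_index 1"
    have "x \<in> S" for x using index_scale_mem[OF S, of x] by simp
    thus "S \<in> {UNIV}" by blast
  qed
  show "{UNIV} \<subseteq> rings_of_index 1" using has_index_UNIV by (simp add: rings_of_index_def unital_subring_def)
qed

text \<open>If no two coordinates are congruent on all of \<open>S\<close>, then for any distinct
  \<open>i\<close>, \<open>j\<close> some element vanishes at \<open>j\<close> and is prime to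
  \<open>p\<close> at \<open>i\<close>. The product over the four \<open>j\<close> is a multiple of
  the unit vector at \<open>i\<close> by a number prime to \<open>p\<close>. Its multiple by the
  index, a power of \<open>p\<close>, lies in \<open>S\<close> too, so Bezout puts the unit vector
  into \<open>S\<close>. Then \<open>S\<close> is everything and has index 1.\<close>

lemma congruent_pair_exists:
  assumes p: "prime p" and S0: "S \<in> rings_of_index (p ^ n)" and n: "n \<ge> 1"
  shows "\<exists>i j. i \<noteq> j \<and> (\<forall>x\<in>S. int p dvd x $ i - x $ j)"
proof (rule ccontr)
  assume neg: "\<not> ?thesis"
  have S: "unital_subring S" "has_index S (p ^ n)" using S0 by (auto simp: rings_of_index_def)
  have pp: "prime (int p)" using p by simp
  have ex: "\<exists>y\<in>S. y $ j = 0 \<and> \<not> int p dvd y $ i" if "i \<noteq> j" for i j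
  proof -
    obtain x where x: "x \<in> S" "\<not> int p dvd x $ i - x $ j" using neg \<open>i \<noteq> j\<close> by blast
    have "x - (x $ j) *s 1 \<in> S"
      by (intro unital_subringD(2)[OF S(1) x(1)] unital_subring_scale[OF S(1)] unital_subringD(1)[OF S(1)])
    thus ?thesis using x(2) by (intro bexI[of _ "x - (x $ j) *s 1"]) auto
  qed
  have ax: "axis i 1 \<in> S" for i
  proof -
    obtain j where "i \<noteq> j" using neg_equal_zero coordinates_obtain
      by (metis coordinates_def distinct_length_2_or_more)
    then obtain k l e where c: "coordinates i j k l e" by (rule coordinates_extend)
    interpret coordinates i j k l e by (rule c)
    have d: "i \<noteq> j" "i \<noteq> k" "i \<noteq> l" "i \<noteq> e" using dist by auto
    obtain y1 where y1: "y1 \<in> S" "y1 $ j = 0" "\<not> int p dvd y1 $ i" using ex[OF d(1)] by blast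
    obtain y2 where y2: "y2 \<in> S" "y2 $ k = 0" "\<not> int p dvd y2 $ i" using ex[OF d(2)] by blast
    obtain y3 where y3: "y3 \<in> S" "y3 $ l = 0" "\<not> int p dvd y3 $ i" using ex[OF d(3)] by blast
    obtain y4 where y4: "y4 \<in> S" "y4 $ e = 0" "\<not> int p dvd y4 $ i" using ex[OF d(4)] by blast
    define m where "m = y1 $ i * y2 $ i * y3 $ i * y4 $ i"
    have axV: "axis i 1 = V 1 0 0 0 0" unfolding vec_eq_coords using d by (simp add: axis_def)
    have "y1 * y2 * y3 * y4 \<in> S" using y1 y2 y3 y4 by (intro unital_subringD(3)[OF S(1)])
    also have "y1 * y2 * y3 * y4 = m *s axis i 1" unfolding axV vec_eq_coords using y1 y2 y3 y4 by (simp
        add: m_def)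
    finally have 1: "m *s axis i 1 \<in> S" .
    have "\<not> int p dvd m" unfolding m_def using y1 y2 y3 y4 pp by (simp add: prime_dvd_mult_iff)
    hence "coprime (int p ^ n) m" using pp by (simp add: prime_imp_coprime)
    then obtain r s where rs: "r * int p ^ n + s * m = 1" using bezout_int[of "int p ^ n" m] by (auto
        simp: coprime_iff_gcd_eq_1)
    have "r *s (int (p ^ n) *s axis i 1) + s *s (m *s axis i 1) \<in> S"
      by (intro unital_subringD(6)[OF S(1)] unital_subring_scale[OF S(1)] index_scale_mem[OF S0] 1)
    also have "r *s (int (p ^ n) *s axis i 1) + s *s (m *s axis i 1) = (r * int p ^ n + s * m) *s axis i 1"
      by (simp add: vector_smult_assoc vector_sadd_rdistrib)
    finally show ?thesis by (simp add: rs)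
  qed
  have "S = UNIV"
  proof safe
    fix x :: "int ^ 5"
    obtain i j k l e where c: "coordinates i j k l e" by (rule coordinates_obtain)
    interpret coordinates i j k l e by (rule c)
    have "x $ i *s axis i 1 + x $ j *s axis j 1 + x $ k *s axis k 1 + x $ l *s axis l 1 + x $ e *s axis e
        1 \<in> S"
      by (intro unital_subringD(6)[OF S(1)] unital_subring_scale[OF S(1)] ax)
    also have "x $ i *s axis i 1 + x $ j *s axis j 1 + x $ k *s axis k 1 + x $ l *s axis l 1 + x $ e *s
        axis e 1 = x"
      unfolding vec_eq_coords using dist by (auto simp: axis_def)
    finally show "x \<in> S" .
  qed simp
  hence "p ^ n = 1" using S(2) has_index_UNIV has_index_unique by blast
  thus False using n prime_gt_1_nat[OF p] by simp
qed

text \<open>The constant is 800 = 25 * 32, with 25 bounding the number of ordered pairs of distinct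
  coordinates.\<close>

lemma card_rings_prime_power_le:
  assumes p: "prime p"
  shows "card (rings_of_index (p ^ k)) \<le> 800 * (1 + k) ^ 8 * p ^ (19 * (k - 1) div 20)"
proof (cases "k = 0")
  case True
  have "card (rings_of_index 1) = 1" by (simp add: rings_of_index_1 del: One_nat_def)
  thus ?thesis using True by simp
next
  case False
  hence k: "k \<ge> 1" by simp
  define K where "K = 32 * (k + 1) ^ 8 * p ^ (19 * (k - 1) div 20)"
  define R where "R = (\<lambda>(i, j). {S \<in> rings_of_index (p ^ k). \<forall>x\<in>S. int p dvd x $ i - x $ j})"
  define I where "I = {q :: 5 \<times> 5. fst q \<noteq> snd q}"
  have "rings_of_index (p ^ k) \<subseteq> (\<Union>q\<in>I. R q)"
    unfolding R_def I_def using congruent_pair_exists[OF p _ k] by fastforce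
  moreover have "finite (R q)" for q unfolding R_def using finite_rings_of_index by (cases q) auto
  ultimately have "card (rings_of_index (p ^ k)) \<le> card (\<Union>q\<in>I. R q)" by (intro card_mono) auto
  also have "\<dots> \<le> (\<Sum>q\<in>I. card (R q))" by (rule card_UN_le) simp
  also have "\<dots> \<le> (\<Sum>q\<in>I. K)"
    unfolding R_def K_def I_def using card_congruent_rings_le[OF p _ k] by (intro sum_mono) auto
  also have "\<dots> = card I * K" by simp
  also have "\<dots> \<le> 25 * K"
  proof -
    have "card I \<le> card (UNIV :: (5 \<times> 5) set)" by (intro card_mono) auto
    also have "\<dots> = 25" by (simp add: card_cartesian_product flip: UNIV_Times_UNIV)
    finally show ?thesis by simp
  qed
  finally show ?thesis by (simp add: K_def add.commute)
qed

section \<open>The counting function\<close>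

definition congruence_ring :: "nat \<Rightarrow> 5 set \<Rightarrow> (int ^ 5) set" where
  "congruence_ring p A = {x. \<forall>i\<in>A. \<forall>j\<in>A. int p dvd x $ i - x $ j}"

lemma congruence_ring_unital: "unital_subring (congruence_ring p A)"
  unfolding unital_subring_def
proof (intro conjI ballI)
  show "1 \<in> congruence_ring p A" by (simp add: congruence_ring_def)
  fix x y assume xy: "x \<in> congruence_ring p A" "y \<in> congruence_ring p A"
  show "x - y \<in> congruence_ring p A"
    unfolding congruence_ring_def
  proof (intro CollectI ballI)
    fix i j assume ij: "i \<in> A" "j \<in> A"
    have eq: "(x - y) $ i - (x - y) $ j = (x $ i - x $ j) - (y $ i - y $ j)" by simp
    show "int p dvd (x - y) $ i - (x - y) $ j"
      unfolding eq by (rule dvd_diff) (use xy ij in \<open>auto simp: congruence_ring_def\<close>)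
  qed
  show "x * y \<in> congruence_ring p A"
    unfolding congruence_ring_def
  proof (intro CollectI ballI)
    fix i j assume ij: "i \<in> A" "j \<in> A"
    have eq: "(x * y) $ i - (x * y) $ j = (x $ i - x $ j) * y $ i + x $ j * (y $ i - y $ j)" by (simp
        add: algebra_simps)
    have "int p dvd x $ i - x $ j" "int p dvd y $ i - y $ j" using xy ij by (auto simp: congruence_ring_def)
    thus "int p dvd (x * y) $ i - (x * y) $ j" unfolding eq by (intro dvd_add dvd_mult dvd_mult2)
  qed
qed

lemma congruence_ring_pair_iff: "x \<in> congruence_ring p {i, j} \<longleftrightarrow> int p dvd x $ i - x $ j"
  unfolding congruence_ring_def by (auto simp: dvd_diff_commute)

lemma congruence_ring_index:
  assumes p: "p > 0" and ij: "i \<noteq> j"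
  shows "has_index (congruence_ring p {i, j}) p"
proof -
  define T :: "(int ^ 5) set" where "T = (\<lambda>a. axis j a) ` {0..<int p}"
  have nth: "axis j a $ j = a" "axis j a $ i = 0" for a :: int using ij by (auto simp: axis_def)
  have inj: "inj_on (\<lambda>a::int. axis j a) {0..<int p}" by (rule inj_onI) (metis nth(1))
  have "has_index (congruence_ring p {i, j}) (card T)"
  proof (rule has_index_transversal[OF congruence_ring_unital])
    show "finite T" by (simp add: T_def)
    fix x :: "int ^ 5"
    define a where "a = (x $ j - x $ i) mod int p"
    have "axis j a \<in> T" unfolding T_def a_def using p by auto
    moreover have "int p dvd (x $ j - x $ i) - a" unfolding a_def by simp
    hence "x - axis j a \<in> congruence_ring p {i, j}"
      unfolding congruence_ring_pair_iff by (simp add: nth dvd_diff_commute algebra_simps)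
    ultimately show "\<exists>t\<in>T. x - t \<in> congruence_ring p {i, j}" by blast
  next
    fix t t' assume t: "t \<in> T" "t' \<in> T" "t - t' \<in> congruence_ring p {i, j}"
    obtain a a' where a: "t = axis j a" "t' = axis j a'" "0 \<le> a" "a < int p" "0 \<le> a'" "a' < int p"
      using t unfolding T_def by auto
    have "int p dvd a - a'" using t(3) unfolding congruence_ring_pair_iff a by (simp add: nth
        dvd_diff_commute)
    hence "a = a'" using a by (metis mod_eq_dvd_iff mod_pos_pos_trivial)
    thus "t = t'" using a by simp
  qed
  moreover have "card T = p" unfolding T_def card_image[OF inj] by simp
  ultimately show ?thesis by simp
qed

text \<open>A subring of index \<open>p\<close> lies in the congruence ring of some pair of
  coordinates, which has the same index, so they coincide. Different pairs give different rings,
  because a unit vector at an index outside one pair belongs to that ring only. The number is 5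
  choose 2.\<close>

lemma card_rings_prime:
  assumes p: "prime p"
  shows "card (rings_of_index p) = 10"
proof -
  have p0: "p > 0" "p > 1" using p prime_gt_0_nat prime_gt_1_nat by auto
  have "rings_of_index p = congruence_ring p ` {A. A \<subseteq> UNIV \<and> card A = 2}"
  proof safe
    fix S assume S: "S \<in> rings_of_index p"
    have "S \<in> rings_of_index (p ^ 1)" using S by simp
    then obtain i j where ij: "i \<noteq> j" "\<forall>x\<in>S. int p dvd x $ i - x $ j"
      using congruent_pair_exists[OF p] by blast
    have "S = congruence_ring p {i, j}"
    proof (rule has_index_subset_eq)
      show "S \<subseteq> congruence_ring p {i, j}" using ij(2) congruence_ring_pair_iff by blast
    qed (use S congruence_ring_unital congruence_ring_index[OF p0(1) ij(1)] in \<open>auto simp: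
        rings_of_index_def\<close>)
    thus "S \<in> congruence_ring p ` {A. A \<subseteq> UNIV \<and> card A = 2}" using ij(1) by auto
  next
    fix A :: "5 set" assume "card A = 2"
    then obtain i j where "A = {i, j}" "i \<noteq> j" by (auto simp: card_2_iff)
    thus "congruence_ring p A \<in> rings_of_index p"
      using congruence_ring_unital congruence_ring_index[OF p0(1)] by (auto simp: rings_of_index_def)
  qed
  moreover have "inj_on (congruence_ring p) {A. A \<subseteq> UNIV \<and> card A = 2}"
  proof (rule inj_onI)
    fix A A' :: "5 set" assume A: "A \<in> {A. A \<subseteq> UNIV \<and> card A = 2}" "A' \<in> {A. A \<subseteq> UNIV \<and> card A = 2}"
      and eq: "congruence_ring p A = congruence_ring p A'"
    show "A = A'"
    proof (rule card_subset_eq)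
      show "A \<subseteq> A'"
      proof (rule ccontr)
        assume "\<not> A \<subseteq> A'"
        then obtain i where i: "i \<in> A" "i \<notin> A'" by blast
        obtain j where j: "j \<in> A" "j \<noteq> i" using A(1) i(1) by (auto simp: card_2_iff)
        have "axis i 1 $ m = (0::int)" if "m \<in> A'" for m using that i(2) by (auto simp: axis_def)
        hence "axis i 1 \<in> congruence_ring p A'" unfolding congruence_ring_def by simp
        hence "axis i 1 \<in> congruence_ring p A" using eq by simp
        hence "int p dvd axis i 1 $ i - axis i 1 $ j" unfolding congruence_ring_def using i(1) j(1) by blast
        hence "int p dvd 1" using j(2) by (simp add: axis_def)
        thus False using p0 by simp
      qed
    qed (use A in auto)
  qed
  ultimately have "card (rings_of_index p) = card {A :: 5 set. A \<subseteq> UNIV \<and> card A = 2}" by (simp add: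
      card_image)
  also have "\<dots> = card (UNIV :: 5 set) choose 2" by (rule n_subsets) simp
  also have "\<dots> = 10" by (simp add: choose_two)
  finally show ?thesis .
qed

section \<open>Multiplicativity of the number of subrings\<close>

definition add_multiples :: "(int ^ 5) set \<Rightarrow> nat \<Rightarrow> (int ^ 5) set" where
  "add_multiples S m = {s + int m *s x | s x. s \<in> S}"

lemma add_multiples_unital:
  assumes S: "unital_subring S"
  shows "unital_subring (add_multiples S m)"
  unfolding unital_subring_def
proof (intro conjI ballI)
  have "1 = 1 + int m *s 0" by simp
  thus "1 \<in> add_multiples S m" unfolding add_multiples_def using unital_subringD(1)[OF S] by blast
  fix x y assume "x \<in> add_multiples S m" "y \<in> add_multiples S m"
  then obtain s a s' a' where xy: "x = s + int m *s a" "y = s' + int m *s a'" "s \<in> S" "s' \<in> S"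
    unfolding add_multiples_def by blast
  have "x - y = (s - s') + int m *s (a - a')" by (simp add: xy vec_eq_iff algebra_simps)
  thus "x - y \<in> add_multiples S m" unfolding add_multiples_def using unital_subringD(2)[OF S xy(3,4)] by blast
  have "x * y = s * s' + int m *s (s * a' + a * s' + int m *s (a * a'))" by (simp add: xy vec_eq_iff
      algebra_simps)
  thus "x * y \<in> add_multiples S m" unfolding add_multiples_def using unital_subringD(3)[OF S xy(3,4)] by blast
qed

lemma add_multiples_scale: "unital_subring S \<Longrightarrow> int m *s x \<in> add_multiples S m"
  unfolding add_multiples_def using unital_subringD(4)[of S] by (intro CollectI exI[of _ 0] exI[of _ x]) simp

lemma subset_add_multiples: "S \<subseteq> add_multiples S m"
proof
  fix s assume "s \<in> S"
  moreover have "s = s + int m *s 0" by simp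
  ultimately show "s \<in> add_multiples S m" unfolding add_multiples_def by blast
qed

lemma unital_subring_Int: "unital_subring S \<Longrightarrow> unital_subring S' \<Longrightarrow> unital_subring (S \<inter> S')"
  unfolding unital_subring_def by blast

text \<open>Chinese remainder theorem: any coset of \<open>S\<close> and any coset of
  \<open>S'\<close> have a common element, and they intersect in exactly one coset of
  \<open>S \<inter> S'\<close>.\<close>

lemma has_index_Int:
  assumes S: "unital_subring S" "has_index S a" "\<And>x. int m *s x \<in> S"
    and S': "unital_subring S'" "has_index S' b" "\<And>x. int n *s x \<in> S'"
    and mn: "coprime m n"
  shows "has_index (S \<inter> S') (a * b)"
proof -
  note I = unital_subring_Int[OF S(1) S'(1)]
  have "coprime (int m) (int n)" using mn by simp
  then obtain r s where rs: "r * int m + s * int n = 1"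
    using bezout_int[of "int m" "int n"] by (auto simp: coprime_iff_gcd_eq_1)
  have int: "coset_of (S \<inter> S') x = coset_of S x \<inter> coset_of S' x" for x by (auto simp: coset_of_def)
  have crt: "\<exists>x. coset_of S x = coset_of S c \<and> coset_of S' x = coset_of S' d" for c d
  proof (intro exI conjI)
    define x where "x = (s * int n) *s c + (r * int m) *s d"
    have r1: "r * int m = 1 - s * int n" and r2: "s * int n = 1 - r * int m" using rs by auto
    have "x - c = int m *s (r *s (d - c))"
      unfolding x_def r2 by (simp add: vec_eq_iff algebra_simps)
    thus "coset_of S ((s * int n) *s c + (r * int m) *s d) = coset_of S c"
      unfolding coset_of_eq_iff[OF S(1)] x_def[symmetric] by (simp only: S(3))
    have "x - d = int n *s (s *s (c - d))"
      unfolding x_def r1 by (simp add: vec_eq_iff algebra_simps)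
    thus "coset_of S' ((s * int n) *s c + (r * int m) *s d) = coset_of S' d"
      unfolding coset_of_eq_iff[OF S'(1)] x_def[symmetric] by (simp only: S'(3))
  qed
  define g where "g = (\<lambda>(X :: (int ^ 5) set, Y). X \<inter> Y)"
  have self: "x \<in> coset_of S x" "x \<in> coset_of S' x" for x
    using unital_subringD(4)[OF S(1)] unital_subringD(4)[OF S'(1)] by (simp_all add: coset_of_def)
  have im: "g ` (range (coset_of S) \<times> range (coset_of S')) = range (coset_of (S \<inter> S'))"
  proof safe
    fix c d
    obtain x where "coset_of S x = coset_of S c" "coset_of S' x = coset_of S' d" using crt by blast
    hence "g (coset_of S c, coset_of S' d) = coset_of (S \<inter> S') x" by (simp add: g_def int)
    thus "g (coset_of S c, coset_of S' d) \<in> range (coset_of (S \<inter> S'))" by simp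
  next
    fix x
    have "coset_of (S \<inter> S') x = g (coset_of S x, coset_of S' x)" by (simp add: g_def int)
    thus "coset_of (S \<inter> S') x \<in> g ` (range (coset_of S) \<times> range (coset_of S'))" by blast
  qed
  have inj: "inj_on g (range (coset_of S) \<times> range (coset_of S'))"
  proof (rule inj_onI, clarify)
    fix c d c' d' assume eq: "g (coset_of S c, coset_of S' d) = g (coset_of S c', coset_of S' d')"
    obtain x where x: "coset_of S x = coset_of S c" "coset_of S' x = coset_of S' d" using crt by blast
    have "x \<in> coset_of S c \<inter> coset_of S' d" using self[of x] x by simp
    hence "x \<in> coset_of S c'" "x \<in> coset_of S' d'" using eq by (auto simp: g_def)
    hence "coset_of S x = coset_of S c'" "coset_of S' x = coset_of S' d'"
      unfolding coset_of_eq_iff[OF S(1)] coset_of_eq_iff[OF S'(1)] by (simp_all add: coset_of_def)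
    thus "coset_of S c = coset_of S c' \<and> coset_of S' d = coset_of S' d'" using x by simp
  qed
  have fin: "finite (range (coset_of S) \<times> range (coset_of S'))"
    using S(2) S'(2) by (intro finite_cartesian_product) (auto simp: has_index_def)
  show ?thesis
    unfolding has_index_def im[symmetric] card_image[OF inj] card_cartesian_product
    using fin S(2) S'(2) by (auto simp: has_index_def)
qed

text \<open>The ring of index \<open>m * n\<close> corresponds to the pair formed by adding the
  multiples of \<open>m\<close> and the multiples of \<open>n\<close> to it; intersection is the
  inverse. Both directions rest on writing \<open>x\<close> as
  \<open>(r * m) *s x + (s * n) *s x\<close> with \<open>r * m + s * n = 1\<close>.\<close>

lemma card_rings_mult:
  assumes mn: "m > 0" "n > 0" "coprime m n"
  shows "card (rings_of_index (m * n)) = card (rings_of_index m) * card (rings_of_index n)"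
proof -
  have "coprime (int m) (int n)" using mn by simp
  then obtain r s where rs: "r * int m + s * int n = 1"
    using bezout_int[of "int m" "int n"] by (auto simp: coprime_iff_gcd_eq_1)
  have split: "x = (r * int m) *s x + (s * int n) *s x" for x :: "int ^ 5"
    unfolding vector_sadd_rdistrib[symmetric] rs by simp
  have "bij_betw (\<lambda>S. (add_multiples S m, add_multiples S n)) (rings_of_index (m * n)) (rings_of_index m
      \<times> rings_of_index n)"
  proof (rule bij_betw_byWitness[where f' = "\<lambda>(S, S'). S \<inter> S'"])
    have key: "add_multiples S m \<inter> add_multiples S n = S" if S0: "S \<in> rings_of_index (m * n)" for S
    proof
      have S: "unital_subring S" using S0 by (simp add: rings_of_index_def)
      show "S \<subseteq> add_multiples S m \<inter> add_multiples S n" using subset_add_multiples by blast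
      show "add_multiples S m \<inter> add_multiples S n \<subseteq> S"
      proof
        fix x assume "x \<in> add_multiples S m \<inter> add_multiples S n"
        then obtain a c a' c' where x: "x = a + int m *s c" "x = a' + int n *s c'" "a \<in> S" "a' \<in> S"
          unfolding add_multiples_def by blast
        have "(r * int m) *s x + (s * int n) *s x = (r * int m) *s (a' + int n *s c') + (s * int n) *s (a
            + int m *s c)"
          using x by metis
        also have "\<dots> = (r * int m) *s a' + (s * int n) *s a + int (m * n) *s (r *s c' + s *s c)"
          by (simp add: vec_eq_iff algebra_simps)
        also have "\<dots> \<in> S"
          by (intro unital_subringD(6)[OF S] unital_subring_scale[OF S] index_scale_mem[OF S0] x)
        finally show "x \<in> S" using split[of x] by simp
      qed
    qed
    show "\<forall>S\<in>rings_of_index (m * n). (\<lambda>(S, S'). S \<inter> S') (add_multiples S m, add_multiples S n) = S"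
      using key by simp
    show "(\<lambda>S. (add_multiples S m, add_multiples S n)) ` rings_of_index (m * n) \<subseteq> rings_of_index m \<times>
        rings_of_index n"
    proof
      fix q assume "q \<in> (\<lambda>S. (add_multiples S m, add_multiples S n)) ` rings_of_index (m * n)"
      then obtain S where S0: "S \<in> rings_of_index (m * n)" and q: "q = (add_multiples S m, add_multiples
          S n)" by auto
      have S: "unital_subring S" "has_index S (m * n)" using S0 by (auto simp: rings_of_index_def)
      note U = add_multiples_unital[OF S(1)] and sc = add_multiples_scale[OF S(1)]
      obtain a where a: "has_index (add_multiples S m) a" "a dvd m ^ 4"
        using has_index_of_scale[OF U mn(1) sc] by blast
      obtain b where b: "has_index (add_multiples S n) b" "b dvd n ^ 4"
        using has_index_of_scale[OF U mn(2) sc] by blast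
      have "has_index (add_multiples S m \<inter> add_multiples S n) (a * b)"
        by (rule has_index_Int[OF U a(1) sc U b(1) sc mn(3)])
      hence ab: "a * b = m * n" unfolding key[OF S0] using S(2) has_index_unique by blast
      \<comment> \<open>So far only \<open>a dvd m ^ 4\<close> and \<open>b dvd n ^ 4\<close> are
        known; coprimality together with \<open>a * b = m * n\<close> forces \<open>a = m\<close>
        and \<open>b = n\<close>.\<close>
      have "coprime (m ^ 4) n" "coprime (n ^ 4) m" using mn(3) by (simp_all add: coprime_commute)
      hence "coprime a n" "coprime b m" using a(2) b(2) by (meson coprime_divisors dvd_refl)+
      moreover have "a dvd m * n" "b dvd m * n" using ab by (metis dvd_triv_left, metis dvd_triv_right)
      ultimately have ad: "a dvd m" and bd: "b dvd n"
        by (simp_all add: coprime_dvd_mult_left_iff coprime_dvd_mult_right_iff)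
      obtain m' n' where mn': "m = a * m'" "n = b * n'" using ad bd by blast
      have "a * b * (m' * n') = a * b * 1" using ab mn' by (simp add: mult_ac)
      hence "m' * n' = 1" using mn ab by (metis mult_cancel1 mult_eq_0_iff neq0_conv)
      hence "a = m" "b = n" using mn' by auto
      thus "q \<in> rings_of_index m \<times> rings_of_index n" unfolding q rings_of_index_def using U a b by simp
    qed
    show "(\<lambda>(S, S'). S \<inter> S') ` (rings_of_index m \<times> rings_of_index n) \<subseteq> rings_of_index (m * n)"
    proof safe
      fix S S' assume S0: "S \<in> rings_of_index m" "S' \<in> rings_of_index n"
      thus "S \<inter> S' \<in> rings_of_index (m * n)"
        using has_index_Int[OF _ _ index_scale_mem[OF S0(1)] _ _ index_scale_mem[OF S0(2)] mn(3)]
            unital_subring_Int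
        unfolding rings_of_index_def by blast
    qed
    show "\<forall>q\<in>rings_of_index m \<times> rings_of_index n.
       (add_multiples ((\<lambda>(S, S'). S \<inter> S') q) m, add_multiples ((\<lambda>(S, S'). S \<inter> S') q) n) = q"
    proof
      fix q assume "q \<in> rings_of_index m \<times> rings_of_index n"
      then obtain S S' where q: "q = (S, S')" and S0: "S \<in> rings_of_index m" "S' \<in> rings_of_index n" by blast
      have S: "unital_subring S" "unital_subring S'" using S0 by (auto simp: rings_of_index_def)
      have "x \<in> add_multiples (S \<inter> S') m" if x: "x \<in> S" for x
      proof -
        have "(s * int n) *s x \<in> S" using unital_subring_scale[OF S(1) x] by simp
        moreover have "(s * int n) *s x \<in> S'"
          using unital_subring_scale[OF S(2) index_scale_mem[OF S0(2), of x], of s] by (simp add: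
              vector_smult_assoc)
        moreover have "x = (s * int n) *s x + int m *s (r *s x)"
          using split[of x] by (simp add: vector_smult_assoc mult.commute add.commute)
        ultimately show ?thesis unfolding add_multiples_def by blast
      qed
      moreover have "add_multiples (S \<inter> S') m \<subseteq> S"
        unfolding add_multiples_def using unital_subringD(6)[OF S(1) _ index_scale_mem[OF S0(1)]] by auto
      ultimately have 1: "add_multiples (S \<inter> S') m = S" by blast
      have "x \<in> add_multiples (S \<inter> S') n" if x: "x \<in> S'" for x
      proof -
        have "(r * int m) *s x \<in> S'" using unital_subring_scale[OF S(2) x] by simp
        moreover have "(r * int m) *s x \<in> S"
          using unital_subring_scale[OF S(1) index_scale_mem[OF S0(1), of x], of r] by (simp add:
              vector_smult_assoc)
        moreover have "x = (r * int m) *s x + int n *s (s *s x)"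
          using split[of x] by (simp add: vector_smult_assoc mult.commute add.commute)
        ultimately show ?thesis unfolding add_multiples_def by blast
      qed
      moreover have "add_multiples (S \<inter> S') n \<subseteq> S'"
        unfolding add_multiples_def using unital_subringD(6)[OF S(2) _ index_scale_mem[OF S0(2)]] by auto
      ultimately have 2: "add_multiples (S \<inter> S') n = S'" by blast
      show "(add_multiples ((\<lambda>(S, S'). S \<inter> S') q) m, add_multiples ((\<lambda>(S, S'). S \<inter> S') q) n) = q"
        using 1 2 by (simp add: q)
    qed
  qed
  from bij_betw_same_card[OF this] show ?thesis by (simp add: card_cartesian_product)
qed

section \<open>From the counting function to the asymptotic formula\<close>

lemma N5_eq_summatory: "real (N5 x) = summatory (\<lambda>n. real (card (rings_of_index n))) x"
proof -
  have "{S. subring S Z5 \<and> finite (a_rcosets\<^bsub>Z5\<^esub> S) \<and> real (card (a_rcosets\<^bsub>Z5\<^esub> S)) \<le> x}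
      = (\<Union>n\<in>{1..nat \<lfloor>x\<rfloor>}. rings_of_index n)" (is "?L = ?R")
  proof safe
    fix S assume S: "subring S Z5" "finite (a_rcosets\<^bsub>Z5\<^esub> S)" "real (card (a_rcosets\<^bsub>Z5\<^esub> S)) \<le> x"
    define n where "n = card (a_rcosets\<^bsub>Z5\<^esub> S)"
    have h: "has_index S n" using S(2) unfolding has_index_def n_def a_rcosets_Z5 by simp
    have "n \<in> {1..nat \<lfloor>x\<rfloor>}" unfolding in_floor_range_iff using has_index_pos[OF h] S(3) n_def by simp
    thus "S \<in> ?R" using h S(1) by (auto simp: rings_of_index_def subring_Z5_iff)
  next
    fix S n assume n: "n \<in> {1..nat \<lfloor>x\<rfloor>}" and S: "S \<in> rings_of_index n"
    show "subring S Z5" using S by (simp add: rings_of_index_def subring_Z5_iff)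
    show "finite (a_rcosets\<^bsub>Z5\<^esub> S)" using S by (simp add: rings_of_index_def has_index_def a_rcosets_Z5)
    have "card (a_rcosets\<^bsub>Z5\<^esub> S) = n" using S by (simp add: rings_of_index_def has_index_def a_rcosets_Z5)
    thus "real (card (a_rcosets\<^bsub>Z5\<^esub> S)) \<le> x" using n unfolding in_floor_range_iff by simp
  qed
  hence "N5 x = card (\<Union>n\<in>{1..nat \<lfloor>x\<rfloor>}. rings_of_index n)" unfolding N5_def by simp
  also have "\<dots> = (\<Sum>n\<in>{1..nat \<lfloor>x\<rfloor>}. card (rings_of_index n))"
    using finite_rings_of_index has_index_unique
    by (intro card_UN_disjoint) (auto simp: rings_of_index_def)
  finally show ?thesis by (simp add: summatory_def)
qed

theorem theorem4p3:
  shows "\<exists>P :: real poly. Polynomial.degree P = 9 \<and>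
           (\<forall>\<epsilon>::real. \<epsilon> > 0 \<longrightarrow>
              (\<lambda>B::real. real (N5 B) - B * poly P (ln B)) \<in> O[at_top](\<lambda>B. B powr (33 / 34 + \<epsilon>)))"
proof -
  define f where "f = (\<lambda>n. real (card (rings_of_index n)))"
  have "multiplicative f"
    unfolding multiplicative_def f_def using rings_of_index_1 card_rings_mult by simp
  moreover have "f (p ^ k) \<le> 800 * (1 + real k) ^ 8 * real (p ^ (19 * (k - 1) div 20))" if "prime p" for p k
  proof -
    have "f (p ^ k) \<le> real (800 * (1 + k) ^ 8 * p ^ (19 * (k - 1) div 20))"
      unfolding f_def using card_rings_prime_power_le[OF that] by (simp only: of_nat_le_iff)
    thus ?thesis by simp
  qed
  ultimately obtain P :: "real poly" and C where P: "degree P = 9"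
    "\<And>x. x \<ge> 1 \<Longrightarrow> \<bar>summatory f x - x * poly P (ln x)\<bar> \<le> C * x powr (97 / 100)"
    using multiplicative_asymptotics[of f 800] card_rings_prime by (auto simp: f_def)
  show ?thesis
  proof (intro exI[of _ P] conjI allI impI P(1))
    fix \<epsilon> :: real assume \<epsilon>: "\<epsilon> > 0"
    show "(\<lambda>B::real. real (N5 B) - B * poly P (ln B)) \<in> O[at_top](\<lambda>B. B powr (33 / 34 + \<epsilon>))"
    proof (rule bigoI[of _ C])
      show "eventually (\<lambda>B::real. norm (real (N5 B) - B * poly P (ln B)) \<le> C * norm (B powr (33 / 34 +
          \<epsilon>))) at_top"
        using eventually_ge_at_top[of 1]
      proof eventually_elim
        case (elim B)
        have C0: "C \<ge> 0" using P(2)[of 1] by simp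
        have "norm (real (N5 B) - B * poly P (ln B)) \<le> C * B powr (97 / 100)"
          using P(2)[OF elim] unfolding N5_eq_summatory f_def by simp
        also have "\<dots> \<le> C * B powr (33 / 34 + \<epsilon>)"
          using elim C0 \<epsilon> by (intro mult_left_mono powr_mono) auto
        finally show ?case by simp
      qed
    qed
  qed
qed

end
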